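(* Let $Q$ be a non-empty set of primes and let $\mathcal{C}$ be an extension-closed pseudovariety of finite $Q'$-groups. Suppose that $F_1,F_2$ are $\mathcal{C}$-hereditarily conjugacy separable acylindrically hyperbolic groups with cyclic centralizers and without non-trivial finite normal subgroups, and $G\leqslant F_1\times F_2$ is a full subdirect product. Let $N_1:=G\cap F_1$. Then the following are equivalent: (a) $G$ is $\mathcal{C}$-conjugacy separable; (b) $F_1/N_1$ is a residually-$\mathcal{C}$ $Q'$-group; (c) $F_1/N_1$ is a residually-$\mathcal{C}$ periodic group.
   Context: A group is a $Q'$-group if every element has finite order which is coprime to each $q\in Q$. A pseudovariety of groups is a class of groups closed under isomorphisms, subgroups, direct products of two members, and quotients; it is a pseudovariety of finite $Q'$-groups if all its members are finite $Q'$-groups (it need not contain all of them), and extension-closed if any group $A$ with a normal subgroup $N$ such that $N\in\mathcal{C}$ and $A/N\in\mathcal{C}$ belongs to $\mathcal{C}$. The pro-$\mathcal{C}$ topology on a group $A$ has as basic open sets the cosets of the normal subgroups $N\lhd A$ with $A/N\in\mathcal{C}$. A group $A$ is $\mathcal{C}$-conjugacy separable if for any two non-conjugate elements $x,y\in A$ there are $M\in\mathcal{C}$ and a homomorphism $\varphi:A\to M$ such that $\varphi(x)$ and $\varphi(y)$ are not conjugate in $M$. $A$ is $\mathcal{C}$-hereditarily conjugacy separable if every subgroup of $A$ open in the pro-$\mathcal{C}$ topology on $A$ is $\mathcal{C}$-conjugacy separable. $A$ is residually-$\mathcal{C}$ if for every $g\in A\setminus\{1\}$ there are $M\in\mathcal{C}$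 and a homomorphism $\varphi:A\to M$ with $\varphi(g)\ne1$. $A$ has cyclic centralizers if the centralizer of every non-trivial element of $A$ is cyclic. A group is elementary if it has a cyclic subgroup of finite index. A group is acylindrically hyperbolic if it is non-elementary and admits an acylindrical cobounded isometric action on a (Gromov) hyperbolic metric space with unbounded orbits; an isometric action of $F$ on $(\mathcal{S},d)$ is acylindrical if for every $\varepsilon>0$ there are $R,N>0$ such that for all $x,y\in\mathcal{S}$ with $d(x,y)\ge R$ there are at most $N$ elements $g\in F$ with $d(x,gx)\le\varepsilon$ and $d(y,gy)\le\varepsilon$. In $F_1\times F_2$ one identifies $F_1$ with $F_1\times\{1\}$ and $F_2$ with $\{1\}\times F_2$. A subgroup $G\leqslant F_1\times F_2$ is a subdirect product if both coordinate projections map $G$ onto $F_1$ and $F_2$ respectively; it is a full subdirect product if in addition $G\cap F_i\neq\{1\}$ for $i=1,2$. For a subdirect product, $G\cap F_i\lhd F_i$. *)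

theory Defs
  imports "HOL-Analysis.Analysis" "HOL-Algebra.Algebra"
begin

section \<open>Orders of elements, conjugacy, centralizers\<close>

text \<open>\<^term>\<open>group.ord G x = 0\<close> means that \<open>x\<close> has infinite order.\<close>

definition periodic_group :: "('a, 'm) monoid_scheme \<Rightarrow> bool" where
  "periodic_group G \<longleftrightarrow> (\<forall>x \<in> carrier G. group.ord G x \<noteq> 0)"

definition coprime_order_group :: "nat set \<Rightarrow> ('a, 'm) monoid_scheme \<Rightarrow> bool" where
  "coprime_order_group Q G \<longleftrightarrow>
     (\<forall>x \<in> carrier G. group.ord G x \<noteq> 0 \<and> (\<forall>q \<in> Q. coprime (group.ord G x) q))"

definition conjugate_in :: "('a, 'm) monoid_scheme \<Rightarrow> 'a \<Rightarrow> 'a \<Rightarrow> bool" where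
  "conjugate_in G x y \<longleftrightarrow> (\<exists>g \<in> carrier G. y = g \<otimes>\<^bsub>G\<^esub> x \<otimes>\<^bsub>G\<^esub> inv\<^bsub>G\<^esub> g)"

definition centralizer :: "('a, 'm) monoid_scheme \<Rightarrow> 'a \<Rightarrow> 'a set" where
  "centralizer G x = {g \<in> carrier G. g \<otimes>\<^bsub>G\<^esub> x = x \<otimes>\<^bsub>G\<^esub> g}"

definition cyclic_centralizers :: "('a, 'm) monoid_scheme \<Rightarrow> bool" where
  "cyclic_centralizers G \<longleftrightarrow>
     (\<forall>x \<in> carrier G - {\<one>\<^bsub>G\<^esub>}. cyclic_group (G\<lparr>carrier := centralizer G x\<rparr>))"

section \<open>Pseudovarieties of finite groups\<close>

text \<open>
  An isomorphism-closed class of finite groups is determined by its members whose carrier is a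
  set of natural numbers (see \<open>finite_group_nat_copy\<close> below), so such a class is represented by a
  set \<open>C\<close> of groups over \<^typ>\<open>nat\<close>. A group over an arbitrary type belongs to the class when it is
  isomorphic to an element of \<open>C\<close>.
\<close>

definition belongs_to :: "('a, 'm) monoid_scheme \<Rightarrow> nat monoid set \<Rightarrow> bool" where
  "belongs_to G C \<longleftrightarrow> group G \<and> (\<exists>M \<in> C. G \<cong> M)"

lemma finite_group_nat_copy:
  fixes G :: "('a, 'm) monoid_scheme"
  assumes "group G" and "finite (carrier G)"
  shows "\<exists>M :: nat monoid. group M \<and> G \<cong> M"
proof -
  interpret group G by fact
  obtain f :: "'a \<Rightarrow> nat" where f: "inj_on f (carrier G)"
    using assms(2) finite_imp_inj_to_nat_seg by blast
  define h where "h = inv_into (carrier G) f"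
  have h: "h (f x) = x" if "x \<in> carrier G" for x
    using f that by (simp add: h_def)
  define M :: "nat monoid" where
    "M = \<lparr>carrier = f ` carrier G, mult = (\<lambda>x y. f (h x \<otimes>\<^bsub>G\<^esub> h y)), one = f \<one>\<^bsub>G\<^esub>\<rparr>"
  have "group M"
  proof (rule groupI)
    fix x assume "x \<in> carrier M"
    then obtain a where a: "a \<in> carrier G" "x = f a" by (auto simp: M_def)
    then have "f (inv\<^bsub>G\<^esub> a) \<in> carrier M \<and> f (inv\<^bsub>G\<^esub> a) \<otimes>\<^bsub>M\<^esub> x = \<one>\<^bsub>M\<^esub>"
      by (auto simp: M_def h)
    then show "\<exists>y\<in>carrier M. y \<otimes>\<^bsub>M\<^esub> x = \<one>\<^bsub>M\<^esub>" by blast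
  qed (auto simp: M_def h m_assoc)
  moreover have "f \<in> iso G M"
    using f by (auto simp: iso_def hom_def M_def h bij_betw_def)
  ultimately show ?thesis
    by (auto simp: is_iso_def)
qed

definition pseudovariety_of_finite_groups :: "nat monoid set \<Rightarrow> bool" where
  "pseudovariety_of_finite_groups C \<longleftrightarrow>
     (\<forall>M \<in> C. group M \<and> finite (carrier M)) \<and>
     (\<forall>M \<in> C. \<forall>M' :: nat monoid. group M' \<and> M \<cong> M' \<longrightarrow> M' \<in> C) \<and>
     (\<forall>M \<in> C. \<forall>H. subgroup H M \<longrightarrow> M\<lparr>carrier := H\<rparr> \<in> C) \<and>
     (\<forall>M \<in> C. \<forall>M' \<in> C. belongs_to (M \<times>\<times> M') C) \<and>
     (\<forall>M \<in> C. \<forall>N. N \<lhd> M \<longrightarrow> belongs_to (M Mod N) C)"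

definition pseudovariety_of_finite_coprime_order_groups ::
    "nat set \<Rightarrow> nat monoid set \<Rightarrow> bool" where
  "pseudovariety_of_finite_coprime_order_groups Q C \<longleftrightarrow>
     pseudovariety_of_finite_groups C \<and> (\<forall>M \<in> C. coprime_order_group Q M)"

text \<open>
  An extension of a finite group by a finite group is finite, so it suffices to let \<open>A\<close> range over
  groups over \<^typ>\<open>nat\<close>.
\<close>

definition extension_closed :: "nat monoid set \<Rightarrow> bool" where
  "extension_closed C \<longleftrightarrow>
     (\<forall>(A :: nat monoid) N. group A \<and> N \<lhd> A \<and> A\<lparr>carrier := N\<rparr> \<in> C \<and> belongs_to (A Mod N) C
        \<longrightarrow> A \<in> C)"

section \<open>The pro-\<open>C\<close> topology and separability properties\<close>

text \<open>
  The whole group is the coset of \<open>A\<close> itself, whose quotient is trivial; it is listed separately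
  so that this is a topology on \<^term>\<open>carrier A\<close> even when \<open>C\<close> is empty.
\<close>

definition pro_topology :: "nat monoid set \<Rightarrow> ('a, 'm) monoid_scheme \<Rightarrow> 'a topology" where
  "pro_topology C A =
     topology_generated_by
       (insert (carrier A)
          {N #>\<^bsub>A\<^esub> a | N a. N \<lhd> A \<and> belongs_to (A Mod N) C \<and> a \<in> carrier A})"

definition conjugacy_separable :: "nat monoid set \<Rightarrow> ('a, 'm) monoid_scheme \<Rightarrow> bool" where
  "conjugacy_separable C A \<longleftrightarrow>
     (\<forall>x \<in> carrier A. \<forall>y \<in> carrier A. \<not> conjugate_in A x y \<longrightarrow>
        (\<exists>M \<in> C. \<exists>\<phi> \<in> hom A M. \<not> conjugate_in M (\<phi> x) (\<phi> y)))"

definition hereditarily_conjugacy_separable ::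
    "nat monoid set \<Rightarrow> ('a, 'm) monoid_scheme \<Rightarrow> bool" where
  "hereditarily_conjugacy_separable C A \<longleftrightarrow>
     (\<forall>H. subgroup H A \<and> openin (pro_topology C A) H \<longrightarrow>
        conjugacy_separable C (A\<lparr>carrier := H\<rparr>))"

definition residually :: "nat monoid set \<Rightarrow> ('a, 'm) monoid_scheme \<Rightarrow> bool" where
  "residually C A \<longleftrightarrow>
     (\<forall>g \<in> carrier A - {\<one>\<^bsub>A\<^esub>}. \<exists>M \<in> C. \<exists>\<phi> \<in> hom A M. \<phi> g \<noteq> \<one>\<^bsub>M\<^esub>)"

section \<open>Acylindrically hyperbolic groups\<close>

definition elementary_group :: "('a, 'm) monoid_scheme \<Rightarrow> bool" where
  "elementary_group G \<longleftrightarrow>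
     (\<exists>H. subgroup H G \<and> cyclic_group (G\<lparr>carrier := H\<rparr>) \<and> finite (rcosets\<^bsub>G\<^esub> H))"

definition geodesic_segment :: "'s set \<Rightarrow> ('s \<Rightarrow> 's \<Rightarrow> real) \<Rightarrow> 's \<Rightarrow> 's \<Rightarrow> 's set \<Rightarrow> bool" where
  "geodesic_segment S d x y P \<longleftrightarrow>
     P \<subseteq> S \<and>
     (\<exists>\<gamma> :: real \<Rightarrow> 's. \<gamma> 0 = x \<and> \<gamma> (d x y) = y \<and> P = \<gamma> ` {0..d x y} \<and>
        (\<forall>s \<in> {0..d x y}. \<forall>t \<in> {0..d x y}. d (\<gamma> s) (\<gamma> t) = \<bar>s - t\<bar>))"

text \<open>
  As usual for acylindrical actions, hyperbolic spaces are geodesic; hyperbolicity is Rips'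
  condition that geodesic triangles are uniformly slim. Stating slimness for one side is enough,
  because the vertices may be permuted cyclically.
\<close>

definition hyperbolic_space :: "'s set \<Rightarrow> ('s \<Rightarrow> 's \<Rightarrow> real) \<Rightarrow> bool" where
  "hyperbolic_space S d \<longleftrightarrow>
     Metric_space S d \<and>
     (\<forall>x \<in> S. \<forall>y \<in> S. \<exists>P. geodesic_segment S d x y P) \<and>
     (\<exists>\<delta> \<ge> 0. \<forall>x \<in> S. \<forall>y \<in> S. \<forall>z \<in> S. \<forall>P1 P2 P3.
        geodesic_segment S d x y P1 \<and> geodesic_segment S d y z P2 \<and> geodesic_segment S d z x P3
        \<longrightarrow> (\<forall>p \<in> P1. \<exists>q \<in> P2 \<union> P3. d p q \<le> \<delta>))"

definition isometric_action ::
    "('a, 'm) monoid_scheme \<Rightarrow> 's set \<Rightarrow> ('s \<Rightarrow> 's \<Rightarrow> real) \<Rightarrow> ('a \<Rightarrow> 's \<Rightarrow> 's) \<Rightarrow> bool" where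
  "isometric_action F S d \<phi> \<longleftrightarrow>
     group_action F S \<phi> \<and>
     (\<forall>g \<in> carrier F. \<forall>x \<in> S. \<forall>y \<in> S. d (\<phi> g x) (\<phi> g y) = d x y)"

definition cobounded_action ::
    "('a, 'm) monoid_scheme \<Rightarrow> 's set \<Rightarrow> ('s \<Rightarrow> 's \<Rightarrow> real) \<Rightarrow> ('a \<Rightarrow> 's \<Rightarrow> 's) \<Rightarrow> bool" where
  "cobounded_action F S d \<phi> \<longleftrightarrow>
     (\<exists>B. Metric_space.mbounded S d B \<and> S = (\<Union>g \<in> carrier F. \<phi> g ` B))"

definition acylindrical_action ::
    "('a, 'm) monoid_scheme \<Rightarrow> 's set \<Rightarrow> ('s \<Rightarrow> 's \<Rightarrow> real) \<Rightarrow> ('a \<Rightarrow> 's \<Rightarrow> 's) \<Rightarrow> bool" where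
  "acylindrical_action F S d \<phi> \<longleftrightarrow>
     (\<forall>\<epsilon> > 0. \<exists>R > 0. \<exists>N > (0::nat). \<forall>x \<in> S. \<forall>y \<in> S. R \<le> d x y \<longrightarrow>
        finite {g \<in> carrier F. d x (\<phi> g x) \<le> \<epsilon> \<and> d y (\<phi> g y) \<le> \<epsilon>} \<and>
        card {g \<in> carrier F. d x (\<phi> g x) \<le> \<epsilon> \<and> d y (\<phi> g y) \<le> \<epsilon>} \<le> N)"

text \<open>
  HOL cannot quantify existentially over the type of the points of the hyperbolic space, so this
  type is a parameter. In a hypothesis \<^term>\<open>acylindrically_hyperbolic TYPE('s) F\<close> with a type
  variable \<open>'s\<close> not used elsewhere, the space is arbitrary.
\<close>

definition acylindrically_hyperbolic :: "'s itself \<Rightarrow> ('a, 'm) monoid_scheme \<Rightarrow> bool" where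
  "acylindrically_hyperbolic _ F \<longleftrightarrow>
     group F \<and> \<not> elementary_group F \<and>
     (\<exists>(S :: 's set) d \<phi>. S \<noteq> {} \<and> hyperbolic_space S d \<and> isometric_action F S d \<phi> \<and>
        acylindrical_action F S d \<phi> \<and> cobounded_action F S d \<phi> \<and>
        (\<forall>x \<in> S. \<not> Metric_space.mbounded S d (orbit F \<phi> x)))"

definition no_nontrivial_finite_normal_subgroups :: "('a, 'm) monoid_scheme \<Rightarrow> bool" where
  "no_nontrivial_finite_normal_subgroups G \<longleftrightarrow> (\<forall>N. N \<lhd> G \<and> finite N \<longrightarrow> N = {\<one>\<^bsub>G\<^esub>})"

section \<open>Subdirect products\<close>

definition subdirect_product ::
    "('a, 'm) monoid_scheme \<Rightarrow> ('b, 'n) monoid_scheme \<Rightarrow> ('a \<times> 'b) set \<Rightarrow> bool" where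
  "subdirect_product F1 F2 G \<longleftrightarrow>
     subgroup G (F1 \<times>\<times> F2) \<and> fst ` G = carrier F1 \<and> snd ` G = carrier F2"

definition full_subdirect_product ::
    "('a, 'm) monoid_scheme \<Rightarrow> ('b, 'n) monoid_scheme \<Rightarrow> ('a \<times> 'b) set \<Rightarrow> bool" where
  "full_subdirect_product F1 F2 G \<longleftrightarrow>
     subdirect_product F1 F2 G \<and>
     G \<inter> (carrier F1 \<times> {\<one>\<^bsub>F2\<^esub>}) \<noteq> {(\<one>\<^bsub>F1\<^esub>, \<one>\<^bsub>F2\<^esub>)} \<and>
     G \<inter> ({\<one>\<^bsub>F1\<^esub>} \<times> carrier F2) \<noteq> {(\<one>\<^bsub>F1\<^esub>, \<one>\<^bsub>F2\<^esub>)}"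

text \<open>The intersection of \<open>G\<close> with the first factor, viewed as a subset of that factor.\<close>

definition first_factor_part ::
    "('a, 'm) monoid_scheme \<Rightarrow> ('b, 'n) monoid_scheme \<Rightarrow> ('a \<times> 'b) set \<Rightarrow> 'a set" where
  "first_factor_part F1 F2 G = {x \<in> carrier F1. (x, \<one>\<^bsub>F2\<^esub>) \<in> G}"

end

theory Submission
  imports Defs
begin

text \<open>
  Let \<open>N\<^sub>i = G \<inter> F\<^sub>i\<close> and \<open>P = F\<^sub>1/N\<^sub>1 \<cong> G/(N\<^sub>1 \<times> N\<^sub>2) \<cong> F\<^sub>2/N\<^sub>2\<close>. Up to conjugation in \<open>G\<close> and up to
  pairs already separated in a factor, one has to separate \<open>(x\<^sub>1, x\<^sub>2)\<close> from \<open>(x\<^sub>1, f x\<^sub>2 f\<inverse>)\<close>; these are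
  conjugate in \<open>G\<close> iff the image of \<open>f\<close> in \<open>P\<close> lies in the product of the images of the centralizers of
  \<open>x\<^sub>1\<close> and \<open>x\<^sub>2\<close>. If \<open>P\<close> is residually \<open>C\<close> and periodic, this product of cyclic groups is finite, hence
  closed, and hereditary conjugacy separability of the factors lets finite quotients see the centralizers.

  Conversely, every coset \<open>h N\<^sub>i\<close> contains an element generating its own centralizer. For \<open>h = 1\<close> this
  provides \<open>x\<^sub>i\<close> whose centralizers die in \<open>P\<close>, so that separation in \<open>G\<close> separates \<open>f\<close> from \<open>1\<close> in \<open>P\<close>.
  If \<open>f\<close> had infinite order in \<open>P\<close>, choose for \<open>q \<in> Q\<close> such elements over \<open>f\<^sup>q\<close>: the pair is not
  conjugate in \<open>G\<close>, but in a quotient from \<open>C\<close> the image of \<open>f\<close> is a power of that of \<open>f\<^sup>q\<close>, because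
  its order is prime to \<open>q\<close>, and the two elements become conjugate.

  The elements generating their own centralizer are \<open>h g\<^sup>m\<close> for a loxodromic \<open>g\<close> in the normal subgroup
  and large \<open>m\<close>. Since the action is cobounded, the geometry is that of the left-invariant pseudometric
  which \<open>F\<close> inherits from an orbit, and it is used only through Gromov's four-point inequality.
\<close>

section \<open>Four-point inequality\<close>

text \<open>Two obstacles shape the geometric half. If \<open>h\<close> commutes with a power of
  \<open>g\<close> or inverts one, then \<open>h g^m\<close> may be a proper power or of finite
  order for every \<open>m\<close>. So \<open>h\<close> is first moved inside its coset until
  neither happens; were that impossible, all squares of elements of \<open>N\<close> would
  centralize \<open>g\<close>, and \<open>F\<close> would be elementary. Moreover a root
  \<open>v\<close> of \<open>w = h g^m\<close> comes with no bound on its length or on its exponent.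
  All constants are therefore fixed before \<open>v\<close> appears, and \<open>v\<close> is
  described only by the shift it causes as seen from a remote end \<open>w^-n\<close> of the line of
  powers of \<open>w\<close>; there \<open>n\<close> may depend on \<open>v\<close>, because the
  errors do not depend on \<open>n\<close>.

  In the algebraic half, extension-closure is what allows a return from subgroups. Conjugacy
  separability is applied to an open subgroup generated by some \<open>K\<close> and
  \<open>x\<close>, and the homomorphism found there need not extend to \<open>F\<close>. Its kernel
  on \<open>K\<close> has to be shrunk to a subgroup normal in \<open>F\<close>, whose quotient is
  then an extension of two members of \<open>C\<close>.\<close>

locale hyperbolic_pseudometric =
  fixes rho :: "'a \<Rightarrow> 'a \<Rightarrow> real" and delta :: real
  assumes rho_sym: "rho a b = rho b a"
    and rho_refl [simp]: "rho a a = 0"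
    and rho_triangle: "rho a b \<le> rho a e + rho e b"
    and four_point: "rho a b + rho e f \<le> max (rho a e + rho b f) (rho a f + rho b e) + delta"
begin

lemma rho_nonneg [simp]: "0 \<le> rho a b"
  using rho_triangle[of a a b] by (simp add: rho_sym)

lemma delta_nonneg [simp]: "0 \<le> delta"
  using four_point[of undefined undefined undefined undefined] by simp

text \<open>An inequality \<open>rho p z + rho z q \<le> rho p q + K\<close> says that \<open>z\<close> is close to a geodesic from \<open>p\<close> to \<open>q\<close>.\<close>
lemma near_line_dist:
  assumes "rho p z + rho z q \<le> rho p q + K" "rho p y + rho y q \<le> rho p q + K"
  shows "rho z y \<le> \<bar>rho p z - rho p y\<bar> + K + delta"
  using four_point[of z y p q] assms by (auto simp: rho_sym max_def abs_if split: if_splits)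

text \<open>Near-geodesics are quasi-convex. No order of \<open>a\<close> and \<open>b\<close> along
  the line from \<open>p\<close> to \<open>q\<close> is assumed, which is why every alternative of
  the two four-point inequalities has to be dealt with.\<close>

lemma near_line_between:
  assumes "rho p a + rho a q \<le> rho p q + K" "rho p b + rho b q \<le> rho p q + K"
    "rho a z + rho z b \<le> rho a b + K'" "0 \<le> K" "0 \<le> K'"
  shows "rho p z + rho z q \<le> rho p q + K + K' + 2 * delta"
proof -
  have sym: "rho z p = rho p z" "rho z a = rho a z" "rho p b = rho b p" "rho p a = rho a p" "rho q b = rho b q" "rho b z = rho z b" "rho q p = rho p q"
    by (rule rho_sym)+
  show ?thesis
    using four_point[of z p a b] four_point[of z q p b] assms delta_nonneg
      rho_triangle[of z q a] rho_triangle[of p z b]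
    unfolding sym max_def by argo
qed

text \<open>Here \<open>q\<close> is replaced by a point \<open>p\<close> in nearly the same direction from \<open>o'\<close>.\<close>
lemma near_line_redirect:
  assumes "rho o' z + rho z q \<le> rho o' q + K" "0 \<le> K"
    "2 * rho o' z + rho p q \<le> rho o' p + rho o' q"
  shows "rho o' z + rho z p \<le> rho o' p + K + delta"
  using four_point[of z p o' q] assms by (auto simp: rho_sym max_def split: if_splits)

text \<open>The ends are replaced one at a time. Since \<open>z\<close> is farther than about
  \<open>V\<close> from both of them, the alternative of the four-point inequality that involves the
  moved distance cannot be the larger one. The point of the lemma is that the loss is
  \<open>2 * delta\<close>, however large \<open>V\<close> is.\<close>

lemma near_line_shift:
  assumes "rho p z + rho z q \<le> rho p q + K"
    "rho p p' \<le> V" "rho q q' \<le> V"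
    "2 * V + K + 2 * delta < 2 * rho p z" "2 * V + K + 2 * delta < 2 * rho q z"
  shows "rho p' z + rho z q' \<le> rho p' q' + K + 2 * delta"
proof -
  have sym: "rho z p = rho p z" "rho q z = rho z q" "rho z p' = rho p' z" "rho p' p = rho p p'" "rho q' q = rho q q'"
    "rho q' p' = rho p' q'"
    by (rule rho_sym)+
  have 1: "rho z p' + rho z q \<le> rho p' q + K + delta"
    using four_point[of z p' p q] rho_triangle[of p z p'] assms delta_nonneg
    unfolding sym max_def by argo
  show ?thesis
    using 1 four_point[of z q' p' q] rho_triangle[of z q q'] assms delta_nonneg
    unfolding sym max_def by argo
qed

text \<open>Seen from far away, \<open>p\<close> and \<open>p'\<close> behave like one end of the
  space: the difference of the distances to them is, up to \<open>delta\<close>, the same at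
  \<open>z\<close> and \<open>y\<close>, like a difference of Busemann functions. The hypotheses
  exclude the pairing of \<open>p p'\<close> with \<open>z y\<close> from both maxima.\<close>

lemma displacement_const:
  assumes "rho p p' + rho z y + delta < rho p z + rho p' y"
    "rho p p' + rho z y + delta < rho p y + rho p' z"
  shows "\<bar>(rho p' z - rho p z) - (rho p' y - rho p y)\<bar> \<le> delta"
  using four_point[of p z p' y] four_point[of p y p' z] assms
  by (auto simp: rho_sym max_def abs_if split: if_splits)

end

section \<open>Groups with a hyperbolic left-invariant pseudometric\<close>

lemma (in group) inv_mult_cancel:
  assumes "x \<in> carrier G" "y \<in> carrier G"
  shows "x \<otimes> (inv x \<otimes> y) = y" "inv x \<otimes> (x \<otimes> y) = y"
  using assms by (simp_all add: m_assoc[symmetric])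

text \<open>This is what remains of the action on an orbit. Distinct elements may have distance 0,
  because the base point can have a stabilizer. Geodesics survive only as points near the line at
  any prescribed distance from \<open>\<one>\<close>, up to the error \<open>coarse\<close>, because
  an orbit of a cobounded action is only coarsely dense.\<close>

locale hyperbolic_group_metric = group F + hyperbolic_pseudometric rho delta
  for F :: "('a, 'm) monoid_scheme" (structure) and rho :: "'a \<Rightarrow> 'a \<Rightarrow> real" and delta :: real +
  fixes coarse :: real
  assumes left_inv: "\<lbrakk>g \<in> carrier F; a \<in> carrier F; b \<in> carrier F\<rbrakk> \<Longrightarrow> rho (g \<otimes> a) (g \<otimes> b) = rho a b"
    and coarse_geodesic: "\<lbrakk>a \<in> carrier F; 0 \<le> r; r \<le> rho \<one> a\<rbrakk> \<Longrightarrow>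
      \<exists>b\<in>carrier F. \<bar>rho \<one> b - r\<bar> \<le> coarse \<and> rho \<one> b + rho b a \<le> rho \<one> a + coarse"
    and acylindrical: "0 < \<epsilon> \<Longrightarrow> \<exists>R. \<exists>N::nat. \<forall>a\<in>carrier F. \<forall>b\<in>carrier F. R \<le> rho a b \<longrightarrow>
      finite {g \<in> carrier F. rho a (g \<otimes> a) \<le> \<epsilon> \<and> rho b (g \<otimes> b) \<le> \<epsilon>} \<and>
      card {g \<in> carrier F. rho a (g \<otimes> a) \<le> \<epsilon> \<and> rho b (g \<otimes> b) \<le> \<epsilon>} \<le> N"
    and unbounded: "\<exists>a\<in>carrier F. r < rho \<one> a"
begin

abbreviation len :: "'a \<Rightarrow> real" where "len a \<equiv> rho \<one> a"

lemma left_inv_inv: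
  assumes "g \<in> carrier F" "a \<in> carrier F" "b \<in> carrier F"
  shows "rho a (inv g \<otimes> b) = rho (g \<otimes> a) b" "rho (inv g \<otimes> b) a = rho b (g \<otimes> a)"
proof -
  show "rho a (inv g \<otimes> b) = rho (g \<otimes> a) b"
    using left_inv[of g a "inv g \<otimes> b"] assms by (simp add: m_assoc[symmetric])
  then show "rho (inv g \<otimes> b) a = rho b (g \<otimes> a)" by (simp add: rho_sym)
qed

lemma rho_inv_left: "g \<in> carrier F \<Longrightarrow> b \<in> carrier F \<Longrightarrow> rho (inv g) b = len (g \<otimes> b)"
  using left_inv_inv(2)[of g b \<one>] left_inv_inv(1)[of g b \<one>] by (simp add: rho_sym)

lemma rho_mult [simp]:
  assumes "a \<in> carrier F" "b \<in> carrier F"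
  shows "rho a (a \<otimes> b) = len b" "rho (a \<otimes> b) a = len b"
proof -
  show "rho a (a \<otimes> b) = len b" using left_inv[of a \<one> b] assms by simp
  then show "rho (a \<otimes> b) a = len b" by (simp add: rho_sym)
qed

lemma rho_eq_len:
  assumes "a \<in> carrier F" "b \<in> carrier F"
  shows "rho a b = len (inv a \<otimes> b)"
  using left_inv[of "inv a" a b] assms by simp

lemma len_inv [simp]: "a \<in> carrier F \<Longrightarrow> len (inv a) = len a"
  using left_inv[of a \<one> "inv a"] by (simp add: rho_sym)

lemma len_mult_le: "a \<in> carrier F \<Longrightarrow> b \<in> carrier F \<Longrightarrow> len (a \<otimes> b) \<le> len a + len b"
  using rho_triangle[of \<one> "a \<otimes> b" a] by simp

lemma len_pow_le: "a \<in> carrier F \<Longrightarrow> len (a [^] (n::nat)) \<le> n * len a"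
  by (induction n) (auto intro: order_trans[OF len_mult_le] simp: algebra_simps)

lemma rho_pow:
  assumes "w \<in> carrier F" "p \<le> q"
  shows "rho (w [^] (p::nat)) (w [^] q) = len (w [^] (q - p))"
  using rho_mult(1)[of "w [^] p" "w [^] (q - p)"] assms by (simp add: nat_pow_mult)

section \<open>Acylindricity and commutation of powers\<close>

lemma acylindrical_pigeonhole:
  assumes "0 < \<epsilon>"
  shows "\<exists>R. \<exists>N::nat. \<forall>a\<in>carrier F. \<forall>b\<in>carrier F. R \<le> rho a b \<longrightarrow>
    (\<forall>u::nat \<Rightarrow> 'a. (\<forall>i\<le>N. u i \<in> carrier F \<and> rho a (u i \<otimes> a) \<le> \<epsilon> \<and> rho b (u i \<otimes> b) \<le> \<epsilon>) \<longrightarrow>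
      (\<exists>i j. i < j \<and> j \<le> N \<and> u i = u j))"
proof -
  let ?X = "\<lambda>a b. {g \<in> carrier F. rho a (g \<otimes> a) \<le> \<epsilon> \<and> rho b (g \<otimes> b) \<le> \<epsilon>}"
  obtain R and N :: nat where
    RN: "\<forall>a\<in>carrier F. \<forall>b\<in>carrier F. R \<le> rho a b \<longrightarrow> finite (?X a b) \<and> card (?X a b) \<le> N"
    using acylindrical[OF assms] by (elim exE)
  have "\<exists>i j. i < j \<and> j \<le> N \<and> u i = u j"
    if ab: "a \<in> carrier F" "b \<in> carrier F" "R \<le> rho a b"
      and u: "\<forall>i\<le>N. u i \<in> carrier F \<and> rho a (u i \<otimes> a) \<le> \<epsilon> \<and> rho b (u i \<otimes> b) \<le> \<epsilon>" for a b u
  proof (rule ccontr)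
    assume no: "\<not> ?thesis"
    have "inj_on u {..N}"
      unfolding inj_on_def
    proof (intro ballI impI)
      fix i j assume "i \<in> {..N}" "j \<in> {..N}" "u i = u j"
      then show "i = j" using no by (cases i j rule: linorder_cases) (auto dest: sym)
    qed
    then have "card (u ` {..N}) = Suc N" by (simp add: card_image)
    moreover have "card (u ` {..N}) \<le> card (?X a b)"
      by (rule card_mono) (use RN ab u in auto)
    moreover have "card (?X a b) \<le> N" using RN ab by blast
    ultimately show False by simp
  qed
  then show ?thesis by blast
qed

text \<open>Pigeonhole: the elements \<open>g'\<^sup>-\<^sup>i v g\<^sup>i v\<inverse>\<close> all move the two distant points \<open>v\<close> and \<open>v g\<^sup>s\<close> by at most \<open>2 E\<close>.\<close>
lemma fellow_travel_commute:
  assumes g: "g \<in> carrier F" "g' \<in> carrier F" and unb: "\<And>r. \<exists>s::nat. r \<le> len (g [^] s)"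
  shows "\<exists>S::nat. \<forall>v\<in>carrier F. (\<forall>i\<le>S. rho (v \<otimes> g [^] i) (g' [^] i) \<le> E) \<longrightarrow>
    (\<exists>c>0. v \<otimes> g [^] (c::nat) = g' [^] c \<otimes> v)"
proof -
  have "0 < 2 * \<bar>E\<bar> + 1" by simp
  then obtain R and N :: nat where RN: "\<forall>a\<in>carrier F. \<forall>b\<in>carrier F. R \<le> rho a b \<longrightarrow>
     (\<forall>u::nat \<Rightarrow> 'a. (\<forall>i\<le>N. u i \<in> carrier F \<and> rho a (u i \<otimes> a) \<le> 2 * \<bar>E\<bar> + 1 \<and> rho b (u i \<otimes> b) \<le> 2 * \<bar>E\<bar> + 1) \<longrightarrow>
      (\<exists>i j. i < j \<and> j \<le> N \<and> u i = u j))"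
    by (elim acylindrical_pigeonhole[elim_format] exE)
  obtain s :: nat where s: "R \<le> len (g [^] s)" using unb by blast
  \<comment> \<open>\<open>N + s\<close> serves as \<open>S\<close>: the pigeonhole elements
    \<open>u i\<close> use exponents up to \<open>N\<close>, the test points \<open>v g^t\<close>
    exponents up to \<open>s\<close>, and the estimate of their displacement adds the two.\<close>
  have "\<exists>c>0. v \<otimes> g [^] (c::nat) = g' [^] c \<otimes> v"
    if v: "v \<in> carrier F" and close: "\<And>i. i \<le> N + s \<Longrightarrow> rho (v \<otimes> g [^] i) (g' [^] i) \<le> E" for v
  proof -
    define u where "u = (\<lambda>i::nat. inv (g' [^] i) \<otimes> (v \<otimes> g [^] i \<otimes> inv v))"
    have move: "u i \<otimes> (v \<otimes> g [^] t) = inv (g' [^] i) \<otimes> (v \<otimes> g [^] (i + t))" for i t :: nat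
    proof -
      have "inv v \<otimes> (v \<otimes> g [^] t) = g [^] t" using g v by (simp add: m_assoc[symmetric])
      then show ?thesis using g v by (simp add: u_def m_assoc nat_pow_mult[symmetric])
    qed
    have est: "rho (v \<otimes> g [^] t) (u i \<otimes> (v \<otimes> g [^] t)) \<le> 2 * E" if "i \<le> N" "t \<le> s" for i t
    proof -
      have "rho (v \<otimes> g [^] t) (u i \<otimes> (v \<otimes> g [^] t)) = rho (g' [^] i \<otimes> (v \<otimes> g [^] t)) (v \<otimes> g [^] (i + t))"
        unfolding move using g v by (simp add: left_inv_inv)
      also have "\<dots> \<le> rho (g' [^] i \<otimes> (v \<otimes> g [^] t)) (g' [^] i \<otimes> g' [^] t) + rho (g' [^] (i + t)) (v \<otimes> g [^] (i + t))"
        using rho_triangle g by (simp add: nat_pow_mult)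
      also have "\<dots> \<le> E + E"
        using close[of t] close[of "i + t"] that g v by (simp add: left_inv rho_sym)
      finally show ?thesis by simp
    qed
    have "\<exists>i j. i < j \<and> j \<le> N \<and> u i = u j"
    proof (rule RN[rule_format, of v "v \<otimes> g [^] s"])
      fix i assume "i \<le> N"
      then show "u i \<in> carrier F \<and> rho v (u i \<otimes> v) \<le> 2 * \<bar>E\<bar> + 1 \<and>
          rho (v \<otimes> g [^] s) (u i \<otimes> (v \<otimes> g [^] s)) \<le> 2 * \<bar>E\<bar> + 1"
          using est[of i 0] est[of i s] g v by (auto simp: u_def)
    qed (use g v s in auto)
    then obtain i j where ij: "i < j" "u i = u j" by blast
    define c where "c = j - i"
    have j: "j = i + c" using ij by (simp add: c_def)
    have "inv (g' [^] i) \<otimes> (v \<otimes> g [^] i) = inv (g' [^] j) \<otimes> (v \<otimes> g [^] j)"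
      using move[of i 0] move[of j 0] ij g v by simp
    then have "g' [^] j \<otimes> (inv (g' [^] i) \<otimes> (v \<otimes> g [^] i)) = v \<otimes> g [^] j"
      using g v by (simp add: inv_mult_cancel)
    moreover have "g' [^] j = g' [^] c \<otimes> g' [^] i"
      using g by (simp add: j nat_pow_mult add.commute)
    moreover have "g [^] j = g [^] c \<otimes> g [^] i"
      using g by (simp add: j nat_pow_mult add.commute)
    moreover have "g' [^] c \<otimes> g' [^] i \<otimes> (inv (g' [^] i) \<otimes> (v \<otimes> g [^] i)) = g' [^] c \<otimes> v \<otimes> g [^] i"
    proof -
      have "g' [^] i \<otimes> (inv (g' [^] i) \<otimes> (v \<otimes> g [^] i)) = v \<otimes> g [^] i"
        using g v by (simp add: m_assoc[symmetric])
      then show ?thesis using g v by (simp add: m_assoc)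
    qed
    ultimately have "g' [^] c \<otimes> v \<otimes> g [^] i = v \<otimes> g [^] c \<otimes> g [^] i"
      using g v by (simp add: m_assoc)
    then have "v \<otimes> g [^] c = g' [^] c \<otimes> v" using g v by simp
    moreover have "c > 0" using ij by (simp add: c_def)
    ultimately show ?thesis by blast
  qed
  then show ?thesis by blast
qed

section \<open>Powers along a near-geodesic\<close>

text \<open>A local-to-global principle: \<open>A\<close> bounds twice the Gromov product of
  \<open>\<one>\<close> and \<open>w^2\<close> at the corner \<open>w\<close>, and the sides are
  long compared with it. The four-point inequality at \<open>\<one>\<close>, \<open>w^(n+1)\<close>,
  \<open>w^n\<close>, \<open>w^(n+2)\<close> passes the growth to the next power; its other
  alternative would contradict the growth already established.\<close>

lemma chain_growth:
  assumes w: "w \<in> carrier F" and A: "2 * len w - A \<le> len (w \<otimes> w)" "A + 2 * delta < len w"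
  shows "len (w [^] n) + len w - A - delta \<le> len (w [^] Suc n)"
proof (induction n)
  case 0
  then show ?case using len_mult_le[OF w w] A w delta_nonneg
    by (simp del: delta_nonneg)
next
  case (Suc n)
  have "len (w [^] Suc n) + rho (w [^] n) (w [^] Suc (Suc n)) \<le>
     max (len (w [^] n) + rho (w [^] Suc n) (w [^] Suc (Suc n))) (len (w [^] Suc (Suc n)) + rho (w [^] n) (w [^] Suc n)) + delta"
    using four_point[of \<one> "w [^] Suc n" "w [^] n" "w [^] Suc (Suc n)"] by (simp only: rho_sym[of "w [^] Suc n" "w [^] n"])
  moreover have "rho (w [^] n) (w [^] Suc (Suc n)) = len (w \<otimes> w)"
    using rho_mult(1)[of "w [^] n" "w \<otimes> w"] w by (simp add: m_assoc)
  moreover have "rho (w [^] n) (w [^] Suc n) = len w" for n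
    using rho_pow[OF w, of n "Suc n"] w by simp
  ultimately show ?case
    using Suc A delta_nonneg by (simp only: max_def) (smt (verit))
qed

text \<open>The error does not depend on the exponents, whereas adding up the losses of
  \<open>chain_growth\<close> would make it proportional to them. Growth on either side of
  \<open>w^i\<close> again rules out the wrong alternative of a single four-point
  inequality.\<close>

lemma chain_sum:
  assumes w: "w \<in> carrier F" and A: "2 * len w - A \<le> len (w \<otimes> w)" "A + 2 * delta < len w"
  shows "len (w [^] (i::nat)) + len (w [^] j) \<le> len (w [^] (i + j)) + A + 2 * delta"
proof (cases i)
  case 0
  then show ?thesis using len_mult_le[OF w w] A delta_nonneg by (simp del: delta_nonneg)
next
  case (Suc k)
  have "rho (w [^] k) (w [^] (Suc k + j)) = len (w [^] Suc j)"
    using rho_pow[OF w, of k "Suc k + j"] by (simp only: add_Suc add_Suc_right[symmetric] diff_add_inverse le_add1)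
  moreover have "rho (w [^] Suc k) (w [^] (Suc k + j)) = len (w [^] j)"
    using rho_pow[OF w, of "Suc k" "Suc k + j"] by simp
  moreover have "rho (w [^] Suc k) (w [^] k) = len w"
    using rho_pow[OF w, of k "Suc k"] w by (simp add: rho_sym)
  ultimately have "len (w [^] Suc k) + len (w [^] Suc j) \<le>
      max (len (w [^] k) + len (w [^] j)) (len (w [^] (Suc k + j)) + len w) + delta"
    using four_point[of \<one> "w [^] Suc k" "w [^] k" "w [^] (Suc k + j)"] by (simp only: )
  then show ?thesis
    using chain_growth[OF w A, of k] chain_growth[OF w A, of j] A delta_nonneg
    unfolding Suc max_def by (simp only: split: if_splits)
qed

section \<open>Loxodromic elements in infinite normal subgroups\<close>

text \<open>A bound on the lengths in \<open>N\<close> is, by normality, a bound on how far elements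
  of \<open>N\<close> move any point. Infinitely many elements would then move two distant points by
  a bounded amount, against acylindricity.\<close>

lemma normal_len_unbounded:
  assumes "N \<lhd> F" "infinite N"
  shows "\<exists>g\<in>N. r < len g"
proof (rule ccontr)
  assume "\<not> ?thesis"
  then have small: "len g \<le> \<bar>r\<bar> + 1" if "g \<in> N" for g using that by fastforce
  interpret normal N F by fact
  have "0 < \<bar>r\<bar> + 1" by simp
  then obtain R and M :: nat where RM: "\<forall>a\<in>carrier F. \<forall>b\<in>carrier F. R \<le> rho a b \<longrightarrow>
      finite {g \<in> carrier F. rho a (g \<otimes> a) \<le> \<bar>r\<bar> + 1 \<and> rho b (g \<otimes> b) \<le> \<bar>r\<bar> + 1} \<and>
      card {g \<in> carrier F. rho a (g \<otimes> a) \<le> \<bar>r\<bar> + 1 \<and> rho b (g \<otimes> b) \<le> \<bar>r\<bar> + 1} \<le> M"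
    by (elim acylindrical[elim_format] exE)
  obtain a where a: "a \<in> carrier F" "R < len a" using unbounded by blast
  have "rho b (g \<otimes> b) \<le> \<bar>r\<bar> + 1" if "b \<in> carrier F" "g \<in> N" for b g
    using small[of "inv b \<otimes> g \<otimes> b"] inv_op_closed1[of b g] that
    by (simp add: rho_eq_len[of b "g \<otimes> b"] m_assoc)
  then have "N \<subseteq> {g \<in> carrier F. rho \<one> (g \<otimes> \<one>) \<le> \<bar>r\<bar> + 1 \<and> rho a (g \<otimes> a) \<le> \<bar>r\<bar> + 1}"
    using a by auto
  moreover have "finite {g \<in> carrier F. rho \<one> (g \<otimes> \<one>) \<le> \<bar>r\<bar> + 1 \<and> rho a (g \<otimes> a) \<le> \<bar>r\<bar> + 1}"
    using RM[rule_format, of \<one> a] a by simp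
  ultimately show False using assms(2) finite_subset by blast
qed

text \<open>
  Otherwise all elements \<open>g\<close> of \<open>N\<close> fold a long geodesic from \<open>1\<close> to \<open>g\<close> in the middle, and then each \<open>f\<close> in
  \<open>N\<close> moves the points far out on such a geodesic by a bounded amount, contradicting acylindricity.
\<close>
lemma normal_has_loxodromic:
  assumes N: "N \<lhd> F" "infinite N"
  shows "\<exists>g\<in>N. len g + B \<le> len (g \<otimes> g)"
proof (rule ccontr)
  assume "\<not> ?thesis"
  then have nonlox: "len (g \<otimes> g) < len g + B" if "g \<in> N" for g using that by force
  interpret normal N F by (rule N)
  \<comment> \<open>The negated claim, applied to the conjugate of \<open>f\<close> by
    \<open>z\<close>, becomes a statement about \<open>f\<close> with base point
    \<open>z\<close>.\<close>
  have nonlox_at: "rho z (f \<otimes> (f \<otimes> z)) < rho z (f \<otimes> z) + B" if "f \<in> N" "z \<in> carrier F" for f z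
  proof -
    have "(inv z \<otimes> f \<otimes> z) \<otimes> (inv z \<otimes> f \<otimes> z) = inv z \<otimes> (f \<otimes> (f \<otimes> z))"
      using that by (simp add: m_assoc inv_mult_cancel)
    then show ?thesis
      using nonlox[of "inv z \<otimes> f \<otimes> z"] inv_op_closed1[of z f] that
      by (simp add: rho_eq_len[of z "f \<otimes> (f \<otimes> z)"] rho_eq_len[of z "f \<otimes> z"] m_assoc)
  qed
  have B: "0 < B" using nonlox[of \<one>] by simp
  have coarse: "0 \<le> coarse" using coarse_geodesic[of \<one> 0] by (auto intro: order_trans[OF rho_nonneg])
  define K where "K = coarse + 2 * delta"
  define \<epsilon> where "\<epsilon> = 2 * K + 3 * delta + B"
  have K: "0 \<le> K" using coarse delta_nonneg by (simp add: K_def del: delta_nonneg)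
  then have "0 < \<epsilon>" using B delta_nonneg unfolding \<epsilon>_def by linarith
  then obtain R and M :: nat where RM: "\<forall>a\<in>carrier F. \<forall>b\<in>carrier F. R \<le> rho a b \<longrightarrow>
      finite {g \<in> carrier F. rho a (g \<otimes> a) \<le> \<epsilon> \<and> rho b (g \<otimes> b) \<le> \<epsilon>} \<and>
      card {g \<in> carrier F. rho a (g \<otimes> a) \<le> \<epsilon> \<and> rho b (g \<otimes> b) \<le> \<epsilon>} \<le> M"
    by (elim acylindrical[elim_format] exE)
  obtain T where T: "finite T" "card T = Suc M" "T \<subseteq> N"
    using infinite_arbitrarily_large[OF N(2)] by blast
  define D where "D = sum len T"
  have D: "len f \<le> D" if "f \<in> T" for f
    unfolding D_def using member_le_sum[OF that, of len] T by simp
  have D0: "0 \<le> D" unfolding D_def by (simp add: sum_nonneg)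
  define r1 where "r1 = 2 * coarse + 4 * D + 4 * K + 4 * delta + B"
  \<comment> \<open>Points at distance about \<open>r1\<close> and \<open>r2\<close> from
    \<open>\<one>\<close> are at least \<open>R\<close> apart even after an error
    \<open>coarse\<close> in each of the two distances.\<close>
  define r2 where "r2 = r1 + \<bar>R\<bar> + 2 * coarse"
  \<comment> \<open>More than twice \<open>r2\<close>, so that the points chosen below lie in the
    first half of the line to \<open>g\<close>, the part which it shares with the line to
    \<open>f g\<close>. The term \<open>5 * D\<close> pays for the displacements by
    \<open>f\<close>.\<close>
  obtain g where g: "g \<in> N" "2 * r2 + 2 * coarse + 5 * D + B + delta < len g"
    using normal_len_unbounded[OF N] by blast
  have small: "rho y (f \<otimes> y) \<le> \<epsilon>"
    if f: "f \<in> T" and y: "y \<in> carrier F" "\<bar>len y - r\<bar> \<le> coarse" "len y + rho y g \<le> len g + coarse"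
      and r: "r1 \<le> r" "r \<le> r2" for f y r
  proof -
    have fN: "f \<in> N" and fC: "f \<in> carrier F" and gC: "g \<in> carrier F" using T f g by auto
    have fD: "len f \<le> D" using D f .
    have fgN: "f \<otimes> g \<in> N" using fN g by simp
    have fg: "len (f \<otimes> g) \<le> len g + D" "len g - D \<le> len (f \<otimes> g)"
      using rho_triangle[of \<one> "f \<otimes> g" f] rho_triangle[of f "f \<otimes> g" \<one>] fD fC gC
      by (simp_all add: rho_sym)
    \<comment> \<open>As \<open>g g\<close> is short, the lines from \<open>\<one>\<close> to
      \<open>g\<close> and to \<open>inv g\<close> agree for about half their length. The same holds
      for \<open>f g\<close> and its inverse, which is within \<open>len f\<close> of
      \<open>inv g\<close>. Hence the lines to \<open>g\<close> and \<open>f g\<close> share about a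
      first half as well.\<close>
    have step1: "rho g (f \<otimes> g) \<le> len g + 2 * D + B + delta"
    proof -
      have 1: "rho g (inv g) = len (g \<otimes> g)" using left_inv_inv(1)[of g g \<one>] gC by (simp add: rho_sym)
      have "rho (f \<otimes> g) (inv (f \<otimes> g)) = len (f \<otimes> g \<otimes> (f \<otimes> g))"
        using left_inv_inv(1)[of "f \<otimes> g" "f \<otimes> g" \<one>] gC fC by (simp add: rho_sym)
      moreover have "rho (inv (f \<otimes> g)) (inv g) = len f"
        using rho_mult(2)[of "inv g" "inv f"] fC gC by (simp add: inv_mult_group)
      ultimately have 2: "rho (f \<otimes> g) (inv g) \<le> len (f \<otimes> g) + B + D"
        using rho_triangle[of "f \<otimes> g" "inv g" "inv (f \<otimes> g)"] nonlox[OF fgN] fD by simp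
      have 3: "rho g \<one> = len g" "rho (f \<otimes> g) \<one> = len (f \<otimes> g)" by (rule rho_sym)+
      show ?thesis
        using four_point[of g "f \<otimes> g" \<one> "inv g"] 1 2 3 nonlox[OF g(1)] fg gC D0 unfolding max_def
        by (simp split: if_splits)
    qed
    have sz: "rho (f \<otimes> y) \<one> = len (f \<otimes> y)" by (rule rho_sym)
    have fy: "len (f \<otimes> y) \<le> len y + D" "len y - D \<le> len (f \<otimes> y)"
      using rho_triangle[of \<one> "f \<otimes> y" f] rho_triangle[of f "f \<otimes> y" \<one>] fD fC y
      by (simp_all add: rho_sym)
    have step2: "len (f \<otimes> y) + rho (f \<otimes> y) (f \<otimes> g) \<le> len (f \<otimes> g) + (coarse + delta)"
    proof -
      have "rho (f \<otimes> y) \<one> + rho f (f \<otimes> g) \<le>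
          max (rho (f \<otimes> y) f + len (f \<otimes> g)) (rho (f \<otimes> y) (f \<otimes> g) + len f) + delta"
        using four_point[of "f \<otimes> y" \<one> f "f \<otimes> g"] by simp
      moreover have "rho (f \<otimes> y) (f \<otimes> g) = rho y g" using left_inv fC gC y by simp
      ultimately show ?thesis
        using fC gC y r fD D0 K coarse B delta_nonneg fy unfolding max_def sz r1_def
        by (simp del: delta_nonneg split: if_splits)
    qed
    have y': "len y \<le> r + coarse" "r - coarse \<le> len y" using y(2) by (simp_all add: abs_le_iff)
    have g2: "2 * r + 2 * coarse + 5 * D + B + delta < len g" using g(2) r by linarith
    have step3: "len (f \<otimes> y) + rho (f \<otimes> y) g \<le> len g + K"
    proof -
      have "2 * len (f \<otimes> y) + rho g (f \<otimes> g) \<le> len g + len (f \<otimes> g)"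
        using fy fg step1 g2 y' by linarith
      moreover have "0 \<le> coarse + delta" using coarse delta_nonneg by linarith
      ultimately show ?thesis
        using near_line_redirect[OF step2, of g] unfolding K_def by linarith
    qed
    have step4: "rho y (f \<otimes> y) \<le> \<bar>len y - len (f \<otimes> y)\<bar> + K + delta"
      by (rule near_line_dist[OF _ step3]) (use y K_def delta_nonneg in linarith)
    have inv_f: "rho (inv f) x = len (f \<otimes> x)" if "x \<in> carrier F" for x
      using left_inv_inv(2)[of f x \<one>] fC that by simp
    have ffy: "len (f \<otimes> y) - D \<le> len (f \<otimes> (f \<otimes> y))"
      using rho_triangle[of f "f \<otimes> (f \<otimes> y)" \<one>] fD fC y by (simp add: rho_sym)
    have fyfy: "\<bar>len y - len (f \<otimes> y)\<bar> \<le> D" using fy by linarith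
    have e: "rho (inv f) y = len (f \<otimes> y)" "rho (inv f) (f \<otimes> y) = len (f \<otimes> (f \<otimes> y))" "len (inv f) = len f"
      using inv_f fC y by simp_all
    \<comment> \<open>Distances to \<open>inv f\<close> are lengths after applying \<open>f\<close>.
      So this says that \<open>f\<close> changes the lengths of \<open>y\<close> and of
      \<open>f y\<close> by nearly the same amount.\<close>
    have "\<bar>(rho (inv f) y - len y) - (rho (inv f) (f \<otimes> y) - len (f \<otimes> y))\<bar> \<le> delta"
    proof (rule displacement_const)
      show "len (inv f) + rho y (f \<otimes> y) + delta < len y + rho (inv f) (f \<otimes> y)"
        unfolding e using step4 fyfy ffy fy fD y' r(1) D0 K B coarse delta_nonneg unfolding r1_def by linarith
      show "len (inv f) + rho y (f \<otimes> y) + delta < len (f \<otimes> y) + rho (inv f) y"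
        unfolding e using step4 fyfy ffy fy fD y' r(1) D0 K B coarse delta_nonneg unfolding r1_def by linarith
    qed
    then have step5: "\<bar>2 * len (f \<otimes> y) - len y - len (f \<otimes> (f \<otimes> y))\<bar> \<le> delta"
      unfolding e by linarith
    have "\<bar>len (f \<otimes> (f \<otimes> y)) - len y\<bar> \<le> rho y (f \<otimes> (f \<otimes> y))"
      using rho_triangle[of \<one> y "f \<otimes> (f \<otimes> y)"] rho_triangle[of \<one> "f \<otimes> (f \<otimes> y)" y]
      by (simp add: rho_sym abs_le_iff)
    \<comment> \<open>If \<open>f\<close> changes the length of \<open>y\<close> by \<open>a\<close>
      in absolute value, then \<open>f\<close> applied twice changes it by about \<open>2 a\<close>,
      while \<open>nonlox_at\<close> keeps \<open>f (f y)\<close> almost as close to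
      \<open>y\<close> as \<open>f y\<close> is. With \<open>step4\<close> this gives
      \<open>2 a - delta \<le> a + K + delta + B\<close>, hence the value of
      \<open>\<epsilon>\<close>.\<close>
    then show ?thesis
      using nonlox_at[OF fN y(1)] step4 step5 unfolding \<epsilon>_def by linarith
  qed
  have r: "0 \<le> r1" "r1 \<le> r2" using D0 K B coarse delta_nonneg unfolding r1_def r2_def by linarith+
  then have r3: "r2 \<le> len g" using g(2) D0 B coarse delta_nonneg by linarith
  have gC: "g \<in> carrier F" using g by simp
  obtain y1 where y1: "y1 \<in> carrier F" "\<bar>len y1 - r1\<bar> \<le> coarse" "len y1 + rho y1 g \<le> len g + coarse"
    using coarse_geodesic[OF gC, of r1] r r3 by auto
  obtain y2 where y2: "y2 \<in> carrier F" "\<bar>len y2 - r2\<bar> \<le> coarse" "len y2 + rho y2 g \<le> len g + coarse"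
    using coarse_geodesic[OF gC, of r2] r r3 by auto
  have "R \<le> rho y1 y2"
    using rho_triangle[of \<one> y2 y1] y1(2) y2(2) unfolding r2_def by linarith
  then have fin: "finite {g \<in> carrier F. rho y1 (g \<otimes> y1) \<le> \<epsilon> \<and> rho y2 (g \<otimes> y2) \<le> \<epsilon>}"
    "card {g \<in> carrier F. rho y1 (g \<otimes> y1) \<le> \<epsilon> \<and> rho y2 (g \<otimes> y2) \<le> \<epsilon>} \<le> M"
    using RM[rule_format, of y1 y2] y1(1) y2(1) by simp_all
  have "T \<subseteq> {g \<in> carrier F. rho y1 (g \<otimes> y1) \<le> \<epsilon> \<and> rho y2 (g \<otimes> y2) \<le> \<epsilon>}"
    using small[OF _ y1] small[OF _ y2] r T by auto
  then have "card T \<le> card {g \<in> carrier F. rho y1 (g \<otimes> y1) \<le> \<epsilon> \<and> rho y2 (g \<otimes> y2) \<le> \<epsilon>}"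
    by (rule card_mono[OF fin(1)])
  then show False using fin(2) T(2) by simp
qed

section \<open>Products with high powers of a loxodromic element\<close>

text \<open>A criterion visible on the first two powers. The margin is chosen so that
  \<open>chain_growth\<close> applies with \<open>A = len g - 2 * delta - 1\<close> and gives growth
  by at least 1 with each power.\<close>

definition loxodromic :: "'a \<Rightarrow> bool" where
  "loxodromic g \<longleftrightarrow> g \<in> carrier F \<and> len g + 2 * delta + 1 \<le> len (g \<otimes> g)"

lemma loxodromic_growth:
  assumes "loxodromic g"
  shows "len (g [^] n) + 1 \<le> len (g [^] Suc n)"
  using chain_growth[of g "len g - 2 * delta - 1" n] assms delta_nonneg unfolding loxodromic_def by linarith

lemma loxodromic_sum:
  assumes "loxodromic g"
  shows "len (g [^] (i::nat)) + len (g [^] j) \<le> len (g [^] (i + j)) + (len g + delta)"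
  using chain_sum[of g "len g - 2 * delta - 1" i j] assms delta_nonneg unfolding loxodromic_def by linarith

lemma loxodromic_mono:
  assumes "loxodromic g" "i \<le> j"
  shows "len (g [^] (i::nat)) \<le> len (g [^] j)"
  using assms(2)
proof (induction j rule: dec_induct)
  case (step n)
  then show ?case using loxodromic_growth[OF assms(1), of n] by linarith
qed simp

lemma loxodromic_ge:
  assumes "loxodromic g"
  shows "real n \<le> len (g [^] n)"
proof (induction n)
  case (Suc n)
  then show ?case using loxodromic_growth[OF assms(1), of n] by linarith
qed simp

lemma loxodromic_unbounded:
  assumes "loxodromic g"
  shows "\<exists>s::nat. r \<le> len (g [^] s)"
  using loxodromic_ge[OF assms] real_arch_simple[of r] order_trans by blast

lemma len_inv_pow: "g \<in> carrier F \<Longrightarrow> len (inv g [^] (n::nat)) = len (g [^] n)"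
  by (simp add: nat_pow_inv)

lemma rho_inv_pow:
  assumes "g \<in> carrier F" "i \<le> m"
  shows "rho (inv g [^] (m::nat)) (inv g [^] i) = len (g [^] (m - i))"
  using rho_pow[of "inv g" i m] assms by (simp add: len_inv_pow rho_sym)

text \<open>If \<open>h\<close> does not turn a power of \<open>g\<close> into its inverse, then \<open>h\<close> does not map the forward end of \<open>g\<close> to its backward end.\<close>
lemma no_flip_separation:
  assumes g: "loxodromic g" and h: "h \<in> carrier F"
    and noflip: "\<And>c::nat. 0 < c \<Longrightarrow> h \<otimes> g [^] c \<noteq> inv g [^] c \<otimes> h"
  shows "\<exists>A\<ge>0. \<forall>m::nat. 2 * len (g [^] m) - A \<le> rho (inv g [^] m) (h \<otimes> g [^] m)"
proof -
  let ?a = "\<lambda>j::nat. len (g [^] j)" and ?z = "\<lambda>j::nat. inv g [^] j"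
  have gC: "g \<in> carrier F" using g by (simp add: loxodromic_def)
  define H where "H = len h"
  define L where "L = len g + delta"
  have H: "0 \<le> H" and L: "0 \<le> L" using delta_nonneg by (simp_all add: H_def L_def add_nonneg_nonneg)
  define K where "K = 2 * H + L + delta"
  obtain S :: nat where S: "\<forall>v\<in>carrier F. (\<forall>i\<le>S. rho (v \<otimes> g [^] i) (?z i) \<le> H + K + delta) \<longrightarrow>
    (\<exists>c>0. v \<otimes> g [^] (c::nat) = ?z c \<otimes> v)"
    using fellow_travel_commute[OF gC inv_closed[OF gC] loxodromic_unbounded[OF g], of "H + K + delta"]
    by (elim exE)
  \<comment> \<open>With this value, a distance below \<open>2 * ?a m - A\<close> forces the Gromov
    product of the ends \<open>inv g^m\<close> and \<open>h g^m\<close> at \<open>\<one>\<close> to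
    be at least the length of every \<open>h g^i\<close> with \<open>i \<le> S\<close>. The two rays
    then travel together up to \<open>S\<close>, and \<open>fellow_travel_commute\<close> with
    \<open>g' = inv g\<close> produces a forbidden flip.\<close>
  define A where "A = 2 * ?a S + 3 * H"
  have "2 * ?a m - A \<le> rho (?z m) (h \<otimes> g [^] m)" for m :: nat
  proof (rule ccontr)
    let ?p = "?z m" and ?q = "h \<otimes> g [^] m"
    assume "\<not> ?thesis"
    then have pq: "rho ?p ?q < 2 * ?a m - A" by simp
    have mS: "S \<le> m"
    proof (rule ccontr)
      assume "\<not> S \<le> m"
      then have "?a m \<le> ?a S" by (simp add: loxodromic_mono[OF g])
      then show False using pq H rho_nonneg[of ?p ?q] unfolding A_def by linarith
    qed
    have q: "?a m - H \<le> len ?q"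
      using rho_triangle[of h ?q \<one>] h gC unfolding H_def by (simp add: rho_sym)
    have "rho (h \<otimes> g [^] i) (?z i) \<le> H + K + delta" if i: "i \<le> S" for i
    proof -
      have z: "len (h \<otimes> g [^] i) \<le> H + ?a i" "?a i - H \<le> len (h \<otimes> g [^] i)"
        using len_mult_le[of h "g [^] i"] rho_triangle[of h "h \<otimes> g [^] i" \<one>] h gC unfolding H_def
        by (simp_all add: rho_sym)
      have iS: "?a i \<le> ?a S" using loxodromic_mono[OF g i] .
      have sum: "?a i + ?a (m - i) \<le> ?a m + L"
        using loxodromic_sum[OF g, of i "m - i"] i mS unfolding L_def by simp
      have "rho (h \<otimes> g [^] i) ?q = ?a (m - i)"
        using left_inv[of h "g [^] i" "g [^] m"] rho_pow[OF gC, of i m] i mS h gC by simp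
      then have 1: "len (h \<otimes> g [^] i) + rho (h \<otimes> g [^] i) ?q \<le> len ?q + (2 * H + L)"
        using z sum q by linarith
      have 2: "2 * len (h \<otimes> g [^] i) + rho ?p ?q \<le> len ?p + len ?q"
        using z iS pq q len_inv_pow[OF gC] unfolding A_def by (simp add: algebra_simps)
      have 3: "len (h \<otimes> g [^] i) + rho (h \<otimes> g [^] i) ?p \<le> len ?p + K"
        using near_line_redirect[OF 1 _ 2] H L unfolding K_def by simp
      have 4: "len (?z i) + rho (?z i) ?p \<le> len ?p + K"
        using sum rho_inv_pow[OF gC, of i m] i mS H len_inv_pow[OF gC] delta_nonneg unfolding K_def
        by (simp add: rho_sym del: delta_nonneg)
      show ?thesis
        using near_line_dist[OF 3 4] z len_inv_pow[OF gC, of i] by linarith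
    qed
    then have "\<exists>c>0. h \<otimes> g [^] (c::nat) = ?z c \<otimes> h" using S h by blast
    then show False using noflip by blast
  qed
  moreover have "0 \<le> A" using H by (simp add: A_def)
  ultimately show ?thesis by blast
qed

text \<open>
  The powers of \<open>w = h g\<^sup>m\<close> lie along a line, on which a root \<open>v\<close> with \<open>v\<^sup>k = w\<close> translates by at most about
  half the length of \<open>w\<close>. Hence \<open>v\<close> shifts the long segment \<open>g\<^sup>-\<^sup>m, \<dots>, g\<^sup>-\<^sup>1, 1\<close> of that line partly onto itself.
\<close>
lemma root_of_long_product_commutes:
  assumes g: "loxodromic g" and h: "h \<in> carrier F"
    and noflip: "\<And>c::nat. 0 < c \<Longrightarrow> h \<otimes> g [^] c \<noteq> inv g [^] c \<otimes> h"
  shows "\<exists>m::nat. h \<otimes> g [^] m \<noteq> \<one> \<and>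
    (\<forall>v\<in>carrier F. \<forall>k::nat. 2 \<le> k \<longrightarrow> v [^] k = h \<otimes> g [^] m \<longrightarrow>
      (\<exists>c>0. v \<otimes> g [^] (c::nat) = g [^] c \<otimes> v))"
proof -
  let ?a = "\<lambda>j::nat. len (g [^] j)" and ?z = "\<lambda>j::nat. inv g [^] j"
  have gC: "g \<in> carrier F" using g by (simp add: loxodromic_def)
  obtain A where A: "0 \<le> A" "\<forall>m::nat. 2 * ?a m - A \<le> rho (?z m) (h \<otimes> g [^] m)"
    using no_flip_separation[OF g h noflip] by blast
  define H where "H = len h"
  define L where "L = len g + delta"
  have d: "0 \<le> delta" by simp
  have H: "0 \<le> H" and L: "0 \<le> L" using d by (simp_all add: H_def L_def add_nonneg_nonneg)
  \<comment> \<open>\<open>A1\<close> is the corner defect of \<open>w\<close> required by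
    \<open>chain_growth\<close>: one \<open>H\<close> comes from replacing \<open>inv w\<close> by
    \<open>inv g^m\<close>, two from comparing \<open>len w\<close> with \<open>?a m\<close>. This
    constant and the following ones involve neither \<open>m\<close> nor \<open>v\<close> nor
    \<open>k\<close>, so \<open>S\<close> can be fixed before \<open>m\<close>.\<close>
  define A1 where "A1 = A + 3 * H"
  define c2 where "c2 = 2 * H + A1 + delta + L"
  define K2 where "K2 = A1 + 4 * delta + L + 2 * H"
  define K3 where "K3 = K2 + 2 * delta"
  define E where "E = 2 * L + c2 + 2 * delta + K3"
  have pos: "0 \<le> A1" "0 \<le> c2" "0 \<le> K2" "0 \<le> K3" using A H L d by (simp_all add: A1_def c2_def K2_def K3_def)
  obtain S :: nat where S: "\<forall>v\<in>carrier F. (\<forall>i\<le>S. rho (v \<otimes> g [^] i) (g [^] i) \<le> E) \<longrightarrow>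
    (\<exists>c>0. v \<otimes> g [^] (c::nat) = g [^] c \<otimes> v)"
    using fellow_travel_commute[OF gC gC loxodromic_unbounded[OF g], of E] by (elim exE)
  \<comment> \<open>A root shifts the line by at most about half of \<open>len w\<close>, so what
    remains of the segment of powers of \<open>g\<close> must still contain \<open>S\<close> steps;
    hence the factor 2. The other terms also make \<open>w\<close> long enough for
    \<open>chain_growth\<close>.\<close>
  obtain m :: nat where m: "2 * ?a S + 2 * L + 2 * delta + 2 * H + A1 + 2 * delta < ?a m"
    using loxodromic_unbounded[OF g] by (meson le_less_trans less_add_one order_less_le_trans)
  define w where "w = h \<otimes> g [^] m"
  have wC: "w \<in> carrier F" using h gC by (simp add: w_def)
  have b1: "len w \<le> ?a m + H" "?a m - H \<le> len w"
    using len_mult_le[of h "g [^] m"] rho_triangle[of h w \<one>] h gC unfolding H_def w_def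
    by (simp_all add: rho_sym)
  have winv: "inv w = ?z m \<otimes> inv h"
    using h gC by (simp add: w_def inv_mult_group nat_pow_inv)
  have winvg: "rho (inv w) (?z m) = H"
    using rho_mult(2)[of "?z m" "inv h"] gC h unfolding winv H_def by simp
  have "rho (inv w) w = len (w \<otimes> w)" using rho_inv_left wC by simp
  then have b2: "2 * len w - A1 \<le> len (w \<otimes> w)"
    using A(2)[rule_format, of m] rho_triangle[of "?z m" w "inv w"] winvg b1 unfolding w_def[symmetric] A1_def
    by (simp add: rho_sym)
  have lw: "A1 + 2 * delta < len w"
    using m b1 H L d rho_nonneg[of \<one> "g [^] S"] by linarith
  note growth = chain_growth[OF wC b2 lw] and sum = chain_sum[OF wC b2 lw]
  have mS: "S \<le> m"
  proof (rule ccontr)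
    assume "\<not> S \<le> m"
    then have "?a m \<le> ?a S" by (simp add: loxodromic_mono[OF g])
    then show False using m H L d pos rho_nonneg[of \<one> "g [^] S"] by linarith
  qed
  have wlox: "real n * (len w - A1 - delta) \<le> len (w [^] n)" for n
  proof (induction n)
    case (Suc n)
    then show ?case using growth[of n] by (simp add: algebra_simps)
  qed simp
  have "\<exists>c>0. v \<otimes> g [^] (c::nat) = g [^] c \<otimes> v"
    if v: "v \<in> carrier F" and k: "2 \<le> k" and vk: "v [^] k = w" for v and k :: nat
  proof -
    define V where "V = len v"
    have V: "0 \<le> V" by (simp add: V_def)
    \<comment> \<open>\<open>n\<close> is to put the ends \<open>w^-n\<close> and \<open>w^n\<close>
      beyond every point considered for this root, including \<open>v^i\<close> for
      \<open>i \<le> k\<close>; so \<open>Z\<close> may involve \<open>V\<close> and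
      \<open>k\<close>. Below, \<open>n\<close> is a successor so that \<open>inv w\<close> is a
      point at distance \<open>len (w^n0)\<close> from the end \<open>?p\<close>.\<close>
    define Z where "Z = k * V + ?a m + V + V + K2 + 2 * delta + len w + 1"
    obtain n0 :: nat where "Z < real n0 * (len w - A1 - delta)"
      using ex_less_of_nat_mult[of "len w - A1 - delta" Z] lw d by auto
    then have n0: "Z < len (w [^] n0)" using wlox[of n0] by linarith
    define n where "n = Suc n0"
    have n: "Z < len (w [^] n)" using n0 growth[of n0] lw d unfolding n_def by linarith
    let ?p = "inv w [^] n" and ?q = "w [^] n"
    have pC: "?p \<in> carrier F" and qC: "?q \<in> carrier F" using wC by auto
    have p1: "rho ?p \<one> = len ?q" using len_inv_pow[OF wC, of n] by (simp add: rho_sym)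
    have vw: "v \<otimes> w = w \<otimes> v" unfolding vk[symmetric] using v by (metis nat_pow_Suc nat_pow_Suc2)
    then have vinvw: "v \<otimes> inv w = inv w \<otimes> v"
      using v wC by (metis inv_closed inv_solve_left inv_solve_right m_assoc m_closed)
    have vq: "v \<otimes> ?q = ?q \<otimes> v" "v \<otimes> ?p = ?p \<otimes> v"
      using group_commutes_pow[of w v n] group_commutes_pow[of "inv w" v n] vw vinvw v wC by auto
    have Vq: "rho (v \<otimes> ?q) ?q = V" "rho (v \<otimes> ?p) ?p = V"
      unfolding vq V_def using v pC qC by simp_all
    have pq: "rho ?p ?q = len (w [^] (n + n))"
      using rho_inv_left[of "w [^] n" "w [^] n"] wC by (simp add: nat_pow_inv nat_pow_mult)
    \<comment> \<open>The translation of \<open>v\<close> along the line, measured as the change of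
      distance to the backward end \<open>?p\<close>.\<close>
    define t where "t = rho ?p v - rho ?p \<one>"
    have far: "len ?q - len z \<le> rho ?p z" "len ?q - len z \<le> rho ?q z" for z
      using rho_triangle[of ?p \<one> z] rho_triangle[of ?q \<one> z] p1 by (simp_all add: rho_sym)
    \<comment> \<open>Being a root of \<open>w\<close>, \<open>v\<close> commutes with
      \<open>w\<close> and moves the end \<open>?p\<close> by exactly \<open>V\<close>. Hence
      \<open>?p\<close> and \<open>inv v \<otimes> ?p\<close> are close compared with their distance
      to \<open>z\<close> and \<open>\<one>\<close>, and \<open>displacement_const\<close>
      applies.\<close>
    have shift: "\<bar>rho ?p (v \<otimes> z) - rho ?p z - t\<bar> \<le> delta"
      if z: "z \<in> carrier F" "len z \<le> k * V + ?a m" for z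
    proof -
      let ?p' = "inv v \<otimes> ?p"
      have e: "rho ?p' z = rho ?p (v \<otimes> z)" "rho ?p' \<one> = rho ?p v" "rho ?p ?p' = V"
        using left_inv_inv v z pC Vq by simp_all
      have vz: "len (v \<otimes> z) \<le> V + len z" using len_mult_le v z unfolding V_def by simp
      have "\<bar>(rho ?p' z - rho ?p z) - (rho ?p' \<one> - rho ?p \<one>)\<bar> \<le> delta"
      proof (rule displacement_const)
        show "rho ?p ?p' + rho z \<one> + delta < rho ?p z + rho ?p' \<one>"
          unfolding e using n far[of z] far[of v] z vz d V pos rho_sym[of z \<one>] rho_nonneg[of \<one> w]
          unfolding Z_def V_def[symmetric] by linarith
        show "rho ?p ?p' + rho z \<one> + delta < rho ?p \<one> + rho ?p' z"
          unfolding e p1 using n far[of "v \<otimes> z"] z vz d V pos rho_sym[of z \<one>] rho_nonneg[of \<one> w]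
          unfolding Z_def by linarith
      qed
      then show ?thesis unfolding e t_def by linarith
    qed
    have iter: "\<bar>rho ?p (v [^] i) - rho ?p \<one> - real i * t\<bar> \<le> real i * delta" if "i \<le> k" for i :: nat
      using that
    proof (induction i)
      case (Suc i)
      have "real i * V \<le> real k * V" using Suc V by (intro mult_right_mono) auto
      then have "len (v [^] i) \<le> k * V + ?a m"
        using len_pow_le[OF v, of i] rho_nonneg[of \<one> "g [^] m"] unfolding V_def by linarith
      then have "\<bar>rho ?p (v \<otimes> v [^] i) - rho ?p (v [^] i) - t\<bar> \<le> delta" using shift v by simp
      moreover have "v [^] Suc i = v \<otimes> v [^] i" using nat_pow_Suc2[OF v] .
      moreover have "\<bar>rho ?p (v [^] i) - rho ?p \<one> - real i * t\<bar> \<le> real i * delta" using Suc by simp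
      ultimately show ?case by (simp add: algebra_simps abs_le_iff)
    qed simp
    have pw: "rho ?p w = len (w [^] Suc n)"
      using rho_inv_left[of "w [^] n" w] wC by (simp add: nat_pow_inv)
    have kt: "\<bar>len (w [^] Suc n) - len (w [^] n) - real k * t\<bar> \<le> real k * delta"
      using iter[of k] unfolding vk pw p1 by simp
    have t1: "- delta \<le> t"
    proof (rule ccontr)
      assume "\<not> - delta \<le> t"
      then have "real k * (t + delta) \<le> 0" by (intro mult_nonneg_nonpos) auto
      then have "real k * t + real k * delta \<le> 0" by (simp add: algebra_simps)
      then show False using kt growth[of n] lw d by linarith
    qed
    have "len (w [^] Suc n) \<le> len (w [^] n) + len w" using len_mult_le[of "w [^] n" w] wC by simp
    then have kt2: "real k * (t - delta) \<le> len w" using kt by (simp add: algebra_simps abs_le_iff)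
    \<comment> \<open>The \<open>k\<close> shifts by about \<open>t\<close> make up the shift of
      \<open>w\<close>, which is at most \<open>len w\<close>, and \<open>k\<close> is at least 2.
      The errors \<open>real k * delta\<close> are absorbed by working with
      \<open>t - delta\<close>.\<close>
    have t2: "2 * t \<le> len w + 2 * delta"
    proof (cases "t \<le> delta")
      case False
      then have "2 * (t - delta) \<le> real k * (t - delta)" using k by (intro mult_right_mono) auto
      then show ?thesis using kt2 by (simp add: algebra_simps)
    next
      case True
      then show ?thesis using rho_nonneg[of \<one> w] by linarith
    qed
    \<comment> \<open>Both \<open>inv w\<close> and \<open>\<one>\<close> lie near the line, and the
      points \<open>inv g^j\<close> lie near the segment between them, because
      \<open>inv g^m\<close> is at distance \<open>H\<close> from \<open>inv w\<close>.\<close>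
    have near: "rho ?p (?z j) + rho (?z j) ?q \<le> rho ?p ?q + K2" if j: "j \<le> m" for j
    proof -
      have 1: "rho ?p (inv w) + rho (inv w) ?q \<le> rho ?p ?q + (A1 + 2 * delta)"
      proof -
        have "rho (inv w) ?q = len (w [^] Suc n)"
          using rho_inv_left[of w ?q] wC by (simp only: nat_pow_Suc2 nat_pow_closed)
        moreover have "rho ?p (inv w) = len (w [^] n0)"
          using rho_inv_pow[OF wC, of 1 n] wC by (simp add: n_def)
        moreover have "n0 + Suc n = n + n" by (simp add: n_def)
        ultimately show ?thesis using sum[of n0 "Suc n"] unfolding pq by (simp only: )
      qed
      have 2: "rho ?p \<one> + rho \<one> ?q \<le> rho ?p ?q + (A1 + 2 * delta)"
        unfolding p1 pq using sum[of n n] by simp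
      have 3: "rho (inv w) (?z j) + rho (?z j) \<one> \<le> rho (inv w) \<one> + (L + 2 * H)"
      proof -
        have "rho (inv w) (?z j) \<le> H + ?a (m - j)"
          using rho_triangle[of "inv w" "?z j" "?z m"] winvg rho_inv_pow[OF gC j] by simp
        moreover have "rho (?z j) \<one> = ?a j" "rho (inv w) \<one> = len w"
          using len_inv_pow[OF gC] len_inv[OF wC] by (simp_all add: rho_sym)
        moreover have "?a j + ?a (m - j) \<le> ?a m + L"
          using loxodromic_sum[OF g, of j "m - j"] j unfolding L_def by simp
        ultimately show ?thesis using b1 by linarith
      qed
      show ?thesis
        using near_line_between[OF 1 2 3] pos L H d unfolding K2_def by simp
    qed
    have position: "rho ?p (?z j) \<le> len ?q - ?a j + c2"
        "len ?q - ?a j \<le> rho ?p (?z j)" if j: "j \<le> m" for j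
    proof -
      have "rho ?p (inv w) = len (w [^] n0)"
        using rho_inv_pow[OF wC, of 1 n] wC by (simp add: n_def)
      moreover have "rho (inv w) (?z j) \<le> H + ?a (m - j)"
        using rho_triangle[of "inv w" "?z j" "?z m"] winvg rho_inv_pow[OF gC j] by simp
      moreover have "?a j + ?a (m - j) \<le> ?a m + L"
        using loxodromic_sum[OF g, of j "m - j"] j unfolding L_def by simp
      ultimately show "rho ?p (?z j) \<le> len ?q - ?a j + c2"
        using rho_triangle[of ?p "?z j" "inv w"] growth[of n0] b1 unfolding n_def[symmetric] c2_def by linarith
      show "len ?q - ?a j \<le> rho ?p (?z j)"
        using far(1)[of "?z j"] len_inv_pow[OF gC, of j] by simp
    qed
    \<comment> \<open>\<open>v\<close> maps the line to one with ends at distance \<open>V\<close>.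
      Here it matters that \<open>near_line_shift\<close> loses an amount independent of
      \<open>V\<close>.\<close>
    have nearv: "rho ?p (v \<otimes> ?z j) + rho (v \<otimes> ?z j) ?q \<le> rho ?p ?q + K3" if j: "j \<le> m" for j
    proof -
      let ?z = "?z j"
      have zC: "?z \<in> carrier F" using gC by simp
      have 1: "rho (v \<otimes> ?p) (v \<otimes> ?z) + rho (v \<otimes> ?z) (v \<otimes> ?q) \<le> rho (v \<otimes> ?p) (v \<otimes> ?q) + K2"
        using near[OF j] left_inv v pC qC zC by simp
      have "?a j \<le> ?a m" using loxodromic_mono[OF g j] .
      then have "2 * V + K2 + 2 * delta < 2 * rho ?p ?z" "2 * V + K2 + 2 * delta < 2 * rho ?q ?z"
        using far[of ?z] len_inv_pow[OF gC, of j] n V pos d mult_nonneg_nonneg[of "real k" V] rho_nonneg[of \<one> w] rho_nonneg[of \<one> "g [^] m"]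
        unfolding Z_def by linarith+
      then show ?thesis
        using near_line_shift[OF 1, of ?p V ?q] Vq left_inv v pC qC zC unfolding K3_def by (simp add: add.assoc)
    qed
    \<comment> \<open>The maximal element \<open>j\<close> makes \<open>?a j\<close> agree with
      \<open>?a m - t\<close> up to a constant, so that \<open>v\<close> carries
      \<open>inv g^m\<close> to the neighbourhood of \<open>inv g^j\<close>.\<close>
    define J where "J = {j. j \<le> m \<and> ?a j \<le> ?a m - t + delta}"
    have "0 \<le> ?a m - t + delta" using m t2 b1 L H pos rho_nonneg[of \<one> "g [^] S"] d by linarith
    then have "0 \<in> J" unfolding J_def by simp
    moreover have "finite J" unfolding J_def by simp
    ultimately have MJ: "Max J \<in> J" using Max_in by blast
    define j where "j = Max J"
    have j: "j \<le> m" "?a j \<le> ?a m - t + delta" using MJ unfolding J_def j_def by auto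
    have jl: "?a m - t - L \<le> ?a j"
    proof (cases "j = m")
      case True
      then show ?thesis using t1 rho_nonneg[of \<one> g] unfolding L_def by (simp del: rho_nonneg)
    next
      case False
      then have "Suc j \<notin> J" using Max_ge[OF \<open>finite J\<close>, of "Suc j"] unfolding j_def by auto
      then have "?a m - t + delta < len (g [^] Suc j)" using False j unfolding J_def by simp
      moreover have "len (g [^] Suc j) \<le> ?a j + len g" using len_mult_le gC by simp
      ultimately show ?thesis using d unfolding L_def by linarith
    qed
    have Sj: "S \<le> j"
    proof (rule ccontr)
      assume "\<not> S \<le> j"
      then have "?a j \<le> ?a S" by (simp add: loxodromic_mono[OF g])
      then show False using jl t2 m b1 H L pos d by linarith
    qed
    \<comment> \<open>\<open>v\<close> modified by powers of \<open>g\<close> so that the overlap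
      starts at \<open>\<one>\<close>: \<open>u\<close> carries \<open>g^i\<close> close to
      \<open>g^i\<close> for \<open>i \<le> S\<close>. Powers of \<open>g\<close> do not affect
      commutation with \<open>g^c\<close>, so the conclusion for \<open>u\<close> is the one for
      \<open>v\<close>.\<close>
    define u where "u = g [^] j \<otimes> (v \<otimes> ?z m)"
    have uC: "u \<in> carrier F" using v gC by (simp add: u_def)
    have gpow: "?z b \<otimes> g [^] a = ?z (b - a)" if "a \<le> b" for a b :: nat
    proof -
      have "?z b = ?z (b - a) \<otimes> ?z a" using gC that by (simp add: nat_pow_mult)
      moreover have "?z a \<otimes> g [^] a = \<one>" using gC by (simp add: nat_pow_inv)
      ultimately show ?thesis using gC by (simp add: m_assoc)
    qed
    have "rho (u \<otimes> g [^] i) (g [^] i) \<le> E" if i: "i \<le> S" for i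
    proof -
      have im: "i \<le> m" "i \<le> j" "m - i \<le> m" "j - i \<le> m" using i mS Sj j by auto
      have "u \<otimes> g [^] i = g [^] j \<otimes> (v \<otimes> ?z (m - i))"
        using gpow[OF im(1)] v gC by (simp add: u_def m_assoc)
      moreover have "g [^] i = g [^] j \<otimes> ?z (j - i)"
      proof -
        have "g [^] j = g [^] i \<otimes> g [^] (j - i)" using gC im by (simp add: nat_pow_mult)
        then show ?thesis using gC by (simp add: m_assoc nat_pow_inv)
      qed
      ultimately have eq: "rho (u \<otimes> g [^] i) (g [^] i) = rho (v \<otimes> ?z (m - i)) (?z (j - i))"
        using left_inv[of "g [^] j"] v gC by simp
      have "K2 \<le> K3" using d unfolding K3_def by linarith
      then have near': "rho ?p (?z (j - i)) + rho (?z (j - i)) ?q \<le> rho ?p ?q + K3"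
        using near[OF im(4)] by linarith
      have "0 \<le> real k * V" using V by simp
      moreover have "?a (m - i) \<le> ?a m" using loxodromic_mono[OF g im(3)] .
      ultimately have sh: "\<bar>rho ?p (v \<otimes> ?z (m - i)) - rho ?p (?z (m - i)) - t\<bar> \<le> delta"
        using shift[of "?z (m - i)"] len_inv_pow[OF gC] gC by simp
      have sums: "?a i + ?a (m - i) \<le> ?a m + L" "?a m \<le> ?a i + ?a (m - i)"
        "?a i + ?a (j - i) \<le> ?a j + L" "?a j \<le> ?a i + ?a (j - i)"
        using loxodromic_sum[OF g, of i "m - i"] loxodromic_sum[OF g, of i "j - i"] im
          len_mult_le[of "g [^] i" "g [^] (m - i)"] len_mult_le[of "g [^] i" "g [^] (j - i)"] gC
        unfolding L_def by (simp_all add: nat_pow_mult)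
      have "\<bar>rho ?p (v \<otimes> ?z (m - i)) - rho ?p (?z (j - i))\<bar> \<le> 2 * L + c2 + delta"
      proof (rule abs_leI)
        have dL: "delta \<le> L" by (simp add: L_def)
        note sh' = sh[unfolded abs_le_iff]
        show "rho ?p (v \<otimes> ?z (m - i)) - rho ?p (?z (j - i)) \<le> 2 * L + c2 + delta"
          using sh'[THEN conjunct1] position[OF im(3)] position[OF im(4)] sums j(2) jl L d dL by linarith
        show "- (rho ?p (v \<otimes> ?z (m - i)) - rho ?p (?z (j - i))) \<le> 2 * L + c2 + delta"
          using sh'[THEN conjunct2] position[OF im(3)] position[OF im(4)] sums j(2) jl L d dL by linarith
      qed
      then show ?thesis
        unfolding eq E_def using near_line_dist[OF nearv[OF im(3)] near'] by linarith
    qed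
    then obtain c :: nat where c: "0 < c" "u \<otimes> g [^] c = g [^] c \<otimes> u" using S uC by blast
    have ginv: "?z m \<otimes> g [^] c = g [^] c \<otimes> ?z m"
    proof -
      have "inv g \<otimes> g [^] c = g [^] c \<otimes> inv g"
        using group_commutes_pow[of g "inv g" c] gC by simp
      then show ?thesis using group_commutes_pow[of "inv g" "g [^] c" m] gC by simp
    qed
    have "u \<otimes> g [^] c = g [^] j \<otimes> (v \<otimes> g [^] c \<otimes> ?z m)"
      using v gC by (simp add: u_def m_assoc ginv)
    moreover have "g [^] c \<otimes> u = g [^] j \<otimes> (g [^] c \<otimes> v \<otimes> ?z m)"
    proof -
      have "g [^] c \<otimes> g [^] j = g [^] j \<otimes> g [^] c" using gC by (simp add: nat_pow_mult add.commute)
      then show ?thesis using v gC by (simp add: u_def m_assoc[symmetric])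
    qed
    ultimately have "v \<otimes> g [^] c = g [^] c \<otimes> v" using c(2) v gC by simp
    then show ?thesis using c by blast
  qed
  moreover have "w \<noteq> \<one>"
  proof
    assume "w = \<one>"
    then have "len w = 0" by simp
    then show False using lw pos d by linarith
  qed
  ultimately show ?thesis unfolding w_def by blast
qed

end

section \<open>From acylindrical actions to pseudometrics on the group\<close>

lemma (in Metric_space) geodesic_segment_sum:
  assumes "geodesic_segment M d x y P" "q \<in> P"
  shows "q \<in> M" "d x q + d q y = d x y"
proof -
  show "q \<in> M" using assms by (auto simp: geodesic_segment_def)
  obtain \<gamma> where \<gamma>: "\<gamma> 0 = x" "\<gamma> (d x y) = y" "P = \<gamma> ` {0..d x y}"
      "\<forall>s \<in> {0..d x y}. \<forall>t \<in> {0..d x y}. d (\<gamma> s) (\<gamma> t) = \<bar>s - t\<bar>"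
    using assms(1) unfolding geodesic_segment_def by (elim conjE exE)
  obtain s where s: "s \<in> {0..d x y}" "q = \<gamma> s" using assms(2) \<gamma>(3) by blast
  have "d (\<gamma> 0) (\<gamma> s) = s" "d (\<gamma> s) (\<gamma> (d x y)) = d x y - s"
    using \<gamma>(4) s(1) by (auto simp: abs_if)
  then show "d x q + d q y = d x y" using s \<gamma> by simp
qed

lemma (in Metric_space) geodesic_segment_ends:
  assumes "geodesic_segment M d x y P"
  shows "x \<in> P" "y \<in> P"
proof -
  obtain \<gamma> where \<gamma>: "\<gamma> 0 = x" "\<gamma> (d x y) = y" "P = \<gamma> ` {0..d x y}"
    using assms(1) unfolding geodesic_segment_def by (elim conjE exE)
  show "x \<in> P" "y \<in> P"
    using \<gamma> imageI[of 0 "{0..d x y}" \<gamma>] imageI[of "d x y" "{0..d x y}" \<gamma>] by simp_all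
qed

text \<open>A replacement for connectedness: the sets need not be closed, so instead of a common
  point one obtains points on both sides of the supremum of \<open>A\<close>, and the slack 2 costs
  nothing on the coarse scale.\<close>

lemma interval_cover_meet:
  fixes A B :: "real set"
  assumes "0 \<in> A" "l \<in> B" "A \<subseteq> {0..l}" "{0..l} \<subseteq> A \<union> B"
  shows "\<exists>s\<in>A. \<exists>t\<in>B. 0 \<le> t \<and> t \<le> l \<and> \<bar>s - t\<bar> \<le> 2"
proof -
  have bdd: "bdd_above A" using assms(3) by (meson bdd_above_Icc bdd_above_mono)
  obtain s where s: "s \<in> A" "Sup A - 1 < s"
    using less_cSup_iff[OF _ bdd, of "Sup A - 1"] assms(1) by auto
  have sS: "s \<le> Sup A" "0 \<le> Sup A" using cSup_upper bdd s assms(1) by blast+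
  have l: "0 \<le> l" "s \<le> l" using assms s by auto
  define t where "t = min l (Sup A + 1)"
  have "t \<in> B"
  proof (cases "l \<le> Sup A + 1")
    case True
    then show ?thesis using assms(2) by (simp add: t_def)
  next
    case False
    then have "t \<notin> A" using cSup_upper[OF _ bdd, of t] by (auto simp: t_def)
    moreover have "t \<in> {0..l}" using False sS by (simp add: t_def)
    ultimately show ?thesis using assms(4) by blast
  qed
  moreover have "\<bar>s - t\<bar> \<le> 2" "0 \<le> t" "t \<le> l" using s sS l by (auto simp: t_def abs_if min_def)
  ultimately show ?thesis using s by blast
qed

lemma hyperbolic_space_four_point:
  assumes "hyperbolic_space S d"
  shows "\<exists>\<delta>. \<forall>a\<in>S. \<forall>b\<in>S. \<forall>e\<in>S. \<forall>f\<in>S. d a b + d e f \<le> max (d a e + d b f) (d a f + d b e) + \<delta>"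
proof -
  interpret Metric_space S d using assms by (simp add: hyperbolic_space_def)
  have ex: "\<exists>P. geodesic_segment S d x y P" if "x \<in> S" "y \<in> S" for x y
    using assms that by (simp add: hyperbolic_space_def)
  obtain \<delta> where "0 \<le> \<delta>" and sl: "\<forall>x \<in> S. \<forall>y \<in> S. \<forall>z \<in> S. \<forall>P1 P2 P3.
        geodesic_segment S d x y P1 \<and> geodesic_segment S d y z P2 \<and> geodesic_segment S d z x P3
        \<longrightarrow> (\<forall>p \<in> P1. \<exists>q \<in> P2 \<union> P3. d p q \<le> \<delta>)"
    using assms unfolding hyperbolic_space_def by (elim conjE exE)
  have slim: "\<And>x y z P1 P2 P3 p. x \<in> S \<Longrightarrow> y \<in> S \<Longrightarrow> z \<in> S \<Longrightarrow>
        geodesic_segment S d x y P1 \<Longrightarrow> geodesic_segment S d y z P2 \<Longrightarrow> geodesic_segment S d z x P3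
        \<Longrightarrow> p \<in> P1 \<Longrightarrow> \<exists>q \<in> P2 \<union> P3. d p q \<le> \<delta>"
    using sl by simp
  \<comment> \<open>The distance from \<open>p\<close> to the opposite side is at most the Gromov
    product of \<open>y\<close> and \<open>z\<close> at \<open>p\<close>, up to a constant. It is
    attained where the side changes from being close to \<open>P3\<close> to being close to
    \<open>P2\<close>, for such a point is near both.\<close>
  have insize: "\<exists>q\<in>P. 2 * d p q \<le> d p y + d p z - d y z + 4 * \<delta> + 4"
    if S: "p \<in> S" "y \<in> S" "z \<in> S" and P: "geodesic_segment S d y z P" for p y z P
  proof -
    obtain P2 where P2: "geodesic_segment S d z p P2" using ex[OF S(3,1)] by blast
    obtain P3 where P3: "geodesic_segment S d p y P3" using ex[OF S(1,2)] by blast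
    obtain \<gamma> where \<gamma>: "\<gamma> 0 = y" "\<gamma> (d y z) = z" "P = \<gamma> ` {0..d y z}"
      "\<forall>s \<in> {0..d y z}. \<forall>t \<in> {0..d y z}. d (\<gamma> s) (\<gamma> t) = \<bar>s - t\<bar>"
      using P unfolding geodesic_segment_def by (elim conjE exE)
    have end3: "y \<in> P3" and end2: "z \<in> P2" using geodesic_segment_ends[OF P3] geodesic_segment_ends[OF P2] by blast+
    define A where "A = {s \<in> {0..d y z}. \<exists>q\<in>P3. d (\<gamma> s) q \<le> \<delta>}"
    define B where "B = {s \<in> {0..d y z}. \<exists>q\<in>P2. d (\<gamma> s) q \<le> \<delta>}"
    have "\<exists>s\<in>A. \<exists>t\<in>B. 0 \<le> t \<and> t \<le> d y z \<and> \<bar>s - t\<bar> \<le> 2"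
    proof (rule interval_cover_meet)
      have "d y y \<le> \<delta>" "d z z \<le> \<delta>" using S \<open>0 \<le> \<delta>\<close> by simp_all
      then show "0 \<in> A" "d y z \<in> B" using end2 end3 \<gamma>(1,2) unfolding A_def B_def by auto
      show "A \<subseteq> {0..d y z}" by (auto simp: A_def)
      show "{0..d y z} \<subseteq> A \<union> B"
      proof
        fix s assume s: "s \<in> {0..d y z}"
        then have "\<gamma> s \<in> P" using \<gamma>(3) by blast
        then have "\<exists>q \<in> P2 \<union> P3. d (\<gamma> s) q \<le> \<delta>" using slim[OF S(2,3,1) P P2 P3] by blast
        then show "s \<in> A \<union> B" using s unfolding A_def B_def by blast
      qed
    qed
    then obtain s t where st: "s \<in> A" "t \<in> B" "\<bar>s - t\<bar> \<le> 2" by blast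
    obtain q1 q2 where q: "q1 \<in> P3" "d (\<gamma> s) q1 \<le> \<delta>" "q2 \<in> P2" "d (\<gamma> t) q2 \<le> \<delta>"
      using st unfolding A_def B_def by blast
    have sP: "\<gamma> s \<in> P" "\<gamma> t \<in> P" using st \<gamma>(3) unfolding A_def B_def by blast+
    have "d (\<gamma> s) (\<gamma> t) \<le> 2" using st \<gamma>(4) unfolding A_def B_def by auto
    note s1 = geodesic_segment_sum[OF P sP(1)] and s2 = geodesic_segment_sum[OF P2 q(3)] and s3 = geodesic_segment_sum[OF P3 q(1)]
      and s4 = geodesic_segment_sum[OF P sP(2)]
    have "d (\<gamma> s) q2 \<le> \<delta> + 2" using triangle[of "\<gamma> s" "\<gamma> t" q2] \<open>d (\<gamma> s) (\<gamma> t) \<le> 2\<close> q s1 s2 s4 by linarith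
    moreover have "d p (\<gamma> s) \<le> d p q1 + \<delta>" using triangle[of p q1 "\<gamma> s"] q S s1 s3 commute[of q1] by simp
    moreover have "d y (\<gamma> s) \<le> d q1 y + \<delta>" using triangle[of "\<gamma> s" q1 y] q S s1 s3 commute[of "\<gamma> s" y] by simp
    moreover have "d p (\<gamma> s) \<le> d q2 p + d (\<gamma> s) q2" using triangle[of "\<gamma> s" q2 p] q S s1 s2 commute[of "\<gamma> s" p] by simp
    moreover have "d (\<gamma> s) z \<le> d z q2 + d (\<gamma> s) q2" using triangle[of "\<gamma> s" q2 z] q S s1 s2 commute[of q2 z] by simp
    ultimately have "2 * d p (\<gamma> s) \<le> d p y + d p z - d y z + 4 * \<delta> + 4"
      using s1(2) s2(2) s3(2) commute[of z p] by linarith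
    then show ?thesis using sP by blast
  qed
  have "d a b + d e f \<le> max (d a e + d b f) (d a f + d b e) + (6 * \<delta> + 4)"
    if S: "a \<in> S" "b \<in> S" "e \<in> S" "f \<in> S" for a b e f
  proof -
    obtain P where P: "geodesic_segment S d a b P" using ex[OF S(1,2)] by blast
    obtain P2 where P2: "geodesic_segment S d b e P2" using ex[OF S(2,3)] by blast
    obtain P3 where P3: "geodesic_segment S d e a P3" using ex[OF S(3,1)] by blast
    \<comment> \<open>The point of the side \<open>a b\<close> close to \<open>f\<close> is, by
      slimness of the triangle \<open>a b e\<close>, close to \<open>b e\<close> or to
      \<open>e a\<close>. The two cases give the two terms of the maximum.\<close>
    obtain q where q: "q \<in> P" "2 * d f q \<le> d f a + d f b - d a b + 4 * \<delta> + 4" using insize[OF S(4,1,2) P] by blast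
    obtain q' where q': "q' \<in> P2 \<union> P3" "d q q' \<le> \<delta>" using slim[OF S(1,2,3) P P2 P3 q(1)] by blast
    have qS: "q \<in> S" "q' \<in> S" using geodesic_segment_sum(1) P P2 P3 q q' by blast+
    have f: "d f q' \<le> d f q + \<delta>" using triangle[of f q q'] qS q' S by simp
    show ?thesis
    proof (cases "q' \<in> P2")
      case True
      have "d b q' + d q' e = d b e" using geodesic_segment_sum(2)[OF P2 True] .
      moreover have "d e f \<le> d q' e + d f q'" using triangle[of f q' e] qS S commute[of f e] by simp
      moreover have "d f b \<le> d f q' + d b q'" using triangle[of f q' b] qS S commute[of q' b] by simp
      ultimately show ?thesis using q f commute[of f a] commute[of f b] by simp
    next
      case False
      then have "d e q' + d q' a = d e a" using geodesic_segment_sum(2)[OF P3] q' by blast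
      moreover have "d e f \<le> d e q' + d f q'" using triangle[of e q' f] qS S commute[of f q'] by simp
      moreover have "d f a \<le> d f q' + d q' a" using triangle[of f q' a] qS S by simp
      ultimately show ?thesis using q f commute[of f a] commute[of f b] commute[of e a] by simp
    qed
  qed
  then show ?thesis by blast
qed

lemma acylindrically_hyperbolic_metric:
  assumes "acylindrically_hyperbolic TYPE('s) F"
  shows "\<exists>rho delta coarse. hyperbolic_group_metric F rho delta coarse"
proof -
  obtain S :: "'s set" and d \<phi> where ne: "S \<noteq> {}" and hyp: "hyperbolic_space S d"
    and act: "isometric_action F S d \<phi>" and acyl: "acylindrical_action F S d \<phi>"
    and cob: "cobounded_action F S d \<phi>" and unb: "\<forall>x \<in> S. \<not> Metric_space.mbounded S d (orbit F \<phi> x)"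
    and grp: "group F"
    using assms unfolding acylindrically_hyperbolic_def
    by (elim conjE exE) (rule that; assumption)
  interpret group F by (rule grp)
  interpret Metric_space S d using hyp by (simp add: hyperbolic_space_def)
  interpret group_action F S \<phi> using act by (simp add: isometric_action_def)
  have iso: "d (\<phi> g x) (\<phi> g y) = d x y" if "g \<in> carrier F" "x \<in> S" "y \<in> S" for g x y
    using act that by (simp add: isometric_action_def)
  obtain x0 where x0: "x0 \<in> S" using ne by blast
  obtain \<delta> where four: "\<forall>a\<in>S. \<forall>b\<in>S. \<forall>e\<in>S. \<forall>f\<in>S. d a b + d e f \<le> max (d a e + d b f) (d a f + d b e) + \<delta>"
    using hyperbolic_space_four_point[OF hyp] by blast
  \<comment> \<open>The default value outside the carrier makes the four axioms of
    \<open>hyperbolic_pseudometric\<close> hold on the whole type, as they are stated.\<close>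
  define pt where "pt a = \<phi> (if a \<in> carrier F then a else \<one>\<^bsub>F\<^esub>) x0" for a
  have pt [simp]: "pt a \<in> S" for a using element_image[OF _ x0] by (auto simp: pt_def)
  have pt_mult: "pt (g \<otimes>\<^bsub>F\<^esub> a) = \<phi> g (pt a)" if "g \<in> carrier F" "a \<in> carrier F" for g a
    using composition_rule[OF x0 that] that by (simp add: pt_def)
  have pt_one: "pt \<one>\<^bsub>F\<^esub> = x0" using id_eq_one[symmetric] x0 by (simp add: pt_def)
  obtain B where B: "mbounded B" "S = (\<Union>g \<in> carrier F. \<phi> g ` B)"
    using cob unfolding cobounded_action_def by blast
  obtain c r where cr: "B \<subseteq> mcball c r" using B(1) unfolding mbounded_def by blast
  define K where "K = \<bar>d x0 c + r\<bar>"
  have dense: "\<exists>b\<in>carrier F. d (pt b) y \<le> K" if y: "y \<in> S" for y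
  proof -
    obtain g z where g: "g \<in> carrier F" "z \<in> B" "y = \<phi> g z" using B(2) y by blast
    have z: "z \<in> S" "c \<in> S" "d c z \<le> r" using cr g(2) by auto
    have "d (pt g) y = d x0 z" using iso[OF g(1) x0 z(1)] g by (simp add: pt_def)
    also have "\<dots> \<le> K" using triangle[OF x0 z(2,1)] z unfolding K_def by linarith
    finally show ?thesis using g by blast
  qed
  have K0: "0 \<le> K" by (simp add: K_def)
  \<comment> \<open>Replacing a point of a geodesic by an orbit point within \<open>K\<close> costs
    up to \<open>K\<close> on either side of it, hence \<open>2 * K\<close>.\<close>
  have "hyperbolic_group_metric F (\<lambda>a b. d (pt a) (pt b)) \<delta> (2 * K)"
  proof (unfold_locales, goal_cases)
    case (1 a b) show ?case by (rule commute)
  next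
    case (2 a) show ?case by simp
  next
    case (3 a b e) show ?case by (rule triangle) auto
  next
    case (4 a b e f) show ?case using four by simp
  next
    case (5 g a b) then show ?case by (simp add: pt_mult iso)
  next
    case (6 a r)
    obtain P where P: "geodesic_segment S d x0 (pt a) P"
      using hyp x0 unfolding hyperbolic_space_def by (meson pt)
    then obtain \<gamma> where \<gamma>: "\<gamma> 0 = x0" "\<gamma> (d x0 (pt a)) = pt a" "P = \<gamma> ` {0..d x0 (pt a)}"
      "\<forall>s \<in> {0..d x0 (pt a)}. \<forall>t \<in> {0..d x0 (pt a)}. d (\<gamma> s) (\<gamma> t) = \<bar>s - t\<bar>"
      unfolding geodesic_segment_def by (elim conjE exE)
    have r: "0 \<le> r" "r \<le> d x0 (pt a)" using 6 by (simp_all add: pt_one)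
    then have y: "\<gamma> r \<in> S" "d x0 (\<gamma> r) + d (\<gamma> r) (pt a) = d x0 (pt a)"
      using geodesic_segment_sum[OF P, of "\<gamma> r"] \<gamma>(3) by auto
    have yr: "d x0 (\<gamma> r) = r" using \<gamma>(4)[rule_format, of 0 r] \<gamma>(1) r by auto
    obtain b where b: "b \<in> carrier F" "d (pt b) (\<gamma> r) \<le> K" using dense[OF y(1)] by blast
    have 1: "d x0 (pt b) \<le> r + K" using triangle[of x0 "\<gamma> r" "pt b"] x0 y yr b commute[of "pt b"] by simp
    have 2: "r - K \<le> d x0 (pt b)" using triangle[of x0 "pt b" "\<gamma> r"] x0 y yr b by simp
    have 3: "d (pt b) (pt a) \<le> K + d (\<gamma> r) (pt a)" using triangle[of "pt b" "\<gamma> r" "pt a"] y b by simp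
    have "\<bar>d x0 (pt b) - r\<bar> \<le> 2 * K" using 1 2 K0 by (simp add: abs_le_iff)
    moreover have "d x0 (pt b) + d (pt b) (pt a) \<le> d x0 (pt a) + 2 * K" using 1 3 y yr by linarith
    ultimately show ?case using b(1) unfolding pt_one by blast
  next
    case (7 \<epsilon>)
    obtain R and N :: nat where RN: "\<And>x y. x \<in> S \<Longrightarrow> y \<in> S \<Longrightarrow> R \<le> d x y \<Longrightarrow>
        finite {g \<in> carrier F. d x (\<phi> g x) \<le> \<epsilon> \<and> d y (\<phi> g y) \<le> \<epsilon>} \<and>
        card {g \<in> carrier F. d x (\<phi> g x) \<le> \<epsilon> \<and> d y (\<phi> g y) \<le> \<epsilon>} \<le> N"
      using acyl 7 unfolding acylindrical_action_def by meson
    have "{g \<in> carrier F. d (pt a) (pt (g \<otimes>\<^bsub>F\<^esub> a)) \<le> \<epsilon> \<and> d (pt b) (pt (g \<otimes>\<^bsub>F\<^esub> b)) \<le> \<epsilon>} =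
        {g \<in> carrier F. d (pt a) (\<phi> g (pt a)) \<le> \<epsilon> \<and> d (pt b) (\<phi> g (pt b)) \<le> \<epsilon>}"
      if "a \<in> carrier F" "b \<in> carrier F" for a b
      using that by (auto simp: pt_mult)
    then show ?case using RN[OF pt pt] by (intro exI[of _ R] exI[of _ N]) simp
  next
    case (8 r)
    show ?case
    proof (rule ccontr)
      assume "\<not> ?case"
      then have "d x0 (pt a) \<le> r" if "a \<in> carrier F" for a using that by (force simp: pt_one)
      then have "orbit F \<phi> x0 \<subseteq> mcball x0 r"
        using x0 pt by (auto simp: orbit_def pt_def) (metis element_image)
      then show False using unb x0 mbounded_def by blast
    qed
  qed
  then show ?thesis by blast
qed

section \<open>Primitive elements in cosets of normal subgroups\<close>

lemma (in group) subgroup_centralizer: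
  assumes "x \<in> carrier G"
  shows "subgroup (centralizer G x) G"
proof (rule subgroupI)
  show "centralizer G x \<noteq> {}" using assms by (force simp: centralizer_def)
  fix a assume a: "a \<in> centralizer G x"
  then have "a \<otimes> x = x \<otimes> a" "a \<in> carrier G" by (auto simp: centralizer_def)
  then show "inv a \<in> centralizer G x"
  proof -
    assume a: "a \<otimes> x = x \<otimes> a" "a \<in> carrier G"
    have "inv a \<otimes> x = inv a \<otimes> (x \<otimes> a) \<otimes> inv a" using assms a(2) by (simp add: m_assoc)
    also have "\<dots> = x \<otimes> inv a" using assms a(2) by (simp add: a(1)[symmetric] inv_mult_cancel m_assoc)
    finally show ?thesis using a(2) by (simp add: centralizer_def)
  qed
next
  fix a b assume "a \<in> centralizer G x" "b \<in> centralizer G x"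
  then show "a \<otimes> b \<in> centralizer G x"
  proof -
    assume a: "a \<in> centralizer G x" and b: "b \<in> centralizer G x"
    then have C: "a \<in> carrier G" "b \<in> carrier G" by (auto simp: centralizer_def)
    have bx: "b \<otimes> x = x \<otimes> b" and ax: "a \<otimes> x = x \<otimes> a" using a b by (simp_all add: centralizer_def)
    have "a \<otimes> b \<otimes> x = a \<otimes> (x \<otimes> b)" using C assms bx by (simp add: m_assoc)
    also have "\<dots> = a \<otimes> x \<otimes> b" using C assms by (simp add: m_assoc)
    also have "\<dots> = x \<otimes> (a \<otimes> b)" unfolding ax using C assms by (simp add: m_assoc)
    finally show ?thesis using C by (simp add: centralizer_def)
  qed
qed (auto simp: centralizer_def)

lemma (in group) cyclic_centralizers_generator:
  assumes "cyclic_centralizers G" "x \<in> carrier G" "x \<noteq> \<one>"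
  shows "\<exists>c\<in>carrier G. centralizer G x = range (\<lambda>i::int. c [^] i)"
proof -
  interpret Z: group "G\<lparr>carrier := centralizer G x\<rparr>"
    using subgroup.subgroup_is_group[OF subgroup_centralizer[OF assms(2)]] group_axioms by blast
  have "cyclic_group (G\<lparr>carrier := centralizer G x\<rparr>)" using assms by (simp add: cyclic_centralizers_def)
  then obtain c where c: "c \<in> centralizer G x"
    "centralizer G x = range (\<lambda>i::int. c [^]\<^bsub>G\<lparr>carrier := centralizer G x\<rparr>\<^esub> i)"
    unfolding Z.cyclic_group by auto
  moreover have "c [^]\<^bsub>G\<lparr>carrier := centralizer G x\<rparr>\<^esub> i = c [^] i" for i :: int
    using int_pow_consistent[OF subgroup_centralizer[OF assms(2)] c(1)] by simp
  ultimately show ?thesis by (auto simp: centralizer_def)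
qed

text \<open>Commutative transitivity: both elements lie in one cyclic group. It serves to pass from
  commuting with a non-trivial power of \<open>g\<close> to commuting with \<open>g\<close>
  itself.\<close>

lemma (in group) cyclic_centralizers_transitive:
  assumes "cyclic_centralizers G" "x \<in> carrier G" "x \<noteq> \<one>"
    and "a \<in> carrier G" "b \<in> carrier G" "a \<otimes> x = x \<otimes> a" "b \<otimes> x = x \<otimes> b"
  shows "a \<otimes> b = b \<otimes> a"
proof -
  obtain c where c: "c \<in> carrier G" "centralizer G x = range (\<lambda>i::int. c [^] i)"
    using cyclic_centralizers_generator[OF assms(1-3)] by blast
  have "a \<in> centralizer G x" "b \<in> centralizer G x" using assms by (auto simp: centralizer_def)
  then obtain i j :: int where "a = c [^] i" "b = c [^] j" unfolding c(2) by blast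
  then show ?thesis using c(1) by (simp add: int_pow_mult[symmetric] add.commute)
qed

lemma (in group) conj_eq_iff_centralizer:
  assumes C: "f \<in> carrier G" "g \<in> carrier G" "x \<in> carrier G"
  shows "g \<otimes> x \<otimes> inv g = f \<otimes> x \<otimes> inv f \<longleftrightarrow> inv f \<otimes> g \<in> centralizer G x"
proof
  assume e: "g \<otimes> x \<otimes> inv g = f \<otimes> x \<otimes> inv f"
  have "inv f \<otimes> g \<otimes> x = inv f \<otimes> (g \<otimes> x \<otimes> inv g) \<otimes> g" using C by (simp add: m_assoc)
  also have "\<dots> = x \<otimes> (inv f \<otimes> g)" unfolding e using C by (simp add: m_assoc inv_mult_cancel)
  finally show "inv f \<otimes> g \<in> centralizer G x" using C by (simp add: centralizer_def)
next
  assume "inv f \<otimes> g \<in> centralizer G x"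
  then have "inv f \<otimes> g \<otimes> x = x \<otimes> (inv f \<otimes> g)" by (simp add: centralizer_def)
  then have "f \<otimes> (inv f \<otimes> g \<otimes> x) \<otimes> inv g = f \<otimes> (x \<otimes> (inv f \<otimes> g)) \<otimes> inv g" by simp
  then show "g \<otimes> x \<otimes> inv g = f \<otimes> x \<otimes> inv f" using C by (simp add: m_assoc inv_mult_cancel)
qed

lemma (in group) commute_int_pow:
  assumes "x \<in> carrier G" "a \<in> carrier G" "a \<otimes> x = x \<otimes> a"
  shows "a [^] (i::int) \<otimes> x = x \<otimes> a [^] i"
  using subgroup_int_pow_closed[OF subgroup_centralizer[OF assms(1)], of a i] assms by (simp add: centralizer_def)

lemma (in group) commute_int_pow_right:
  assumes "x \<in> carrier G" "a \<in> carrier G" "a \<otimes> x = x \<otimes> a"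
  shows "a \<otimes> x [^] (i::int) = x [^] i \<otimes> a"
  using commute_int_pow[of a x i] assms by simp

lemma (in group) conj_int_pow:
  assumes "x \<in> carrier G" "a \<in> carrier G"
  shows "a \<otimes> x [^] (i::int) \<otimes> inv a = (a \<otimes> x \<otimes> inv a) [^] i"
proof -
  have "(\<lambda>y. a \<otimes> y \<otimes> inv a) \<in> hom G G"
    using assms by (auto simp: hom_def m_assoc inv_mult_cancel)
  then show ?thesis using hom_int_pow[of "\<lambda>y. a \<otimes> y \<otimes> inv a" G G x i] assms is_group by simp
qed

lemma (in group) intertwine_inv:
  assumes "a \<in> carrier G" "y \<in> carrier G" "z \<in> carrier G" "a \<otimes> y = z \<otimes> a"
  shows "inv a \<otimes> z = y \<otimes> inv a"
proof -
  have "inv a \<otimes> z = inv a \<otimes> (z \<otimes> a) \<otimes> inv a" using assms(1-3) by (simp add: m_assoc)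
  then show ?thesis unfolding assms(4)[symmetric] using assms(1-3) by (simp add: m_assoc[symmetric])
qed

text \<open>Each of \<open>a\<close> and \<open>b\<close> sends a power of \<open>g\<close> to
  itself or to its inverse, so on the common power \<open>g^(k*l)\<close> their quotient
  \<open>n\<close> does the same. Its square then has sign 1.\<close>

lemma (in group) quotient_of_flips:
  assumes C: "g \<in> carrier G" "a \<in> carrier G" "b \<in> carrier G"
    and a: "s \<in> {1, -1}" "\<And>i::int. a \<otimes> g [^] (k * i) = g [^] (s * k * i) \<otimes> a"
    and b: "t \<in> {1, -1}" "\<And>i::int. b \<otimes> g [^] (l * i) = g [^] (t * l * i) \<otimes> b"
  defines "n \<equiv> inv a \<otimes> b"
  shows "n \<otimes> n \<otimes> g [^] (k * l) = g [^] (k * l) \<otimes> (n \<otimes> n)"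
proof -
  have n: "n \<otimes> g [^] (k * l * i) = g [^] (s * t * k * l * i) \<otimes> n" for i
  proof -
    have "s * s = 1" using a(1) by auto
    then have "a \<otimes> g [^] (s * t * k * l * i) = g [^] (t * k * l * i) \<otimes> a"
      using a(2)[of "s * t * l * i"] by (simp add: ac_simps) (simp add: mult.assoc[symmetric])
    then have "inv a \<otimes> g [^] (t * k * l * i) = g [^] (s * t * k * l * i) \<otimes> inv a"
      using C by (intro intertwine_inv) auto
    moreover have "b \<otimes> g [^] (k * l * i) = g [^] (t * k * l * i) \<otimes> b"
      using b(2)[of "k * i"] by (simp add: ac_simps)
    ultimately show ?thesis using C by (simp add: n_def m_assoc) (simp add: m_assoc[symmetric])
  qed
  have nC: "n \<in> carrier G" using C by (simp add: n_def)
  have st: "s * t * (s * t) = 1" using a(1) b(1) by auto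
  have "n \<otimes> n \<otimes> g [^] (k * l) = n \<otimes> (g [^] (s * t * k * l) \<otimes> n)"
    using n[of 1] nC C by (simp add: m_assoc)
  also have "\<dots> = n \<otimes> g [^] (k * l * (s * t)) \<otimes> n" using nC C by (simp add: m_assoc ac_simps)
  also have "\<dots> = g [^] (s * t * k * l * (s * t)) \<otimes> n \<otimes> n" unfolding n ..
  also have "s * t * k * l * (s * t) = k * l" using st by (simp add: ac_simps)
  finally show ?thesis using nC C by (simp add: m_assoc)
qed

text \<open>Let \<open>c\<close> generate the centralizer \<open>Z\<close> of \<open>g\<close>. For
  any \<open>f\<close>, the square of \<open>f g f^-1\<close> commutes with \<open>g\<close> by
  hypothesis and with \<open>f c f^-1\<close> because \<open>c\<close> commutes with
  \<open>g\<close>; by commutative transitivity \<open>f c f^-1\<close> lies in \<open>Z\<close>.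
  The same for \<open>f^-1\<close> shows that \<open>f\<close> takes \<open>c\<close> to
  \<open>c\<close> or to its inverse, so the cyclic group \<open>Z\<close> has index at most
  2.\<close>

lemma (in group) elementary_if_squares_commute:
  assumes cc: "cyclic_centralizers G" and N: "N \<lhd> G" and g: "g \<in> N"
    and inf: "\<And>i::int. g [^] i = \<one> \<Longrightarrow> i = 0"
    and sq: "\<And>n. n \<in> N \<Longrightarrow> n \<otimes> n \<otimes> g = g \<otimes> (n \<otimes> n)"
  shows "elementary_group G"
proof -
  interpret normal N G by fact
  have gC: "g \<in> carrier G" using g by simp
  have g1: "g \<noteq> \<one>" using inf[of 1] gC by auto
  have g2: "g \<otimes> g \<noteq> \<one>" using inf[of 2] gC int_pow_mult[of g 1 1] by auto
  obtain c where c: "c \<in> carrier G" "centralizer G g = range (\<lambda>i::int. c [^] i)"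
    using cyclic_centralizers_generator[OF cc gC g1] by blast
  have "g \<in> centralizer G g" using gC by (simp add: centralizer_def)
  then obtain k :: int where k: "g = c [^] k" using c by auto
  have cinf: "i = 0" if "c [^] i = \<one>" for i :: int
  proof -
    have "g [^] i = (c [^] i) [^] k" using c(1) by (simp add: k int_pow_pow mult.commute)
    then show ?thesis using inf that by simp
  qed
  have "c [^] (1::int) \<in> centralizer G g" unfolding c(2) by blast
  then have cg: "c \<otimes> g = g \<otimes> c" using c(1) by (simp add: centralizer_def)
  define Z where "Z = centralizer G g"
  have conj: "f \<otimes> c \<otimes> inv f \<in> Z" if f: "f \<in> carrier G" for f
  proof -
    let ?n = "f \<otimes> g \<otimes> inv f"
    have "?n \<in> N" using inv_op_closed2[OF f g] .
    then have 1: "g \<otimes> (?n \<otimes> ?n) = ?n \<otimes> ?n \<otimes> g" using sq by simp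
    have nn: "?n \<otimes> ?n = f \<otimes> (g \<otimes> g) \<otimes> inv f" using f gC by (simp add: m_assoc inv_mult_cancel)
    have "c \<otimes> (g \<otimes> g) = g \<otimes> g \<otimes> c"
    proof -
      have "c \<otimes> (g \<otimes> g) = c \<otimes> g \<otimes> g" using c(1) gC by (simp add: m_assoc)
      also have "\<dots> = g \<otimes> (c \<otimes> g)" unfolding cg using c(1) gC by (simp add: m_assoc cg)
      finally show ?thesis unfolding cg using c(1) gC by (simp add: m_assoc)
    qed
    then have "f \<otimes> (c \<otimes> (g \<otimes> g)) \<otimes> inv f = f \<otimes> (g \<otimes> g \<otimes> c) \<otimes> inv f" by simp
    then have 2: "(f \<otimes> c \<otimes> inv f) \<otimes> (?n \<otimes> ?n) = (?n \<otimes> ?n) \<otimes> (f \<otimes> c \<otimes> inv f)"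
      unfolding nn using f gC c(1) by (simp add: m_assoc inv_mult_cancel)
    have "?n \<otimes> ?n \<noteq> \<one>"
    proof
      assume "?n \<otimes> ?n = \<one>"
      then have "inv f \<otimes> (f \<otimes> (g \<otimes> g) \<otimes> inv f) \<otimes> f = \<one>" unfolding nn using f by simp
      then show False using f gC g2 by (simp add: m_assoc inv_mult_cancel)
    qed
    then show ?thesis
      using cyclic_centralizers_transitive[OF cc _ _ _ gC 2 1] f gC c(1) unfolding Z_def centralizer_def by simp
  qed
  have conj_cases: "f \<otimes> c \<otimes> inv f = c \<or> f \<otimes> c \<otimes> inv f = inv c" if f: "f \<in> carrier G" for f
  proof -
    obtain i :: int where i: "f \<otimes> c \<otimes> inv f = c [^] i" using conj[OF f] c(2) unfolding Z_def by auto
    obtain j :: int where j: "inv f \<otimes> c \<otimes> f = c [^] j"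
      using conj[of "inv f"] f c(2) unfolding Z_def by auto
    have "c = f \<otimes> (inv f \<otimes> c \<otimes> f) \<otimes> inv f" using f c(1) by (simp add: m_assoc inv_mult_cancel)
    also have "\<dots> = c [^] (i * j)"
      unfolding j using conj_int_pow[OF c(1) f, of j] i c(1) by (simp add: int_pow_pow)
    finally have "c [^] (i * j - 1) = \<one>" using c(1) by (simp add: int_pow_diff)
    then have "i * j = 1" using cinf by fastforce
    then have "i = 1 \<or> i = - 1" by (simp add: zmult_eq_1_iff) auto
    then show ?thesis using i c(1) int_pow_neg[of c 1] by auto
  qed
  have Zsub: "subgroup Z G" unfolding Z_def by (rule subgroup_centralizer[OF gC])
  have inZ: "f \<in> Z" if f: "f \<in> carrier G" and fc: "f \<otimes> c \<otimes> inv f = c" for f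
  proof -
    have "f \<otimes> c = f \<otimes> c \<otimes> inv f \<otimes> f" using f c(1) by (simp add: m_assoc)
    then have "f \<otimes> c = c \<otimes> f" unfolding fc .
    then show ?thesis using commute_int_pow_right[OF c(1) f] f unfolding Z_def centralizer_def k by simp
  qed
  \<comment> \<open>Any single element \<open>f0\<close> that inverts \<open>c\<close> represents
    the only possible second coset.\<close>
  have cosets: "Z #> f = Z \<or> (f0 \<in> carrier G \<longrightarrow> f0 \<otimes> c \<otimes> inv f0 = inv c \<longrightarrow> Z #> f = Z #> f0)"
    if f: "f \<in> carrier G" for f f0
  proof (cases "f \<otimes> c \<otimes> inv f = c")
    case True
    then show ?thesis using inZ[OF f] Zsub f by (simp add: coset_join2)
  next
    case False
    then have fc: "f \<otimes> c \<otimes> inv f = inv c" using conj_cases[OF f] by simp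
    have "Z #> f = Z #> f0" if f0: "f0 \<in> carrier G" and f0c: "f0 \<otimes> c \<otimes> inv f0 = inv c"
    proof -
      have "inv f0 \<otimes> inv c \<otimes> f0 = c" unfolding f0c[symmetric] using f0 c(1) by (simp add: m_assoc inv_mult_cancel)
      then have "inv (inv f0 \<otimes> inv c \<otimes> f0) = inv c" by simp
      then have f0c': "inv f0 \<otimes> c \<otimes> f0 = inv c" using f0 c(1) by (simp add: inv_mult_group m_assoc)
      have "(f \<otimes> inv f0) \<otimes> c \<otimes> inv (f \<otimes> inv f0) = f \<otimes> (inv f0 \<otimes> c \<otimes> f0) \<otimes> inv f"
        using f f0 c(1) by (simp add: inv_mult_group m_assoc)
      also have "\<dots> = inv (f \<otimes> c \<otimes> inv f)" unfolding f0c' using f c(1) by (simp add: inv_mult_group m_assoc)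
      also have "\<dots> = c" unfolding fc using c(1) by simp
      finally have "f \<otimes> inv f0 \<in> Z" using inZ f f0 by simp
      then have "f \<in> Z #> f0" using f f0 Zsub by (auto simp: r_coset_def m_assoc intro!: bexI[of _ "f \<otimes> inv f0"])
      then show ?thesis using repr_independence[OF _ f0 Zsub] by simp
    qed
    then show ?thesis by blast
  qed
  have "finite (rcosets Z)"
  proof (cases "\<exists>f0\<in>carrier G. f0 \<otimes> c \<otimes> inv f0 = inv c")
    case True
    then obtain f0 where "f0 \<in> carrier G" "f0 \<otimes> c \<otimes> inv f0 = inv c" by blast
    then have "rcosets Z \<subseteq> {Z, Z #> f0}" using cosets by (auto simp: RCOSETS_def)
    then show ?thesis using finite_subset by blast
  next
    case False
    then have "Z #> f = Z" if "f \<in> carrier G" for f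
      using conj_cases inZ Zsub coset_join2 that by blast
    then have "rcosets Z \<subseteq> {Z}" by (auto simp: RCOSETS_def)
    then show ?thesis using finite_subset by blast
  qed
  moreover have "cyclic_group (G\<lparr>carrier := Z\<rparr>)" using cc gC g1 by (simp add: cyclic_centralizers_def Z_def)
  ultimately show ?thesis using Zsub unfolding elementary_group_def by blast
qed

text \<open>Once \<open>h\<close> is replaced by some \<open>h1\<close> in its coset that neither
  centralizes nor inverts a power of \<open>g\<close>, a proper root \<open>v\<close> of
  \<open>w = h1 g^m\<close> cannot exist: \<open>v\<close> would commute with a power of
  \<open>g\<close>, hence with \<open>g\<close>, so \<open>w\<close> and with it \<open>h1\<close>
  would commute with \<open>g\<close>. As \<open>w\<close> is a power of the generator of its cyclic
  centralizer, the exponent must be 1 or -1.\<close>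

theorem primitive_element_in_coset:
  fixes F :: "('a, 'm) monoid_scheme" (structure)
  assumes hyp: "acylindrically_hyperbolic TYPE('s) F" and cc: "cyclic_centralizers F"
    and N: "N \<lhd> F" "infinite N" and h: "h \<in> carrier F"
  shows "\<exists>n\<in>N. h \<otimes> n \<noteq> \<one> \<and>
    (\<forall>v\<in>centralizer F (h \<otimes> n). \<exists>i::int. v = (h \<otimes> n) [^] i)"
proof -
  obtain rho delta coarse where "hyperbolic_group_metric F rho delta coarse"
    using acylindrically_hyperbolic_metric[OF hyp] by blast
  then interpret hyperbolic_group_metric F rho delta coarse .
  interpret normal N F by (rule N)
  have nonelem: "\<not> elementary_group F" using hyp by (simp add: acylindrically_hyperbolic_def)
  obtain g where g: "g \<in> N" "len g + (2 * delta + 1) \<le> len (g \<otimes> g)"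
    using normal_has_loxodromic[OF N] by blast
  have gC: "g \<in> carrier F" using g by simp
  have lox: "loxodromic g" using g gC by (simp add: loxodromic_def add.assoc)
  have nat_inf: "c = 0" if "g [^] c = \<one>" for c :: nat
    using loxodromic_ge[OF lox, of c] that by simp
  have inf: "i = 0" if "g [^] i = \<one>" for i :: int
  proof (cases i)
    case (nonneg n)
    then show ?thesis using that nat_inf by (simp add: int_pow_int)
  next
    case (neg n)
    then have "g [^] Suc n = \<one>" using that gC by (simp only: int_pow_neg_int inv_eq_1_iff nat_pow_closed)
    then show ?thesis using nat_inf by blast
  qed
  \<comment> \<open>Both signs have to be avoided: the inverting one for the geometry of
    \<open>h1 g^m\<close>, the commuting one for the contradiction in \<open>noroot\<close>.\<close>
  define flips where "flips a \<longleftrightarrow> (\<exists>c::nat. 0 < c \<and>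
      (a \<otimes> g [^] c = g [^] c \<otimes> a \<or> a \<otimes> g [^] c = inv g [^] c \<otimes> a))" for a
  have flips_int: "\<exists>s\<in>{1, -1::int}. \<exists>k\<noteq>0. \<forall>i::int. a \<otimes> g [^] (k * i) = g [^] (s * k * i) \<otimes> a"
    if a: "a \<in> carrier F" "flips a" for a
  proof -
    obtain c :: nat where c: "0 < c" "a \<otimes> g [^] c = g [^] c \<otimes> a \<or> a \<otimes> g [^] c = inv g [^] c \<otimes> a"
      using a(2) unfolding flips_def by blast
    have "inv g [^] c = g [^] (- int c)" using gC by (simp add: int_pow_neg_int nat_pow_inv)
    then obtain s :: int where s: "s \<in> {1, -1}" "a \<otimes> g [^] (int c) = g [^] (s * int c) \<otimes> a"
      using c(2) by (fastforce simp: int_pow_int)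
    have "a \<otimes> g [^] (int c * i) = g [^] (s * int c * i) \<otimes> a" for i
    proof -
      have "a \<otimes> g [^] (int c) \<otimes> inv a = g [^] (s * int c)" using s(2) a gC by (simp add: m_assoc)
      then have "a \<otimes> g [^] (int c * i) \<otimes> inv a = g [^] (s * int c * i)"
        using conj_int_pow[of "g [^] int c" a i] a gC by (simp add: int_pow_pow)
      then have "g [^] (s * int c * i) \<otimes> a = a \<otimes> g [^] (int c * i) \<otimes> inv a \<otimes> a" by simp
      then show ?thesis using a gC by (simp add: m_assoc)
    qed
    then show ?thesis using s(1) c(1) by (intro bexI[of _ s] exI[of _ "int c"]) auto
  qed
  \<comment> \<open>Otherwise \<open>h\<close> and all \<open>h n\<close> flip, so the square of
    every quotient \<open>n = h^-1 (h n)\<close> commutes with a power of \<open>g\<close>, hence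
    with \<open>g\<close>, which makes \<open>F\<close> elementary.\<close>
  have "\<exists>n\<in>N. \<not> flips (h \<otimes> n)"
  proof (rule ccontr)
    assume "\<not> ?thesis"
    then have fl: "flips (h \<otimes> n)" if "n \<in> N" for n using that by blast
    have "n \<otimes> n \<otimes> g = g \<otimes> (n \<otimes> n)" if n: "n \<in> N" for n
    proof -
      have nC: "n \<in> carrier F" using n by simp
      have fh: "flips h" using fl[of "\<one>"] h by simp
      obtain s k where a: "s \<in> {1, -1::int}" "k \<noteq> 0" "\<And>i::int. h \<otimes> g [^] (k * i) = g [^] (s * k * i) \<otimes> h"
        using flips_int[OF h fh] by blast
      have hn: "h \<otimes> n \<in> carrier F" using h nC by simp
      obtain t l where b: "t \<in> {1, -1::int}" "l \<noteq> 0" "\<And>i::int. h \<otimes> n \<otimes> g [^] (l * i) = g [^] (t * l * i) \<otimes> (h \<otimes> n)"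
        using flips_int[OF hn fl[OF n]] by blast
      have "n \<otimes> n \<otimes> g [^] (k * l) = g [^] (k * l) \<otimes> (n \<otimes> n)"
        using quotient_of_flips[OF gC h hn a(1,3) b(1,3)] h nC by (simp add: inv_mult_cancel)
      moreover have "g [^] (k * l) \<noteq> \<one>" using inf a(2) b(2) by fastforce
      moreover have "g \<otimes> g [^] (k * l) = g [^] (k * l) \<otimes> g" using commute_int_pow_right[OF gC gC] by simp
      ultimately show ?thesis using cyclic_centralizers_transitive[OF cc, of "g [^] (k * l)" "n \<otimes> n" g] gC nC by simp
    qed
    then show False using elementary_if_squares_commute[OF cc N(1) g(1) inf] nonelem by blast
  qed
  then obtain n1 where n1: "n1 \<in> N" "\<not> flips (h \<otimes> n1)" by blast
  define h1 where "h1 = h \<otimes> n1"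
  have h1C: "h1 \<in> carrier F" using h n1 by (simp add: h1_def)
  have "h1 \<otimes> g [^] c \<noteq> inv g [^] c \<otimes> h1" if "0 < c" for c :: nat
    using n1(2) that unfolding flips_def h1_def by blast
  from root_of_long_product_commutes[OF lox h1C this]
  obtain m :: nat where m: "h1 \<otimes> g [^] m \<noteq> \<one>"
     "\<And>v k. v \<in> carrier F \<Longrightarrow> 2 \<le> k \<Longrightarrow> v [^] (k::nat) = h1 \<otimes> g [^] m \<Longrightarrow>
        \<exists>c>0. v \<otimes> g [^] (c::nat) = g [^] c \<otimes> v" by blast
  define w where "w = h1 \<otimes> g [^] m"
  have wC: "w \<in> carrier F" using h1C gC by (simp add: w_def)
  have noroot: False if v: "v \<in> carrier F" and k: "2 \<le> k" "v [^] (k::nat) = w" for v k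
  proof -
    obtain c :: nat where c: "0 < c" "v \<otimes> g [^] c = g [^] c \<otimes> v" using m(2) v k unfolding w_def by blast
    have "g [^] c \<noteq> \<one>" using nat_inf c by blast
    moreover have "g \<otimes> g [^] c = g [^] c \<otimes> g" using gC nat_pow_Suc2[OF gC, of c] by simp
    ultimately have "g \<otimes> v = v \<otimes> g"
      using cyclic_centralizers_transitive[OF cc, of "g [^] c" g v] c gC v by simp
    moreover have "w \<otimes> v = v \<otimes> w" unfolding k(2)[symmetric] using nat_pow_Suc2[OF v, of k] by simp
    moreover have "v \<noteq> \<one>" using k m(1) unfolding w_def by auto
    ultimately have "w \<otimes> g = g \<otimes> w" using cyclic_centralizers_transitive[OF cc v _ wC gC] by simp
    then have "h1 \<otimes> g \<otimes> g [^] m = g \<otimes> h1 \<otimes> g [^] m"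
      unfolding w_def using gC h1C nat_pow_Suc2[OF gC, of m] by (simp add: m_assoc)
    then have "h1 \<otimes> g = g \<otimes> h1" using gC h1C by simp
    then have "flips h1" unfolding flips_def using gC by (intro exI[of _ 1]) simp
    then show False using n1(2) unfolding h1_def by blast
  qed
  obtain v where v: "v \<in> carrier F" "centralizer F w = range (\<lambda>i::int. v [^] i)"
    using cyclic_centralizers_generator[OF cc wC] m(1) unfolding w_def by blast
  have "w \<in> centralizer F w" using wC by (simp add: centralizer_def)
  then obtain k :: int where k: "w = v [^] k" using v(2) by blast
  have "k = 1 \<or> k = -1"
  proof (rule ccontr)
    assume k1: "\<not> ?thesis"
    have "k \<noteq> 0" using k m(1) unfolding w_def by auto
    then consider "2 \<le> k" | "k \<le> -2" using k1 by linarith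
    then show False
    proof cases
      case 1
      then have "2 \<le> nat k" by arith
      then show False using 1 noroot[of v "nat k"] v(1) k by (simp add: int_pow_int[symmetric])
    next
      case 2
      have "w = inv v [^] (- k)" using v(1) k by (simp add: int_pow_inv int_pow_neg)
      moreover have "2 \<le> nat (- k)" using 2 by arith
      ultimately show False using noroot[of "inv v" "nat (- k)"] 2 v(1) by (simp add: int_pow_int[symmetric])
    qed
  qed
  then have roots: "\<exists>j::int. u = w [^] j" if u: "u \<in> centralizer F w" for u
  proof -
    obtain i :: int where i: "u = v [^] i" using u unfolding v(2) by blast
    have "k * k = 1" using \<open>k = 1 \<or> k = -1\<close> by auto
    then have "w [^] (k * i) = u" unfolding k i using v(1) by (simp add: int_pow_pow mult.assoc[symmetric])
    then show ?thesis by blast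
  qed
  have w: "w = h \<otimes> (n1 \<otimes> g [^] m)" using h n1(1) gC by (simp add: w_def h1_def m_assoc)
  have "g [^] m \<in> N" using g(1) subgroup_int_pow_closed[OF subgroup_axioms, of g "int m"] by (simp add: int_pow_int)
  then have "n1 \<otimes> g [^] m \<in> N" using n1(1) by simp
  then show ?thesis
    using roots m(1) unfolding w_def[symmetric] unfolding w by blast
qed

section \<open>Kernels of homomorphisms onto members of \<open>C\<close>\<close>

text \<open>For a pseudovariety \<open>C\<close> these are the normal subgroups \<open>K\<close> with \<open>A Mod K\<close> in \<open>C\<close>, see \<open>C_kernel_iff\<close> below.\<close>
definition C_kernel :: "nat monoid set \<Rightarrow> ('a, 'm) monoid_scheme \<Rightarrow> 'a set \<Rightarrow> bool" where
  "C_kernel C A K \<longleftrightarrow> (\<exists>M\<in>C. \<exists>\<phi>\<in>hom A M. \<phi> ` carrier A = carrier M \<and> K = kernel A M \<phi>)"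

lemma (in group_hom) normal_image:
  assumes "N \<lhd> G" "h ` carrier G = carrier H"
  shows "h ` N \<lhd> H"
  unfolding H.normal_inv_iff
proof (intro conjI ballI)
  interpret N: normal N G by fact
  show "subgroup (h ` N) H" by (rule subgroup_img_is_subgroup[OF N.subgroup_axioms])
  fix a n assume "a \<in> carrier H" "n \<in> h ` N"
  then obtain b k where bk: "b \<in> carrier G" "a = h b" "k \<in> N" "n = h k" using assms(2) by blast
  then have "a \<otimes>\<^bsub>H\<^esub> n \<otimes>\<^bsub>H\<^esub> inv\<^bsub>H\<^esub> a = h (b \<otimes> k \<otimes> inv b)" by simp
  then show "a \<otimes>\<^bsub>H\<^esub> n \<otimes>\<^bsub>H\<^esub> inv\<^bsub>H\<^esub> a \<in> h ` N" using N.inv_op_closed2 bk by blast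
qed

locale finite_pseudovariety =
  fixes C :: "nat monoid set"
  assumes pseudovariety: "pseudovariety_of_finite_groups C"
begin

lemmas pv = pseudovariety[unfolded pseudovariety_of_finite_groups_def]

lemmas C_group = pv[THEN conjunct1, rule_format, THEN conjunct1]
lemmas C_finite = pv[THEN conjunct1, rule_format, THEN conjunct2]
lemmas C_iso = pv[THEN conjunct2, THEN conjunct1, rule_format, OF _ conjI]
lemmas C_subgroup = pv[THEN conjunct2, THEN conjunct2, THEN conjunct1, rule_format]
lemmas C_DirProd = pv[THEN conjunct2, THEN conjunct2, THEN conjunct2, THEN conjunct1, rule_format]
lemmas C_Mod = pv[THEN conjunct2, THEN conjunct2, THEN conjunct2, THEN conjunct2, rule_format]

lemma belongs_to_nat:
  fixes M :: "nat monoid"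
  shows "belongs_to M C \<Longrightarrow> M \<in> C"
  unfolding belongs_to_def using C_iso group.iso_sym by blast

lemma C_kernel_normal:
  assumes "group A" "C_kernel C A K"
  shows "K \<lhd> A"
  using assms C_group group_hom.normal_kernel unfolding C_kernel_def group_hom_def group_hom_axioms_def by blast

text \<open>\<open>C_kernel\<close> asks for a surjection onto a member of \<open>C\<close> over
  \<open>nat\<close>. Transport along the isomorphism and closure under subgroups, applied to the
  image, provide it.\<close>

lemma C_kernel_hom:
  assumes A: "group A" and M: "belongs_to M C" and \<phi>: "\<phi> \<in> hom A M"
  shows "C_kernel C A (kernel A M \<phi>)"
proof -
  obtain M' f where M': "M' \<in> C" "f \<in> iso M M'" using M unfolding belongs_to_def is_iso_def by blast
  have gM: "group M" "group M'" using M M' C_group by (auto simp: belongs_to_def)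
  then have f: "f \<in> hom M M'" "inj_on f (carrier M)" using M'(2) by (auto simp: iso_def bij_betw_def)
  have h: "f \<circ> \<phi> \<in> hom A M'" using hom_compose[OF \<phi> f(1)] .
  interpret h: group_hom A M' "f \<circ> \<phi>" using A gM h by (simp add: group_hom_def group_hom_axioms_def)
  interpret f: group_hom M M' f using gM f by (simp add: group_hom_def group_hom_axioms_def)
  let ?H = "(f \<circ> \<phi>) ` carrier A"
  have "subgroup ?H M'" by (rule h.img_is_subgroup)
  then have "M'\<lparr>carrier := ?H\<rparr> \<in> C" using C_subgroup[OF M'(1)] by blast
  moreover have "f \<circ> \<phi> \<in> hom A (M'\<lparr>carrier := ?H\<rparr>)" using h by (auto simp: hom_def)
  moreover have "kernel A M \<phi> = kernel A (M'\<lparr>carrier := ?H\<rparr>) (f \<circ> \<phi>)"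
  proof -
    have "f (\<phi> x) = \<one>\<^bsub>M'\<^esub> \<longleftrightarrow> \<phi> x = \<one>\<^bsub>M\<^esub>" if "x \<in> carrier A" for x
      using inj_onD[OF f(2), of "\<phi> x" "\<one>\<^bsub>M\<^esub>"] hom_in_carrier[OF \<phi> that] by auto
    then show ?thesis by (auto simp: kernel_def)
  qed
  ultimately show ?thesis
    unfolding C_kernel_def
    by (intro bexI[of _ "M'\<lparr>carrier := ?H\<rparr>"] bexI[of _ "f \<circ> \<phi>"] conjI) simp_all
qed

lemma belongs_to_surj:
  assumes A: "group A" and H: "group H" and \<theta>: "\<theta> \<in> hom A H" "\<theta> ` carrier A = carrier H"
    and K: "C_kernel C A (kernel A H \<theta>)"
  shows "belongs_to H C"
proof -
  interpret \<theta>: group_hom A H \<theta> using A H \<theta> by (simp add: group_hom_def group_hom_axioms_def)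
  obtain M \<phi> where M: "M \<in> C" "\<phi> \<in> hom A M" "\<phi> ` carrier A = carrier M" "kernel A H \<theta> = kernel A M \<phi>"
    using K unfolding C_kernel_def by blast
  interpret \<phi>: group_hom A M \<phi> using A C_group M by (simp add: group_hom_def group_hom_axioms_def)
  have 1: "A Mod kernel A H \<theta> \<cong> H" by (rule \<theta>.FactGroup_iso[OF \<theta>(2)])
  have 2: "A Mod kernel A H \<theta> \<cong> M" unfolding M(4) by (rule \<phi>.FactGroup_iso[OF M(3)])
  have "group (A Mod kernel A H \<theta>)" using normal.factorgroup_is_group[OF \<theta>.normal_kernel] .
  then have "H \<cong> A Mod kernel A H \<theta>" using 1 group.iso_sym by blast
  then have "H \<cong> M" using 2 iso_trans by blast
  then show ?thesis using H M(1) unfolding belongs_to_def by blast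
qed

lemma kernel_r_coset:
  assumes "K \<lhd> A"
  shows "kernel A (A Mod K) (\<lambda>a. K #>\<^bsub>A\<^esub> a) = K"
proof -
  interpret normal K A by fact
  show ?thesis
    using coset_join1 coset_join2[OF _ subgroup_axioms] subset subgroup_axioms
    by (auto simp: kernel_def)
qed

lemma C_kernel_iff:
  assumes A: "group A"
  shows "C_kernel C A K \<longleftrightarrow> K \<lhd> A \<and> belongs_to (A Mod K) C"
proof
  assume K: "C_kernel C A K"
  then have n: "K \<lhd> A" using C_kernel_normal A by blast
  have "belongs_to (A Mod K) C"
    by (rule belongs_to_surj[OF A normal.factorgroup_is_group[OF n] normal.r_coset_hom_Mod[OF n]])
      (use K kernel_r_coset[OF n] in \<open>auto simp: carrier_FactGroup\<close>)
  then show "K \<lhd> A \<and> belongs_to (A Mod K) C" using n by blast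
next
  assume "K \<lhd> A \<and> belongs_to (A Mod K) C"
  then show "C_kernel C A K"
    using C_kernel_hom[OF A _ normal.r_coset_hom_Mod, of K] kernel_r_coset[of K A] by simp
qed

lemma C_kernel_vimage:
  assumes G: "group G" and A: "group A" and \<psi>: "\<psi> \<in> hom G A" and K: "C_kernel C A K"
  shows "C_kernel C G {g \<in> carrier G. \<psi> g \<in> K}"
proof -
  obtain M \<phi> where M: "M \<in> C" "\<phi> \<in> hom A M" "K = kernel A M \<phi>" using K unfolding C_kernel_def by blast
  have "belongs_to M C" using M C_group iso_refl unfolding belongs_to_def by blast
  then have "C_kernel C G (kernel G M (\<phi> \<circ> \<psi>))" using C_kernel_hom G hom_compose[OF \<psi> M(2)] by blast
  moreover have "kernel G M (\<phi> \<circ> \<psi>) = {g \<in> carrier G. \<psi> g \<in> K}"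
    using hom_in_carrier[OF \<psi>] by (auto simp: M(3) kernel_def)
  ultimately show ?thesis by simp
qed

lemma C_kernel_Int:
  assumes A: "group A" and K: "C_kernel C A K" "C_kernel C A K'"
  shows "C_kernel C A (K \<inter> K')"
proof -
  obtain M \<phi> where M: "M \<in> C" "\<phi> \<in> hom A M" "K = kernel A M \<phi>" using K(1) unfolding C_kernel_def by blast
  obtain M' \<phi>' where M': "M' \<in> C" "\<phi>' \<in> hom A M'" "K' = kernel A M' \<phi>'" using K(2) unfolding C_kernel_def by blast
  have "C_kernel C A (kernel A (M \<times>\<times> M') (\<lambda>a. (\<phi> a, \<phi>' a)))"
    by (rule C_kernel_hom[OF A C_DirProd[OF M(1) M'(1)]]) (use M M' in \<open>auto simp: hom_def\<close>)
  moreover have "kernel A (M \<times>\<times> M') (\<lambda>a. (\<phi> a, \<phi>' a)) = K \<inter> K'" by (auto simp: M M' kernel_def)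
  ultimately show ?thesis by simp
qed

lemma C_kernel_INT:
  assumes A: "group A" and "finite T" "T \<noteq> {}" and "\<And>t. t \<in> T \<Longrightarrow> C_kernel C A (K t)"
  shows "C_kernel C A (\<Inter>t\<in>T. K t)"
  using assms(2-) by (induction T rule: finite_ne_induct) (auto intro: C_kernel_Int[OF A])

text \<open>Closure under quotients, pulled back to \<open>A\<close>: the quotient by
  \<open>K'\<close> is a quotient of the one by \<open>K\<close>.\<close>

lemma C_kernel_superset:
  assumes A: "group A" and K: "C_kernel C A K" "K \<subseteq> K'" and K': "K' \<lhd> A"
  shows "C_kernel C A K'"
proof -
  obtain M \<phi> where M: "M \<in> C" "\<phi> \<in> hom A M" "\<phi> ` carrier A = carrier M" "K = kernel A M \<phi>"
    using K(1) unfolding C_kernel_def by blast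
  interpret \<phi>: group_hom A M \<phi> using A C_group M by (simp add: group_hom_def group_hom_axioms_def)
  interpret K': normal K' A by fact
  have "\<phi> ` K' \<lhd> M" by (rule \<phi>.normal_image[OF K' M(3)])
  then have "C_kernel C M (\<phi> ` K')" using C_kernel_iff C_Mod[OF M(1)] C_group[OF M(1)] by blast
  then have "C_kernel C A {g \<in> carrier A. \<phi> g \<in> \<phi> ` K'}" using C_kernel_vimage[OF A C_group[OF M(1)] M(2)] by blast
  moreover have "{g \<in> carrier A. \<phi> g \<in> \<phi> ` K'} = K'"
  proof
    show "{g \<in> carrier A. \<phi> g \<in> \<phi> ` K'} \<subseteq> K'"
    proof
      fix g assume "g \<in> {g \<in> carrier A. \<phi> g \<in> \<phi> ` K'}"
      then obtain k where k: "g \<in> carrier A" "k \<in> K'" "\<phi> g = \<phi> k" by blast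
      then have "g \<otimes>\<^bsub>A\<^esub> inv\<^bsub>A\<^esub> k \<in> K" by (simp add: M(4) kernel_def)
      then have "g \<otimes>\<^bsub>A\<^esub> inv\<^bsub>A\<^esub> k \<otimes>\<^bsub>A\<^esub> k \<in> K'" using K(2) k(2) by blast
      then show "g \<in> K'" using k by (simp add: \<phi>.G.m_assoc)
    qed
  qed auto
  ultimately show ?thesis by simp
qed

lemma C_kernel_image:
  assumes G: "group G" and A: "group A" and \<pi>: "\<pi> \<in> hom G A" "\<pi> ` carrier G = carrier A" and L: "C_kernel C G L"
  shows "C_kernel C A (\<pi> ` L)"
proof -
  interpret \<pi>: group_hom G A \<pi> using A G \<pi> by (simp add: group_hom_def group_hom_axioms_def)
  interpret L: normal L G using C_kernel_normal[OF G L] .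
  have N: "\<pi> ` L \<lhd> A" by (rule \<pi>.normal_image[OF C_kernel_normal[OF G L] \<pi>(2)])
  let ?\<theta> = "\<lambda>g. \<pi> ` L #>\<^bsub>A\<^esub> \<pi> g"
  have Q: "group (A Mod \<pi> ` L)" by (rule normal.factorgroup_is_group[OF N])
  have \<theta>: "?\<theta> \<in> hom G (A Mod \<pi> ` L)"
    using hom_compose[OF \<pi>(1) normal.r_coset_hom_Mod[OF N]] by (simp add: comp_def)
  interpret \<theta>: group_hom G "A Mod \<pi> ` L" ?\<theta> using \<theta> G Q by (simp add: group_hom_def group_hom_axioms_def)
  have "kernel G (A Mod \<pi> ` L) ?\<theta> = {g \<in> carrier G. \<pi> g \<in> kernel A (A Mod \<pi> ` L) (\<lambda>a. \<pi> ` L #>\<^bsub>A\<^esub> a)}"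
    by (auto simp: kernel_def)
  then have "L \<subseteq> kernel G (A Mod \<pi> ` L) ?\<theta>" unfolding kernel_r_coset[OF N] using L.subset by auto
  then have "C_kernel C G (kernel G (A Mod \<pi> ` L) ?\<theta>)"
    using C_kernel_superset[OF G L] \<theta>.normal_kernel by blast
  moreover have "?\<theta> ` carrier G = carrier (A Mod \<pi> ` L)"
    unfolding carrier_FactGroup \<pi>(2)[symmetric] by auto
  ultimately have "belongs_to (A Mod \<pi> ` L) C" using belongs_to_surj[OF G Q \<theta>] by blast
  then show ?thesis using C_kernel_iff[OF A] N by blast
qed

text \<open>Finiteness of the members of \<open>C\<close>, as finite index. \<open>T\<close> is
  required to be non-empty because it indexes intersections of kernels below.\<close>

lemma C_kernel_transversal:
  assumes A: "group A" and K: "C_kernel C A K"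
  shows "\<exists>T. finite T \<and> T \<subseteq> carrier A \<and> T \<noteq> {} \<and> (\<forall>a\<in>carrier A. \<exists>t\<in>T. \<exists>k\<in>K. a = t \<otimes>\<^bsub>A\<^esub> k)"
proof -
  obtain M \<phi> where M: "M \<in> C" "\<phi> \<in> hom A M" "\<phi> ` carrier A = carrier M" "K = kernel A M \<phi>"
    using K unfolding C_kernel_def by blast
  interpret \<phi>: group_hom A M \<phi> using A C_group M by (simp add: group_hom_def group_hom_axioms_def)
  define s where "s m = (SOME a. a \<in> carrier A \<and> \<phi> a = m)" for m
  have s: "s m \<in> carrier A \<and> \<phi> (s m) = m" if "m \<in> carrier M" for m
  proof -
    have "\<exists>a. a \<in> carrier A \<and> \<phi> a = m" using that unfolding M(3)[symmetric] by auto
    then show ?thesis unfolding s_def by (rule someI_ex)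
  qed
  have "\<exists>t\<in>s ` carrier M. \<exists>k\<in>K. a = t \<otimes>\<^bsub>A\<^esub> k" if a: "a \<in> carrier A" for a
  proof -
    let ?t = "s (\<phi> a)"
    have t: "?t \<in> carrier A" "\<phi> ?t = \<phi> a" using s[of "\<phi> a"] a by auto
    then have "inv\<^bsub>A\<^esub> ?t \<otimes>\<^bsub>A\<^esub> a \<in> K" using a by (simp add: M(4) kernel_def)
    moreover have "a = ?t \<otimes>\<^bsub>A\<^esub> (inv\<^bsub>A\<^esub> ?t \<otimes>\<^bsub>A\<^esub> a)" using t a by (simp add: \<phi>.G.m_assoc[symmetric])
    moreover have "?t \<in> s ` carrier M" using a by simp
    ultimately show ?thesis by blast
  qed
  moreover have "finite (s ` carrier M)" using C_finite[OF M(1)] by simp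
  moreover have "s ` carrier M \<subseteq> carrier A" using s by auto
  moreover have "s ` carrier M \<noteq> {}" using \<phi>.H.one_closed by auto
  ultimately show ?thesis by blast
qed

end

section \<open>Extension-closure and passage from subgroups to the group\<close>

context finite_pseudovariety
begin

text \<open>\<open>F Mod L\<close> is an extension of \<open>F Mod K\<close> by the quotient of
  \<open>K\<close> by \<open>L\<close>. As \<open>extension_closed\<close> ranges over groups on
  \<open>nat\<close>, the quotient is first shown to be finite and then replaced by a copy
  \<open>A\<close>, in which the image \<open>N\<close> of \<open>K\<close> is the normal subgroup
  of the extension.\<close>

lemma C_kernel_extension:
  fixes F :: "('a, 'm) monoid_scheme" (structure)
  assumes ext: "extension_closed C" and F: "group F" and K: "C_kernel C F K"
    and L: "C_kernel C (F\<lparr>carrier := K\<rparr>) L" and LF: "L \<lhd> F"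
  shows "C_kernel C F L"
proof -
  interpret F: group F by (rule F)
  interpret K: normal K F using C_kernel_normal[OF F K] .
  interpret L: normal L F by (rule LF)
  have FK: "group (F\<lparr>carrier := K\<rparr>)" using K.subgroup_axioms F by (simp add: subgroup.subgroup_is_group)
  have LK: "L \<subseteq> K" using C_kernel_normal[OF FK L] normal_imp_subgroup subgroup.subset by fastforce
  have Q: "group (F Mod L)" by (rule L.factorgroup_is_group)
  have "finite (carrier (F Mod L))"
  proof -
    obtain T where T: "finite T" "T \<subseteq> carrier F" "\<forall>a\<in>carrier F. \<exists>t\<in>T. \<exists>k\<in>K. a = t \<otimes> k"
      using C_kernel_transversal[OF F K] by blast
    obtain T' where T': "finite T'" "T' \<subseteq> K" "\<forall>a\<in>K. \<exists>t\<in>T'. \<exists>k\<in>L. a = t \<otimes> k"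
      using C_kernel_transversal[OF FK L] by auto
    have "carrier (F Mod L) \<subseteq> (\<lambda>(t, t'). L #> (t \<otimes> t')) ` (T \<times> T')"
    proof
      fix U assume "U \<in> carrier (F Mod L)"
      then obtain a where a: "a \<in> carrier F" and Ua: "U = L #> a" by (auto simp: carrier_FactGroup)
      obtain t k where t: "t \<in> T" "k \<in> K" "a = t \<otimes> k" using T(3) a(1) by blast
      obtain t' l where t': "t' \<in> T'" "l \<in> L" "k = t' \<otimes> l" using T'(3) t(2) by blast
      have tt: "t \<in> carrier F" "t' \<in> carrier F" "l \<in> carrier F" using t t' T(2) T'(2) by auto
      have "(t \<otimes> t') \<otimes> l \<otimes> inv (t \<otimes> t') \<in> L" using L.inv_op_closed2 tt t'(2) by simp
      moreover have "a = ((t \<otimes> t') \<otimes> l \<otimes> inv (t \<otimes> t')) \<otimes> (t \<otimes> t')"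
        using tt t(3) t'(3) by (simp add: F.m_assoc)
      ultimately have "a \<in> L #> (t \<otimes> t')" unfolding r_coset_def by blast
      then have "U = L #> (t \<otimes> t')"
        unfolding Ua using F.repr_independence[OF _ _ L.subgroup_axioms] tt by simp
      then show "U \<in> (\<lambda>(t, t'). L #> (t \<otimes> t')) ` (T \<times> T')" using t t' by auto
    qed
    then show ?thesis by (rule finite_subset) (use T T' in simp)
  qed
  then obtain A :: "nat monoid" where A: "group A" "F Mod L \<cong> A"
    using finite_group_nat_copy[OF Q] by blast
  then obtain f where f: "f \<in> iso (F Mod L) A" unfolding is_iso_def by blast
  define \<theta> where "\<theta> = f \<circ> (\<lambda>a. L #> a)"
  have fh: "f \<in> hom (F Mod L) A" "f ` carrier (F Mod L) = carrier A" "inj_on f (carrier (F Mod L))"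
    using f by (auto simp: iso_def bij_betw_def)
  have \<theta>: "\<theta> \<in> hom F A" unfolding \<theta>_def using hom_compose[OF L.r_coset_hom_Mod fh(1)] .
  have \<theta>onto: "\<theta> ` carrier F = carrier A"
    unfolding \<theta>_def image_comp[symmetric] carrier_FactGroup[symmetric] by (rule fh(2))
  interpret \<theta>: group_hom F A \<theta> using F A \<theta> by (simp add: group_hom_def group_hom_axioms_def)
  interpret f: group_hom "F Mod L" A f using Q A fh by (simp add: group_hom_def group_hom_axioms_def)
  have ker: "kernel F A \<theta> = L"
  proof -
    have "f U = \<one>\<^bsub>A\<^esub> \<longleftrightarrow> U = \<one>\<^bsub>F Mod L\<^esub>" if "U \<in> carrier (F Mod L)" for U
      using inj_onD[OF fh(3), of U "\<one>\<^bsub>F Mod L\<^esub>"] that f.hom_one f.G.one_closed by metis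
    then have "kernel F A \<theta> = kernel F (F Mod L) (\<lambda>a. L #> a)"
      unfolding \<theta>_def kernel_def by (auto simp: carrier_FactGroup)
    then show ?thesis using kernel_r_coset[OF LF] by simp
  qed
  define N where "N = \<theta> ` K"
  have N: "N \<lhd> A" unfolding N_def by (rule \<theta>.normal_image[OF C_kernel_normal[OF F K] \<theta>onto])
  have AN: "group (A\<lparr>carrier := N\<rparr>)"
    using normal_imp_subgroup[OF N] A(1) by (simp add: subgroup.subgroup_is_group)
  have "belongs_to (A\<lparr>carrier := N\<rparr>) C"
  proof (rule belongs_to_surj[OF FK AN])
    show "\<theta> \<in> hom (F\<lparr>carrier := K\<rparr>) (A\<lparr>carrier := N\<rparr>)" by (auto simp: hom_def N_def)
    show "\<theta> ` carrier (F\<lparr>carrier := K\<rparr>) = carrier (A\<lparr>carrier := N\<rparr>)" by (simp add: N_def)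
    have "kernel (F\<lparr>carrier := K\<rparr>) (A\<lparr>carrier := N\<rparr>) \<theta> = kernel F A \<theta> \<inter> K" by (auto simp: kernel_def)
    then show "C_kernel C (F\<lparr>carrier := K\<rparr>) (kernel (F\<lparr>carrier := K\<rparr>) (A\<lparr>carrier := N\<rparr>) \<theta>)"
      using L LK ker by (simp add: Int_absorb2)
  qed
  then have 1: "A\<lparr>carrier := N\<rparr> \<in> C" by (rule belongs_to_nat)
  have 2: "belongs_to (A Mod N) C"
  proof (rule belongs_to_surj[OF F normal.factorgroup_is_group[OF N]])
    show "(\<lambda>a. N #>\<^bsub>A\<^esub> a) \<circ> \<theta> \<in> hom F (A Mod N)" by (rule hom_compose[OF \<theta> normal.r_coset_hom_Mod[OF N]])
    show "((\<lambda>a. N #>\<^bsub>A\<^esub> a) \<circ> \<theta>) ` carrier F = carrier (A Mod N)"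
      unfolding image_comp[symmetric] \<theta>onto carrier_FactGroup ..
    have "kernel F (A Mod N) ((\<lambda>a. N #>\<^bsub>A\<^esub> a) \<circ> \<theta>) = {a \<in> carrier F. \<theta> a \<in> kernel A (A Mod N) (\<lambda>a. N #>\<^bsub>A\<^esub> a)}"
      by (auto simp: kernel_def)
    also have "\<dots> = {a \<in> carrier F. \<theta> a \<in> N}" unfolding kernel_r_coset[OF N] ..
    also have "\<dots> = K"
    proof
      show "{a \<in> carrier F. \<theta> a \<in> N} \<subseteq> K"
      proof
        fix a assume "a \<in> {a \<in> carrier F. \<theta> a \<in> N}"
        then obtain k where k: "a \<in> carrier F" "k \<in> K" "\<theta> a = \<theta> k" unfolding N_def by blast
        then have "a \<otimes> inv k \<in> kernel F A \<theta>" by (simp add: kernel_def)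
        then have "a \<otimes> inv k \<otimes> k \<in> K" using LK ker k(2) by blast
        then show "a \<in> K" using k by (simp add: F.m_assoc)
      qed
    qed (auto simp: N_def)
    finally show "C_kernel C F (kernel F (A Mod N) ((\<lambda>a. N #>\<^bsub>A\<^esub> a) \<circ> \<theta>))" using K by simp
  qed
  have "A \<in> C" using ext A(1) N 1 2 unfolding extension_closed_def by blast
  then show ?thesis using \<theta> \<theta>onto ker unfolding C_kernel_def by blast
qed

text \<open>The kernel of \<open>\<psi>\<close> on \<open>K\<close> is replaced by its normal core, an intersection of finitely many conjugates.\<close>
lemma C_kernel_inside:
  fixes F :: "('a, 'm) monoid_scheme" (structure)
  assumes ext: "extension_closed C" and F: "group F" and K: "C_kernel C F K"
    and H: "subgroup H F" "K \<subseteq> H" and M: "M \<in> C" and \<psi>: "\<psi> \<in> hom (F\<lparr>carrier := H\<rparr>) M"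
  shows "\<exists>L\<subseteq>K. C_kernel C F L \<and> (\<forall>l\<in>L. \<psi> l = \<one>\<^bsub>M\<^esub>)"
proof -
  interpret F: group F by (rule F)
  interpret K: normal K F using C_kernel_normal[OF F K] .
  interpret M: group M using C_group[OF M] .
  have FH: "group (F\<lparr>carrier := H\<rparr>)" using H F by (simp add: subgroup.subgroup_is_group)
  have FK: "group (F\<lparr>carrier := K\<rparr>)" using K.subgroup_axioms F by (simp add: subgroup.subgroup_is_group)
  interpret \<psi>: group_hom "F\<lparr>carrier := H\<rparr>" M \<psi> using FH M.is_group \<psi> by (simp add: group_hom_def group_hom_axioms_def)
  have \<psi>m: "\<psi> (a \<otimes> b) = \<psi> a \<otimes>\<^bsub>M\<^esub> \<psi> b" "\<psi> a \<in> carrier M" "\<psi> (inv a) = inv\<^bsub>M\<^esub> \<psi> a" if "a \<in> K" "b \<in> K" for a b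
  proof -
    have ab: "a \<in> H" "b \<in> H" using that H(2) by blast+
    show "\<psi> (a \<otimes> b) = \<psi> a \<otimes>\<^bsub>M\<^esub> \<psi> b" "\<psi> a \<in> carrier M" using \<psi>.hom_mult[of a b] \<psi>.hom_closed[of a] ab by simp_all
    show "\<psi> (inv a) = inv\<^bsub>M\<^esub> \<psi> a" using \<psi>.hom_inv[of a] ab F.m_inv_consistent[OF H(1)] by simp
  qed
  define cj where "cj t x = inv t \<otimes> x \<otimes> t" for t x
  have cjK: "cj t x \<in> K" if "t \<in> carrier F" "x \<in> K" for t x
    unfolding cj_def using K.inv_op_closed1[OF that] .
  define L where "L = {x \<in> K. \<forall>t\<in>carrier F. \<psi> (cj t x) = \<one>\<^bsub>M\<^esub>}"
  obtain T where T: "finite T" "T \<subseteq> carrier F" "T \<noteq> {}" "\<forall>a\<in>carrier F. \<exists>t\<in>T. \<exists>k\<in>K. a = t \<otimes> k"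
    using C_kernel_transversal[OF F K] by blast
  define \<kappa> where "\<kappa> t = (\<lambda>x. \<psi> (cj t x))" for t
  have \<kappa>: "\<kappa> t \<in> hom (F\<lparr>carrier := K\<rparr>) M" if t: "t \<in> carrier F" for t
  proof -
    have "cj t (x \<otimes> y) = cj t x \<otimes> cj t y" if "x \<in> K" "y \<in> K" for x y
    proof -
      have "cj t x \<otimes> cj t y = inv t \<otimes> x \<otimes> (t \<otimes> inv t) \<otimes> y \<otimes> t"
        unfolding cj_def using that t K.mem_carrier by (simp only: F.m_assoc F.m_closed F.inv_closed)
      then show ?thesis unfolding cj_def using that t K.mem_carrier by (simp add: F.m_assoc)
    qed
    then show ?thesis using cjK[OF t] \<psi>m unfolding \<kappa>_def hom_def by simp
  qed
  \<comment> \<open>Conjugating by an element of \<open>K\<close> preserves the kernel of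
    \<open>\<psi>\<close> on \<open>K\<close>, so one conjugate for each coset of \<open>K\<close>
    is enough.\<close>
  have L_eq: "L = (\<Inter>t\<in>T. kernel (F\<lparr>carrier := K\<rparr>) M (\<kappa> t))"
  proof
    show "L \<subseteq> (\<Inter>t\<in>T. kernel (F\<lparr>carrier := K\<rparr>) M (\<kappa> t))"
      using T(2) by (auto simp: L_def kernel_def \<kappa>_def)
    show "(\<Inter>t\<in>T. kernel (F\<lparr>carrier := K\<rparr>) M (\<kappa> t)) \<subseteq> L"
    proof
      fix x assume x: "x \<in> (\<Inter>t\<in>T. kernel (F\<lparr>carrier := K\<rparr>) M (\<kappa> t))"
      have xK: "x \<in> K" using x T(3) by (auto simp: kernel_def)
      have "\<psi> (cj a x) = \<one>\<^bsub>M\<^esub>" if a: "a \<in> carrier F" for a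
      proof -
        obtain t k where t: "t \<in> T" "k \<in> K" "a = t \<otimes> k" using T(4) a by blast
        have tC: "t \<in> carrier F" using t T by blast
        have "cj a x = inv k \<otimes> cj t x \<otimes> k"
          unfolding cj_def t(3) using tC t(2) xK K.mem_carrier by (simp add: F.inv_mult_group F.m_assoc)
        moreover have "\<psi> (cj t x) = \<one>\<^bsub>M\<^esub>" using x t(1) by (auto simp: kernel_def \<kappa>_def)
        ultimately show ?thesis using \<psi>m cjK[OF tC xK] t(2) by simp
      qed
      then show "x \<in> L" unfolding L_def using xK by blast
    qed
  qed
  have MC: "belongs_to M C" using M M.is_group iso_refl unfolding belongs_to_def by blast
  have "C_kernel C (F\<lparr>carrier := K\<rparr>) L"
    unfolding L_eq using T(1,2,3) C_kernel_hom[OF FK MC \<kappa>] by (intro C_kernel_INT[OF FK]) auto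
  moreover have LF: "L \<lhd> F"
    unfolding F.normal_inv_iff
  proof (intro conjI ballI)
    have "subgroup L (F\<lparr>carrier := K\<rparr>)" using \<open>C_kernel C (F\<lparr>carrier := K\<rparr>) L\<close> C_kernel_normal[OF FK] normal_imp_subgroup by blast
    then show "subgroup L F" using F.incl_subgroup[OF K.subgroup_axioms] by blast
    fix g x assume g: "g \<in> carrier F" and x: "x \<in> L"
    have xK: "x \<in> K" "x \<in> carrier F" using x K.mem_carrier unfolding L_def by blast+
    have "cj t (g \<otimes> x \<otimes> inv g) = cj (inv g \<otimes> t) x" if "t \<in> carrier F" for t
      unfolding cj_def using that g xK by (simp add: F.inv_mult_group F.m_assoc)
    then show "g \<otimes> x \<otimes> inv g \<in> L" using x g K.inv_op_closed2[OF g xK(1)] unfolding L_def by simp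
  qed
  ultimately have "C_kernel C F L" using C_kernel_extension[OF ext F K] by blast
  moreover have "\<psi> l = \<one>\<^bsub>M\<^esub>" if "l \<in> L" for l
  proof -
    have "cj \<one> l = l" using that K.mem_carrier unfolding cj_def L_def by simp
    then show ?thesis using that unfolding L_def by force
  qed
  moreover have "L \<subseteq> K" unfolding L_def by blast
  ultimately show ?thesis by blast
qed

end

section \<open>The centralizer condition\<close>

context finite_pseudovariety
begin

lemma openin_pro_topology:
  fixes F :: "('a, 'm) monoid_scheme" (structure)
  assumes F: "group F" and K: "C_kernel C F K" and H: "subgroup H F" "K \<subseteq> H"
  shows "openin (pro_topology C F) H"
proof -
  interpret F: group F by (rule F)
  interpret H: subgroup H F by (rule H)
  have n: "K \<lhd> F" "belongs_to (F Mod K) C" using K C_kernel_iff[OF F] by blast+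
  interpret K: normal K F by (rule n)
  have 1: "openin (pro_topology C F) (K #> a)" if "a \<in> carrier F" for a
    unfolding pro_topology_def using n that by (intro topology_generated_by_Basis) blast
  have 2: "H = (\<Union>a\<in>H. K #> a)"
  proof
    show "H \<subseteq> (\<Union>a\<in>H. K #> a)" using F.rcos_self[OF _ K.subgroup_axioms] by auto
    show "(\<Union>a\<in>H. K #> a) \<subseteq> H" using H(2) by (auto simp: r_coset_def)
  qed
  show ?thesis by (subst 2) (rule openin_Union, use 1 in auto)
qed

lemma C_kernel_commutator:
  fixes F :: "('a, 'm) monoid_scheme" (structure)
  assumes F: "group F" and K: "C_kernel C F K" and L: "L \<subseteq> K" and x: "x \<in> carrier F" "z \<in> carrier F" "k \<in> K"
    and xz: "inv x \<otimes> (inv (z \<otimes> k) \<otimes> x \<otimes> (z \<otimes> k)) \<in> L"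
  shows "\<exists>l\<in>L. inv z \<otimes> x \<otimes> z = k \<otimes> (x \<otimes> l) \<otimes> inv k"
proof -
  interpret F: group F by (rule F)
  interpret K: normal K F using C_kernel_normal[OF F K] .
  have kC: "k \<in> carrier F" using x by simp
  let ?l = "inv x \<otimes> (inv (z \<otimes> k) \<otimes> x \<otimes> (z \<otimes> k))"
  have c: "a \<otimes> (inv a \<otimes> b) = b" if "a \<in> carrier F" "b \<in> carrier F" for a b
    using that by (simp add: F.m_assoc[symmetric])
  have "inv z \<otimes> x \<otimes> z = k \<otimes> (x \<otimes> ?l) \<otimes> inv k"
    using x(1,2) kC by (simp add: F.inv_mult_group F.m_assoc c)
  then show ?thesis using xz by blast
qed

text \<open>The centralizer condition: whatever commutes with \<open>x\<close> modulo
  \<open>L\<close> is, modulo \<open>K\<close>, a true centralizing element. The finitely many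
  cosets \<open>z K\<close> are handled separately. If \<open>z K\<close> misses the centralizer and
  \<open>inv z \<otimes> x \<otimes> z\<close> lies in the open subgroup \<open>H\<close>, then that
  element and \<open>x\<close> are not conjugate in \<open>H\<close>, and a quotient from
  \<open>C\<close> separating them there yields an \<open>L\<close> which no element of
  \<open>z K\<close> passes.\<close>

lemma centralizer_condition:
  fixes F :: "('a, 'm) monoid_scheme" (structure)
  assumes ext: "extension_closed C" and F: "group F" and hcs: "hereditarily_conjugacy_separable C F"
    and x: "x \<in> carrier F" and K: "C_kernel C F K"
  shows "\<exists>L\<subseteq>K. C_kernel C F L \<and>
    (\<forall>g\<in>carrier F. inv x \<otimes> (inv g \<otimes> x \<otimes> g) \<in> L \<longrightarrow>
      (\<exists>c\<in>centralizer F x. \<exists>k\<in>K. g = c \<otimes> k))"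
proof -
  obtain M \<phi> where M: "M \<in> C" "\<phi> \<in> hom F M" "\<phi> ` carrier F = carrier M" "K = kernel F M \<phi>"
    using K unfolding C_kernel_def by (elim bexE conjE) (rule that; assumption)
  interpret F: group F by (rule F)
  interpret K: normal K F using C_kernel_normal[OF F K] .
  interpret \<phi>: group_hom F M \<phi> using F C_group M by (simp add: group_hom_def group_hom_axioms_def)
  have Kiff: "k \<in> K \<longleftrightarrow> k \<in> carrier F \<and> \<phi> k = \<one>\<^bsub>M\<^esub>" for k
    unfolding M(4) kernel_def by blast
  \<comment> \<open>This is the product of \<open>K\<close> with the cyclic group of
    \<open>x\<close>: small enough that conjugating \<open>x\<close> inside \<open>H\<close> is
    conjugating by elements of \<open>K\<close>.\<close>
  define H where "H = {h \<in> carrier F. \<exists>i::int. \<phi> h = \<phi> x [^]\<^bsub>M\<^esub> i}"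
  have xM: "\<phi> x \<in> carrier M" using x by simp
  have HI: "h \<in> H" if "h \<in> carrier F" "\<phi> h = \<phi> x [^]\<^bsub>M\<^esub> i" for h and i :: int
    unfolding H_def using that by blast
  have HE: "h \<in> carrier F" "\<exists>i::int. \<phi> h = \<phi> x [^]\<^bsub>M\<^esub> i" if "h \<in> H" for h
    using that unfolding H_def by blast+
  have xH: "x \<in> H" using HI[OF x, of 1] \<phi>.H.int_pow_1[OF xM] by simp
  have H: "subgroup H F"
  proof (rule F.subgroupI)
    show "H \<subseteq> carrier F" using HE by blast
    show "H \<noteq> {}" using xH by blast
    fix a assume a: "a \<in> H"
    then obtain i :: int where i: "\<phi> a = \<phi> x [^]\<^bsub>M\<^esub> i" using HE by blast
    show "inv a \<in> H" using HI[of "inv a" "- i"] HE(1)[OF a] i \<phi>.H.int_pow_neg[OF xM, of i] by simp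
    fix b assume b: "b \<in> H"
    then obtain j :: int where j: "\<phi> b = \<phi> x [^]\<^bsub>M\<^esub> j" using HE by blast
    show "a \<otimes> b \<in> H"
      using HI[of "a \<otimes> b" "i + j"] HE(1)[OF a] HE(1)[OF b] i j \<phi>.H.int_pow_mult[OF xM, of i j] by simp
  qed
  have KH: "K \<subseteq> H"
  proof
    fix k assume "k \<in> K"
    then show "k \<in> H" using HI[of k 0] by (simp add: Kiff)
  qed
  interpret H: subgroup H F by (rule H)
  have FH: "group (F\<lparr>carrier := H\<rparr>)" using H F by (simp add: subgroup.subgroup_is_group)
  have csH: "conjugacy_separable C (F\<lparr>carrier := H\<rparr>)"
    using hcs openin_pro_topology[OF F K H KH] H unfolding hereditarily_conjugacy_separable_def by blast
  have "\<exists>L\<subseteq>K. C_kernel C F L \<and> (\<forall>k\<in>K. inv x \<otimes> (inv (z \<otimes> k) \<otimes> x \<otimes> (z \<otimes> k)) \<in> L \<longrightarrow>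
      (\<exists>k'\<in>K. z \<otimes> k' \<in> centralizer F x))" if z: "z \<in> carrier F" for z
  \<comment> \<open>In the negative case \<open>L = K\<close> works: the premise with
    \<open>K\<close> already forces \<open>inv z \<otimes> x \<otimes> z\<close> into
    \<open>H\<close>.\<close>
  proof (cases "inv z \<otimes> x \<otimes> z \<in> H \<and> \<not> (\<exists>k'\<in>K. z \<otimes> k' \<in> centralizer F x)")
    case False
    have "\<exists>k'\<in>K. z \<otimes> k' \<in> centralizer F x"
      if k: "k \<in> K" "inv x \<otimes> (inv (z \<otimes> k) \<otimes> x \<otimes> (z \<otimes> k)) \<in> K" for k
    proof -
      obtain l where "l \<in> K" "inv z \<otimes> x \<otimes> z = k \<otimes> (x \<otimes> l) \<otimes> inv k"
        using C_kernel_commutator[OF F K subset_refl x z k] by blast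
      then have "inv z \<otimes> x \<otimes> z \<in> H" using k KH xH by auto
      then show ?thesis using False by blast
    qed
    then show ?thesis using K by blast
  next
    case True
    let ?y = "inv z \<otimes> x \<otimes> z"
    have "\<not> conjugate_in (F\<lparr>carrier := H\<rparr>) x ?y"
    proof
      assume "conjugate_in (F\<lparr>carrier := H\<rparr>) x ?y"
      then obtain h where h: "h \<in> H" "?y = h \<otimes> x \<otimes> inv h"
        using F.m_inv_consistent[OF H] unfolding conjugate_in_def by auto
      then obtain i :: int where i: "h \<in> carrier F" "\<phi> h = \<phi> x [^]\<^bsub>M\<^esub> i" unfolding H_def by blast
      let ?k = "h \<otimes> x [^] (- i)"
      have xi: "\<phi> (x [^] (- i)) = \<phi> x [^]\<^bsub>M\<^esub> (- i)" using x by (simp add: \<phi>.hom_int_pow)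
      have "?k \<in> K" unfolding Kiff using i x xi \<phi>.H.int_pow_mult[OF xM, of i "- i"] by simp
      have zh: "x \<otimes> (z \<otimes> h) = z \<otimes> h \<otimes> x"
      proof -
        have "x \<otimes> (z \<otimes> h) = z \<otimes> ?y \<otimes> h"
          using x z i(1) by (simp add: F.m_assoc[symmetric])
        also have "\<dots> = z \<otimes> h \<otimes> x" unfolding h(2) using x z i(1) by (simp add: F.m_assoc)
        finally show ?thesis .
      qed
      have xx: "x [^] (- i) \<otimes> x = x \<otimes> x [^] (- i)"
        using F.int_pow_mult[OF x, of "- i" 1] F.int_pow_mult[OF x, of 1 "- i"] x by (simp add: add.commute)
      have "z \<otimes> ?k \<otimes> x = z \<otimes> h \<otimes> x \<otimes> x [^] (- i)"
        using x z i(1) xx by (simp add: F.m_assoc)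
      also have "\<dots> = x \<otimes> (z \<otimes> ?k)" unfolding zh[symmetric] using x z i(1) by (simp add: F.m_assoc)
      finally have "z \<otimes> ?k \<in> centralizer F x" using x z i(1) unfolding centralizer_def by simp
      then show False using True \<open>?k \<in> K\<close> by blast
    qed
    then have "\<exists>M'\<in>C. \<exists>\<psi>\<in>hom (F\<lparr>carrier := H\<rparr>) M'. \<not> conjugate_in M' (\<psi> x) (\<psi> ?y)"
      using csH[unfolded conjugacy_separable_def, rule_format, of x ?y] True xH by simp
    then obtain M' \<psi> where M': "M' \<in> C" "\<psi> \<in> hom (F\<lparr>carrier := H\<rparr>) M'" "\<not> conjugate_in M' (\<psi> x) (\<psi> ?y)"
      by blast
    interpret \<psi>: group_hom "F\<lparr>carrier := H\<rparr>" M' \<psi> using FH C_group M' by (simp add: group_hom_def group_hom_axioms_def)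
    obtain L where L: "L \<subseteq> K" "C_kernel C F L" "\<forall>l\<in>L. \<psi> l = \<one>\<^bsub>M'\<^esub>"
      using C_kernel_inside[OF ext F K H KH M'(1,2)] by blast
    have False if k: "k \<in> K" "inv x \<otimes> (inv (z \<otimes> k) \<otimes> x \<otimes> (z \<otimes> k)) \<in> L" for k
    proof -
      obtain l where l: "l \<in> L" "?y = k \<otimes> (x \<otimes> l) \<otimes> inv k"
        using C_kernel_commutator[OF F K L(1) x z k] by blast
      have kl: "k \<in> H" "l \<in> H" using k l(1) L(1) KH by blast+
      have hm: "\<psi> (a \<otimes> b) = \<psi> a \<otimes>\<^bsub>M'\<^esub> \<psi> b" "\<psi> a \<in> carrier M'" if "a \<in> H" "b \<in> H" for a b
        using \<psi>.hom_mult[of a b] \<psi>.hom_closed[of a] that by simp_all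
      have hi: "\<psi> (inv k) = inv\<^bsub>M'\<^esub> \<psi> k" using \<psi>.hom_inv[of k] kl F.m_inv_consistent[OF H] by simp
      have "\<psi> ?y = \<psi> k \<otimes>\<^bsub>M'\<^esub> \<psi> x \<otimes>\<^bsub>M'\<^esub> inv\<^bsub>M'\<^esub> \<psi> k"
        unfolding l(2) using kl xH L(3) l(1) hm hi by simp
      then show False using M'(3) hm(2)[OF kl(1) xH] unfolding conjugate_in_def by blast
    qed
    then show ?thesis using L by blast
  qed
  then have "\<forall>z\<in>carrier F. \<exists>L. L \<subseteq> K \<and> C_kernel C F L \<and> (\<forall>k\<in>K. inv x \<otimes> (inv (z \<otimes> k) \<otimes> x \<otimes> (z \<otimes> k)) \<in> L \<longrightarrow>
      (\<exists>k'\<in>K. z \<otimes> k' \<in> centralizer F x))" by blast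
  from bchoice[OF this] obtain L where L: "\<forall>z\<in>carrier F. L z \<subseteq> K \<and> C_kernel C F (L z) \<and>
      (\<forall>k\<in>K. inv x \<otimes> (inv (z \<otimes> k) \<otimes> x \<otimes> (z \<otimes> k)) \<in> L z \<longrightarrow>
      (\<exists>k'\<in>K. z \<otimes> k' \<in> centralizer F x))" by blast
  obtain T where T: "finite T" "T \<subseteq> carrier F" "T \<noteq> {}" "\<forall>a\<in>carrier F. \<exists>t\<in>T. \<exists>k\<in>K. a = t \<otimes> k"
    using C_kernel_transversal[OF F K] by blast
  define L0 where "L0 = (\<Inter>t\<in>T. L t)"
  have "C_kernel C F L0" unfolding L0_def using T L by (intro C_kernel_INT[OF F]) auto
  moreover have "L0 \<subseteq> K" using T L unfolding L0_def by blast
  moreover have "\<exists>c\<in>centralizer F x. \<exists>k\<in>K. g = c \<otimes> k"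
    if g: "g \<in> carrier F" and gx: "inv x \<otimes> (inv g \<otimes> x \<otimes> g) \<in> L0" for g
  proof -
    obtain t k where t: "t \<in> T" "k \<in> K" "g = t \<otimes> k" using T(4) g by blast
    have tC: "t \<in> carrier F" using t(1) T(2) by blast
    have "inv x \<otimes> (inv (t \<otimes> k) \<otimes> x \<otimes> (t \<otimes> k)) \<in> L t" using gx t(1) unfolding L0_def t(3) by blast
    then obtain k' where k': "k' \<in> K" "t \<otimes> k' \<in> centralizer F x" using L tC t(2) by blast
    have "g = (t \<otimes> k') \<otimes> (inv k' \<otimes> k)"
      unfolding t(3) using tC t(2) k'(1) K.mem_carrier by (simp add: F.m_assoc[symmetric]) (simp add: F.m_assoc)
    then show ?thesis using k' t(2) by blast
  qed
  ultimately show ?thesis by blast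
qed

section \<open>Separability expressed by kernels\<close>

text \<open>A conjugating element of \<open>M\<close> lifts to \<open>G\<close>, since
  \<open>C_kernel\<close> supplies a surjection.\<close>

lemma conjugacy_separableI:
  fixes G :: "('a, 'm) monoid_scheme" (structure)
  assumes G: "group G"
    and sep: "\<And>x y. x \<in> carrier G \<Longrightarrow> y \<in> carrier G \<Longrightarrow> \<not> conjugate_in G x y \<Longrightarrow>
      \<exists>L. C_kernel C G L \<and> (\<forall>g\<in>carrier G. inv y \<otimes> (g \<otimes> x \<otimes> inv g) \<notin> L)"
  shows "conjugacy_separable C G"
  unfolding conjugacy_separable_def
proof (intro ballI impI)
  fix x y assume xy: "x \<in> carrier G" "y \<in> carrier G" "\<not> conjugate_in G x y"
  obtain L where L: "C_kernel C G L" "\<forall>g\<in>carrier G. inv y \<otimes> (g \<otimes> x \<otimes> inv g) \<notin> L"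
    using sep[OF xy] by blast
  obtain M \<phi> where M: "M \<in> C" "\<phi> \<in> hom G M" "\<phi> ` carrier G = carrier M" "L = kernel G M \<phi>"
    using L(1) unfolding C_kernel_def by blast
  interpret \<phi>: group_hom G M \<phi> using G C_group M by (simp add: group_hom_def group_hom_axioms_def)
  have "\<not> conjugate_in M (\<phi> x) (\<phi> y)"
  proof
    assume "conjugate_in M (\<phi> x) (\<phi> y)"
    then obtain m where m: "m \<in> carrier M" "\<phi> y = m \<otimes>\<^bsub>M\<^esub> \<phi> x \<otimes>\<^bsub>M\<^esub> inv\<^bsub>M\<^esub> m" unfolding conjugate_in_def by blast
    then obtain g where g: "g \<in> carrier G" "m = \<phi> g" using M(3) by blast
    have "\<phi> (g \<otimes> x \<otimes> inv g) = \<phi> y" using m g xy by simp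
    then have "inv y \<otimes> (g \<otimes> x \<otimes> inv g) \<in> L" using g xy by (simp add: M(4) kernel_def)
    then show False using L(2) g(1) by blast
  qed
  then show "\<exists>M\<in>C. \<exists>\<phi>\<in>hom G M. \<not> conjugate_in M (\<phi> x) (\<phi> y)" using M by blast
qed

lemma conjugacy_separable_kernel:
  fixes G :: "('a, 'm) monoid_scheme" (structure)
  assumes G: "group G" "conjugacy_separable C G" and xy: "x \<in> carrier G" "y \<in> carrier G" "\<not> conjugate_in G x y"
  shows "\<exists>L. C_kernel C G L \<and> (\<forall>g\<in>carrier G. inv y \<otimes> (g \<otimes> x \<otimes> inv g) \<notin> L)"
proof -
  obtain M \<phi> where M: "M \<in> C" "\<phi> \<in> hom G M" "\<not> conjugate_in M (\<phi> x) (\<phi> y)"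
    using G(2) xy unfolding conjugacy_separable_def by blast
  interpret \<phi>: group_hom G M \<phi> using G C_group M by (simp add: group_hom_def group_hom_axioms_def)
  have "inv y \<otimes> (g \<otimes> x \<otimes> inv g) \<notin> kernel G M \<phi>" if g: "g \<in> carrier G" for g
  proof
    assume "inv y \<otimes> (g \<otimes> x \<otimes> inv g) \<in> kernel G M \<phi>"
    then have "inv\<^bsub>M\<^esub> \<phi> y \<otimes>\<^bsub>M\<^esub> (\<phi> g \<otimes>\<^bsub>M\<^esub> \<phi> x \<otimes>\<^bsub>M\<^esub> inv\<^bsub>M\<^esub> \<phi> g) = \<one>\<^bsub>M\<^esub>" using g xy by (simp add: kernel_def)
    then have "\<phi> y = \<phi> g \<otimes>\<^bsub>M\<^esub> \<phi> x \<otimes>\<^bsub>M\<^esub> inv\<^bsub>M\<^esub> \<phi> g" using g xy by (simp add: \<phi>.H.inv_solve_left')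
    then show False using M(3) g unfolding conjugate_in_def by auto
  qed
  moreover have "belongs_to M C" using M(1) \<phi>.H.is_group iso_refl unfolding belongs_to_def by blast
  then have "C_kernel C G (kernel G M \<phi>)" using C_kernel_hom[OF G(1) _ M(2)] by blast
  ultimately show ?thesis by blast
qed

lemma residually_Mod_iff:
  fixes F :: "('a, 'm) monoid_scheme" (structure)
  assumes F: "group F" and N: "N \<lhd> F"
  shows "residually C (F Mod N) \<longleftrightarrow> (\<forall>f\<in>carrier F - N. \<exists>K. C_kernel C F K \<and> N \<subseteq> K \<and> f \<notin> K)"
proof -
  interpret F: group F by (rule F)
  interpret N: normal N F by (rule N)
  have Q: "group (F Mod N)" by (rule N.factorgroup_is_group)
  have one: "N #> f = N \<longleftrightarrow> f \<in> N" if "f \<in> carrier F" for f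
    using F.coset_join1[OF _ that N.subgroup_axioms] F.coset_join2[OF that N.subgroup_axioms] by blast
  show ?thesis
  proof
    assume R: "residually C (F Mod N)"
    show "\<forall>f\<in>carrier F - N. \<exists>K. C_kernel C F K \<and> N \<subseteq> K \<and> f \<notin> K"
    proof
      fix f assume f: "f \<in> carrier F - N"
      then have "N #> f \<in> carrier (F Mod N) - {\<one>\<^bsub>F Mod N\<^esub>}" using one by (auto simp: carrier_FactGroup)
      then obtain M \<phi> where M: "M \<in> C" "\<phi> \<in> hom (F Mod N) M" "\<phi> (N #> f) \<noteq> \<one>\<^bsub>M\<^esub>"
        using R unfolding residually_def by blast
      interpret \<phi>: group_hom "F Mod N" M \<phi> using Q C_group M by (simp add: group_hom_def group_hom_axioms_def)
      let ?\<psi> = "\<phi> \<circ> (\<lambda>a. N #> a)"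
      have "belongs_to M C" using M(1) \<phi>.H.is_group iso_refl unfolding belongs_to_def by blast
      then have "C_kernel C F (kernel F M ?\<psi>)" using C_kernel_hom[OF F] hom_compose[OF N.r_coset_hom_Mod M(2)] by blast
      moreover have "N \<subseteq> kernel F M ?\<psi>"
      proof
        fix n assume n: "n \<in> N"
        then have "N #> n = N" using one N.mem_carrier by blast
        then show "n \<in> kernel F M ?\<psi>" using \<phi>.hom_one N.mem_carrier[OF n] by (simp add: kernel_def)
      qed
      moreover have "f \<notin> kernel F M ?\<psi>" using M(3) by (simp add: kernel_def)
      ultimately show "\<exists>K. C_kernel C F K \<and> N \<subseteq> K \<and> f \<notin> K" by blast
    qed
  next
    assume R: "\<forall>f\<in>carrier F - N. \<exists>K. C_kernel C F K \<and> N \<subseteq> K \<and> f \<notin> K"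
    show "residually C (F Mod N)"
      unfolding residually_def
    proof
      fix U assume U: "U \<in> carrier (F Mod N) - {\<one>\<^bsub>F Mod N\<^esub>}"
      obtain f where f: "f \<in> carrier F" "U = N #> f" "f \<notin> N" using one U unfolding carrier_FactGroup by auto
      then obtain K where K: "C_kernel C F K" "N \<subseteq> K" "f \<notin> K" using R by blast
      obtain M \<phi> where M: "M \<in> C" "\<phi> \<in> hom F M" "K = kernel F M \<phi>" using K(1) unfolding C_kernel_def by blast
      interpret \<phi>: group_hom F M \<phi> using F C_group M by (simp add: group_hom_def group_hom_axioms_def)
      obtain g where g: "g \<in> hom (F Mod N) M" "\<And>x. x \<in> carrier F \<Longrightarrow> g (N #> x) = \<phi> x"
        using \<phi>.FactGroup_universal_kernel[OF N] K(2) M(3) by blast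
      have "g U \<noteq> \<one>\<^bsub>M\<^esub>" using g(2)[OF f(1)] f(1,2) K(3) M(3) by (auto simp: kernel_def)
      then show "\<exists>M\<in>C. \<exists>\<phi>\<in>hom (F Mod N) M. \<phi> U \<noteq> \<one>\<^bsub>M\<^esub>" using M(1) g(1) by blast
    qed
  qed
qed

end

section \<open>Subdirect products\<close>

locale subdirect = F1: group F1 + F2: group F2
  for F1 :: "'a monoid" (structure) and F2 :: "'b monoid" +
  fixes G :: "('a \<times> 'b) set"
  assumes subdirect: "subdirect_product F1 F2 G"
begin

abbreviation mult2 (infixl "\<cdot>" 70) where "x \<cdot> y \<equiv> x \<otimes>\<^bsub>F2\<^esub> y"
abbreviation inv2 where "inv2 x \<equiv> inv\<^bsub>F2\<^esub> x"

definition "GG = (F1 \<times>\<times> F2)\<lparr>carrier := G\<rparr>"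
definition "N1 = {a \<in> carrier F1. (a, \<one>\<^bsub>F2\<^esub>) \<in> G}"
definition "N2 = {b \<in> carrier F2. (\<one>, b) \<in> G}"

lemma subgroup_G: "subgroup G (F1 \<times>\<times> F2)"
  using subdirect by (simp add: subdirect_product_def)

lemma group_GG: "group GG"
  unfolding GG_def using subgroup.subgroup_is_group[OF subgroup_G] DirProd_group F1.is_group F2.is_group by blast

sublocale GG: group GG by (rule group_GG)

lemma carrier_GG [simp]: "carrier GG = G" by (simp add: GG_def)

lemma G_carrier: "(a, b) \<in> G \<Longrightarrow> a \<in> carrier F1" "(a, b) \<in> G \<Longrightarrow> b \<in> carrier F2"
  using subgroup.subset[OF subgroup_G] by auto

lemma one_GG [simp]: "\<one>\<^bsub>GG\<^esub> = (\<one>, \<one>\<^bsub>F2\<^esub>)" by (simp add: GG_def)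

lemma mult_GG [simp]: "(a, b) \<otimes>\<^bsub>GG\<^esub> (a', b') = (a \<otimes> a', b \<cdot> b')" by (simp add: GG_def)

lemma G_one [simp]: "(\<one>, \<one>\<^bsub>F2\<^esub>) \<in> G" using GG.one_closed by simp

lemma G_mult: "(a, b) \<in> G \<Longrightarrow> (a', b') \<in> G \<Longrightarrow> (a \<otimes> a', b \<cdot> b') \<in> G"
  using GG.m_closed[of "(a, b)" "(a', b')"] by simp

lemma inv_GG: "(a, b) \<in> G \<Longrightarrow> inv\<^bsub>GG\<^esub> (a, b) = (inv a, inv2 b)"
  unfolding GG_def
  using group.m_inv_consistent[OF DirProd_group[OF F1.is_group F2.is_group] subgroup_G, of "(a, b)"]
    inv_DirProd[OF F1.is_group F2.is_group] G_carrier by simp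

lemma G_inv: "(a, b) \<in> G \<Longrightarrow> (inv a, inv2 b) \<in> G"
  using GG.inv_closed[of "(a, b)"] inv_GG by simp

lemma pow_GG: "(a, b) \<in> G \<Longrightarrow> (a, b) [^]\<^bsub>GG\<^esub> (n::nat) = (a [^] n, b [^]\<^bsub>F2\<^esub> n)"
  by (induction n) auto

lemma G_pow: "(a, b) \<in> G \<Longrightarrow> (a [^] (n::nat), b [^]\<^bsub>F2\<^esub> n) \<in> G"
  using GG.nat_pow_closed[of "(a, b)" n] pow_GG by simp

lemma G_int_pow:
  assumes "(a, b) \<in> G"
  shows "(a [^] (i::int), b [^]\<^bsub>F2\<^esub> i) \<in> G"
proof (cases i)
  case (nonneg n)
  then show ?thesis using G_pow[OF assms] by (simp add: int_pow_int)
next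
  case (neg n)
  then show ?thesis
    using G_inv[OF G_pow[OF assms, of "Suc n"]] G_carrier[OF assms]
    by (simp only: F1.int_pow_neg_int F2.int_pow_neg_int)
qed

lemma lift1: "a \<in> carrier F1 \<Longrightarrow> \<exists>b. (a, b) \<in> G"
  using subdirect unfolding subdirect_product_def by force

lemma lift2: "b \<in> carrier F2 \<Longrightarrow> \<exists>a. (a, b) \<in> G"
  using subdirect unfolding subdirect_product_def by force

lemma fst_hom: "fst \<in> hom GG F1" "fst ` carrier GG = carrier F1"
  and snd_hom: "snd \<in> hom GG F2" "snd ` carrier GG = carrier F2"
  using subdirect G_carrier by (auto simp: hom_def subdirect_product_def)

lemma N1D: "n \<in> N1 \<Longrightarrow> n \<in> carrier F1 \<and> (n, \<one>\<^bsub>F2\<^esub>) \<in> G" by (simp add: N1_def)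

lemma N2D: "n \<in> N2 \<Longrightarrow> n \<in> carrier F2 \<and> (\<one>, n) \<in> G" by (simp add: N2_def)

lemma N1I: "(n, \<one>\<^bsub>F2\<^esub>) \<in> G \<Longrightarrow> n \<in> N1" using G_carrier by (simp add: N1_def)

lemma N2I: "(\<one>, n) \<in> G \<Longrightarrow> n \<in> N2" using G_carrier by (simp add: N2_def)

lemma N1_cancel:
  assumes "(a, b) \<in> G" "(a', b) \<in> G"
  shows "a \<otimes> inv a' \<in> N1"
  using G_mult[OF assms(1) G_inv[OF assms(2)]] assms G_carrier by (simp add: N1_def)

lemma N1_normal: "N1 \<lhd> F1"
  unfolding F1.normal_inv_iff
proof (intro conjI ballI)
  show "subgroup N1 F1"
  proof (rule F1.subgroupI)
    fix a b assume ab: "a \<in> N1" "b \<in> N1"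
    show "inv a \<in> N1" using G_inv[of a "\<one>\<^bsub>F2\<^esub>"] ab by (simp add: N1_def)
    show "a \<otimes> b \<in> N1" using G_mult[of a "\<one>\<^bsub>F2\<^esub>" b "\<one>\<^bsub>F2\<^esub>"] ab by (simp add: N1_def)
  qed (use G_one in \<open>auto simp: N1_def simp del: G_one\<close>)
  fix g n assume g: "g \<in> carrier F1" and n: "n \<in> N1"
  obtain b where b: "(g, b) \<in> G" using lift1[OF g] by blast
  show "g \<otimes> n \<otimes> inv g \<in> N1"
    using G_mult[OF G_mult[OF b, of n "\<one>\<^bsub>F2\<^esub>"] G_inv[OF b]] n g G_carrier[OF b] by (simp add: N1_def)
qed

lemma N2_normal: "N2 \<lhd> F2"
  unfolding F2.normal_inv_iff
proof (intro conjI ballI)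
  show "subgroup N2 F2"
  proof (rule F2.subgroupI)
    fix a b assume ab: "a \<in> N2" "b \<in> N2"
    show "inv2 a \<in> N2" using G_inv[of "\<one>" a] ab by (simp add: N2_def)
    show "a \<cdot> b \<in> N2" using G_mult[of "\<one>" a "\<one>" b] ab by (simp add: N2_def)
  qed (use G_one in \<open>auto simp: N2_def simp del: G_one\<close>)
  fix g n assume g: "g \<in> carrier F2" and n: "n \<in> N2"
  obtain a where a: "(a, g) \<in> G" using lift2[OF g] by blast
  show "g \<cdot> n \<cdot> inv2 g \<in> N2"
    using G_mult[OF G_mult[OF a, of "\<one>" n] G_inv[OF a]] n g G_carrier[OF a] by (simp add: N2_def)
qed

sublocale N1: normal N1 F1 by (rule N1_normal)
sublocale N2: normal N2 F2 by (rule N2_normal)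

lemma conjugate_in_GG:
  assumes "(x1, x2) \<in> G"
  shows "conjugate_in GG (x1, x2) (y1, y2) \<longleftrightarrow>
    (\<exists>g1 g2. (g1, g2) \<in> G \<and> y1 = g1 \<otimes> x1 \<otimes> inv g1 \<and> y2 = g2 \<cdot> x2 \<cdot> inv2 g2)"
  unfolding conjugate_in_def Bex_def split_paired_Ex by (simp add: inv_GG cong: conj_cong)

lemma conjugate_twisted_pair:
  assumes "(x1, x2) \<in> G" "f2 \<in> carrier F2"
  shows "conjugate_in GG (x1, x2) (x1, f2 \<cdot> x2 \<cdot> inv2 f2) \<longleftrightarrow>
    (\<exists>g1 g2. (g1, g2) \<in> G \<and> g1 \<in> centralizer F1 x1 \<and> inv2 f2 \<cdot> g2 \<in> centralizer F2 x2)"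
proof -
  have x: "x1 \<in> carrier F1" "x2 \<in> carrier F2" using G_carrier[OF assms(1)] .
  have "x1 = g1 \<otimes> x1 \<otimes> inv g1 \<longleftrightarrow> g1 \<in> centralizer F1 x1"
    "f2 \<cdot> x2 \<cdot> inv2 f2 = g2 \<cdot> x2 \<cdot> inv2 g2 \<longleftrightarrow> inv2 f2 \<cdot> g2 \<in> centralizer F2 x2" if "(g1, g2) \<in> G" for g1 g2
    using F1.conj_eq_iff_centralizer[of "\<one>" g1 x1] F2.conj_eq_iff_centralizer[of f2 g2 x2] G_carrier[OF that] x assms(2)
    by auto
  then show ?thesis unfolding conjugate_in_GG[OF assms(1)] by blast
qed

end

section \<open>Necessity\<close>

locale subdirect_pseudovariety = subdirect F1 F2 G + finite_pseudovariety C
  for F1 :: "'a monoid" (structure) and F2 :: "'b monoid" and G C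
begin

lemma residually_of_conjugacy_separable:
  assumes cs: "conjugacy_separable C GG"
    and x1: "x1 \<in> N1" "centralizer F1 x1 \<subseteq> N1" and x2: "x2 \<in> N2" "centralizer F2 x2 \<subseteq> N2"
  shows "residually C (F1 Mod N1)"
  unfolding residually_Mod_iff[OF F1.is_group N1_normal]
proof
  fix f1 assume f1: "f1 \<in> carrier F1 - N1"
  then obtain f2 where f: "(f1, f2) \<in> G" using lift1 by blast
  have fC: "f1 \<in> carrier F1" "f2 \<in> carrier F2" using G_carrier[OF f] .
  have xC: "x1 \<in> carrier F1" "x2 \<in> carrier F2" using x1 x2 N1D N2D by blast+
  have xG: "(x1, x2) \<in> G" using G_mult[of x1 "\<one>\<^bsub>F2\<^esub>" "\<one>" x2] N1D[OF x1(1)] N2D[OF x2(1)] by simp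
  define y2 where "y2 = f2 \<cdot> x2 \<cdot> inv2 f2"
  have y2: "y2 \<in> N2" unfolding y2_def using N2.inv_op_closed2[OF fC(2) x2(1)] .
  have y2C: "y2 \<in> carrier F2" using N2D[OF y2] by simp
  have yG: "(x1, y2) \<in> G" using G_mult[of x1 "\<one>\<^bsub>F2\<^esub>" "\<one>" y2] N1D[OF x1(1)] N2D[OF y2] by simp
  have nc: "\<not> conjugate_in GG (x1, x2) (x1, y2)"
  proof
    assume "conjugate_in GG (x1, x2) (x1, y2)"
    then obtain g1 g2 where g: "(g1, g2) \<in> G" "g1 \<in> centralizer F1 x1" "inv2 f2 \<cdot> g2 \<in> centralizer F2 x2"
      unfolding y2_def conjugate_twisted_pair[OF xG fC(2)] by blast
    have gC: "g1 \<in> carrier F1" "g2 \<in> carrier F2" using G_carrier[OF g(1)] .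
    have "g1 \<in> N1" using x1(2) g(2) by blast
    then have "(\<one>, g2) \<in> G" using G_mult[OF G_inv[of g1 "\<one>\<^bsub>F2\<^esub>"] g(1)] N1D[of g1] gC by simp
    then have g2: "g2 \<in> N2" by (rule N2I)
    have "g2 \<cdot> inv2 (inv2 f2 \<cdot> g2) \<in> N2" using x2(2) g(3) g2 by blast
    then have "f2 \<in> N2" using gC fC by (simp add: F2.inv_mult_group F2.inv_mult_cancel)
    then have "(\<one>, f2) \<in> G" using N2D by blast
    then have "(f1, \<one>\<^bsub>F2\<^esub>) \<in> G" using G_mult[OF f G_inv[of "\<one>" f2]] fC by simp
    then show False using N1I f1 by blast
  qed
  obtain L where L: "C_kernel C GG L" "\<forall>g \<in> carrier GG. inv\<^bsub>GG\<^esub> (x1, y2) \<otimes>\<^bsub>GG\<^esub> (g \<otimes>\<^bsub>GG\<^esub> (x1, x2) \<otimes>\<^bsub>GG\<^esub> inv\<^bsub>GG\<^esub> g) \<notin> L"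
    using conjugacy_separable_kernel[OF group_GG cs _ _ nc] xG yG unfolding carrier_GG by blast
  interpret L: normal L GG using C_kernel_normal[OF group_GG L(1)] .
  have LG: "L \<subseteq> G" using L.subset by simp
  have K0: "C_kernel C F1 (fst ` L)" using C_kernel_image[OF group_GG F1.is_group fst_hom L(1)] .
  \<comment> \<open>The image of \<open>L\<close> in \<open>F1\<close>, enlarged by
    \<open>N1\<close> so that it defines a quotient of \<open>F1 Mod N1\<close>.\<close>
  define K where "K = fst ` L <#>\<^bsub>F1\<^esub> N1"
  have Kn: "K \<lhd> F1"
    unfolding K_def using F1.normal_subgroup_set_mult_closed C_kernel_normal[OF F1.is_group K0] N1_normal by blast
  have "fst ` L \<subseteq> K"
  proof
    fix a assume a: "a \<in> fst ` L"
    then have "a \<in> carrier F1" using LG G_carrier by force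
    then have "a = a \<otimes> \<one>" by simp
    then show "a \<in> K" unfolding K_def set_mult_def using a N1.one_closed by blast
  qed
  then have "C_kernel C F1 K" using C_kernel_superset[OF F1.is_group K0 _ Kn] by blast
  moreover have "N1 \<subseteq> K"
  proof
    fix n assume n: "n \<in> N1"
    have "fst \<one>\<^bsub>GG\<^esub> \<in> fst ` L" using L.one_closed by blast
    then have "\<one> \<in> fst ` L" by simp
    moreover have "n = \<one> \<otimes> n" using n by simp
    ultimately show "n \<in> K" unfolding K_def set_mult_def using n by blast
  qed
  moreover have "f1 \<notin> K"
  proof
    assume "f1 \<in> K"
    then obtain l n1 where l: "l \<in> L" "n1 \<in> N1" "f1 = fst l \<otimes> n1" unfolding K_def set_mult_def by blast
    obtain l1 l2 where l12: "l = (l1, l2)" by (cases l)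
    have lG: "(l1, l2) \<in> G" using l(1) LG l12 by blast
    have lC: "l1 \<in> carrier F1" "l2 \<in> carrier F2" using G_carrier[OF lG] .
    have n1C: "n1 \<in> carrier F1" "(n1, \<one>\<^bsub>F2\<^esub>) \<in> G" using N1D[OF l(2)] by auto
    \<comment> \<open>The decomposition of \<open>f1\<close> lifts to
      \<open>(f1, f2) = (l1, l2) (n1, n2)\<close>, and removing \<open>n1\<close> leaves
      \<open>(\<one>, n2)\<close> in \<open>G\<close>. This element takes \<open>(x1, x2)\<close> to
      \<open>(x1, w)\<close>, which differs from \<open>(x1, y2)\<close> only by a conjugation with
      an element of \<open>L\<close>.\<close>
    define n2 where "n2 = inv2 l2 \<cdot> f2"
    have n2C: "n2 \<in> carrier F2" using lC fC by (simp add: n2_def)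
    have f2: "f2 = l2 \<cdot> n2" using lC fC by (simp add: n2_def F2.inv_mult_cancel)
    have "(n1, n2) \<in> G"
      using G_mult[OF G_inv[OF lG] f] l(3) l12 lC n1C by (simp add: n2_def F1.inv_mult_cancel)
    then have n2G: "(\<one>, n2) \<in> G" using G_mult[OF G_inv[OF n1C(2)], of n1 n2] n1C n2C by simp
    define w where "w = n2 \<cdot> x2 \<cdot> inv2 n2"
    have w: "w \<in> carrier F2" using n2C xC by (simp add: w_def)
    have wG: "(\<one>, w) \<in> G"
      using N2.inv_op_closed2[OF n2C x2(1)] N2D unfolding w_def by blast
    have y2w: "y2 = l2 \<cdot> w \<cdot> inv2 l2"
      unfolding y2_def f2 w_def using lC n2C xC by (simp add: F2.inv_mult_group F2.m_assoc)
    let ?g = "(\<one>, n2)"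
    have "inv\<^bsub>GG\<^esub> (x1, y2) \<otimes>\<^bsub>GG\<^esub> (?g \<otimes>\<^bsub>GG\<^esub> (x1, x2) \<otimes>\<^bsub>GG\<^esub> inv\<^bsub>GG\<^esub> ?g) = (\<one>, inv2 y2 \<cdot> w)"
      using xC n2C y2C w inv_GG[OF yG] inv_GG[OF n2G] by (simp add: w_def)
    \<comment> \<open>A commutator of an element of \<open>L\<close>. Its first coordinate is
      trivial because \<open>(\<one>, inv2 w)\<close> commutes with \<open>F1\<close>.\<close>
    also have "\<dots> = (l1, l2) \<otimes>\<^bsub>GG\<^esub> ((\<one>, inv2 w) \<otimes>\<^bsub>GG\<^esub> inv\<^bsub>GG\<^esub> (l1, l2) \<otimes>\<^bsub>GG\<^esub> inv\<^bsub>GG\<^esub> (\<one>, inv2 w))"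
      using lC w inv_GG[OF lG] inv_GG[OF G_inv[OF wG]] by (simp add: y2w F2.inv_mult_group F2.m_assoc)
    also have "\<dots> \<in> L"
    proof (rule L.m_closed)
      show "(l1, l2) \<in> L" using l(1) l12 by simp
      have "(\<one>, inv2 w) \<in> carrier GG" using G_inv[OF wG] by simp
      then show "(\<one>, inv2 w) \<otimes>\<^bsub>GG\<^esub> inv\<^bsub>GG\<^esub> (l1, l2) \<otimes>\<^bsub>GG\<^esub> inv\<^bsub>GG\<^esub> (\<one>, inv2 w) \<in> L"
        using L.inv_op_closed2 L.m_inv_closed[of "(l1, l2)"] l(1) l12 by blast
    qed
    finally show False using L(2) n2G by auto
  qed
  ultimately show "\<exists>K. C_kernel C F1 K \<and> N1 \<subseteq> K \<and> f1 \<notin> K" by blast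
qed

end

context subdirect_pseudovariety
begin

lemma periodic_of_conjugacy_separable:
  assumes cs: "conjugacy_separable C GG"
    and q: "\<And>M x. M \<in> C \<Longrightarrow> x \<in> carrier M \<Longrightarrow> coprime (group.ord M x) q" "1 < q"
    and prim1: "\<And>h. h \<in> carrier F1 \<Longrightarrow> \<exists>n \<in> N1. \<forall>v \<in> centralizer F1 (h \<otimes> n). \<exists>i::int. v = (h \<otimes> n) [^] i"
    and prim2: "\<And>h. h \<in> carrier F2 \<Longrightarrow> \<exists>n \<in> N2. \<forall>v \<in> centralizer F2 (h \<cdot> n). \<exists>i::int. v = (h \<cdot> n) [^]\<^bsub>F2\<^esub> i"
  shows "periodic_group (F1 Mod N1)"
  unfolding periodic_group_def
proof (intro ballI notI)
  fix U assume U: "U \<in> carrier (F1 Mod N1)" and ord0: "group.ord (F1 Mod N1) U = 0"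
  define Qt where "Qt = F1 Mod N1"
  interpret Qt: group Qt unfolding Qt_def by (rule N1.factorgroup_is_group)
  obtain f1 where f1: "f1 \<in> carrier F1" "U = N1 #> f1" using U unfolding carrier_FactGroup by blast
  obtain f2 where f: "(f1, f2) \<in> G" using lift1[OF f1(1)] by blast
  have fC: "f1 \<in> carrier F1" "f2 \<in> carrier F2" using G_carrier[OF f] .
  have UC: "U \<in> carrier Qt" using U by (simp add: Qt_def)
  have inf: "i = 0" if "U [^]\<^bsub>Qt\<^esub> i = \<one>\<^bsub>Qt\<^esub>" for i :: int
    using that Qt.int_pow_eq_id[OF UC, of i] ord0 unfolding Qt_def[symmetric] by simp
  obtain n1 where n1: "n1 \<in> N1" "\<forall>v \<in> centralizer F1 (f1 [^] q \<otimes> n1). \<exists>i::int. v = (f1 [^] q \<otimes> n1) [^] i"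
    using prim1[of "f1 [^] q"] fC by blast
  obtain n2 where n2: "n2 \<in> N2" "\<forall>v \<in> centralizer F2 (f2 [^]\<^bsub>F2\<^esub> q \<cdot> n2). \<exists>i::int. v = (f2 [^]\<^bsub>F2\<^esub> q \<cdot> n2) [^]\<^bsub>F2\<^esub> i"
    using prim2[of "f2 [^]\<^bsub>F2\<^esub> q"] fC by blast
  have nC: "n1 \<in> carrier F1" "n2 \<in> carrier F2" "(n1, \<one>\<^bsub>F2\<^esub>) \<in> G" "(\<one>, n2) \<in> G" using n1(1) n2(1) N1D N2D by blast+
  define c where "c = f1 [^] q \<otimes> n1"
  define d where "d = f2 [^]\<^bsub>F2\<^esub> q \<cdot> n2"
  have cC: "c \<in> carrier F1" "d \<in> carrier F2" using fC nC by (simp_all add: c_def d_def)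
  have cfG: "(c, f2 [^]\<^bsub>F2\<^esub> q) \<in> G" using G_mult[OF G_pow[OF f] nC(3), of q] fC by (simp add: c_def)
  have cdG: "(c, d) \<in> G" using G_mult[OF cfG nC(4)] cC unfolding d_def by simp
  define n2' where "n2' = f2 \<cdot> n2 \<cdot> inv2 f2"
  have n2': "n2' \<in> carrier F2" "(\<one>, n2') \<in> G"
    using N2.inv_op_closed2[OF fC(2) n2(1)] N2D unfolding n2'_def by blast+
  define y2 where "y2 = f2 \<cdot> d \<cdot> inv2 f2"
  have ff: "f2 [^]\<^bsub>F2\<^esub> q \<cdot> f2 = f2 \<cdot> f2 [^]\<^bsub>F2\<^esub> q" using F2.nat_pow_Suc2[OF fC(2), of q] by simp
  have "y2 = f2 \<cdot> f2 [^]\<^bsub>F2\<^esub> q \<cdot> (n2 \<cdot> inv2 f2)" unfolding y2_def d_def using fC nC by (simp add: F2.m_assoc)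
  also have "\<dots> = f2 [^]\<^bsub>F2\<^esub> q \<cdot> n2'" unfolding ff[symmetric] n2'_def using fC nC by (simp add: F2.m_assoc)
  finally have y2: "y2 = f2 [^]\<^bsub>F2\<^esub> q \<cdot> n2'" .
  have y2C: "y2 \<in> carrier F2" using fC n2' by (simp add: y2)
  have yG: "(c, y2) \<in> G" unfolding y2 using G_mult[OF cfG n2'(2)] cC by simp
  have nc: "\<not> conjugate_in GG (c, d) (c, y2)"
  proof
    assume "conjugate_in GG (c, d) (c, y2)"
    then obtain g1 g2 where g: "(g1, g2) \<in> G" "g1 \<in> centralizer F1 c" "inv2 f2 \<cdot> g2 \<in> centralizer F2 d"
      unfolding y2_def conjugate_twisted_pair[OF cdG fC(2)] by blast
    have gC: "g1 \<in> carrier F1" "g2 \<in> carrier F2" using G_carrier[OF g(1)] .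
    obtain i :: int where i: "g1 = c [^] i" using g(2) n1(2) unfolding c_def by blast
    obtain j :: int where j: "inv2 f2 \<cdot> g2 = d [^]\<^bsub>F2\<^esub> j" using g(3) n2(2) unfolding d_def by blast
    have g2: "g2 = f2 \<cdot> d [^]\<^bsub>F2\<^esub> j" unfolding j[symmetric] using gC fC by (simp add: F2.inv_mult_cancel)
    \<comment> \<open>Dividing the conjugating pair by the \<open>i\<close>-th power of
      \<open>(c, d)\<close> leaves only \<open>f2 d^(j-i)\<close>. Over \<open>F1 Mod N1\<close>
      this reads \<open>U^(1 + q (j-i)) = 1\<close>, impossible for \<open>U\<close> of infinite
      order and \<open>q > 1\<close>.\<close>
    have "(c [^] i \<otimes> c [^] (- i), f2 \<cdot> d [^]\<^bsub>F2\<^esub> j \<cdot> d [^]\<^bsub>F2\<^esub> (- i)) \<in> G"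
      using G_mult[OF g(1) G_int_pow[OF cdG, of "- i"]] unfolding i g2 .
    moreover have "c [^] i \<otimes> c [^] (- i) = \<one>" using F1.int_pow_mult[OF cC(1), of i "- i"] by simp
    moreover have "f2 \<cdot> d [^]\<^bsub>F2\<^esub> j \<cdot> d [^]\<^bsub>F2\<^esub> (- i) = f2 \<cdot> d [^]\<^bsub>F2\<^esub> (j - i)"
      using F2.int_pow_mult[OF cC(2), of j "- i"] fC cC by (simp add: F2.m_assoc)
    ultimately have 1: "(\<one>, f2 \<cdot> d [^]\<^bsub>F2\<^esub> (j - i)) \<in> G" by simp
    have "(f1 \<otimes> c [^] (j - i), f2 \<cdot> d [^]\<^bsub>F2\<^esub> (j - i)) \<in> G" using G_mult[OF f G_int_pow[OF cdG]] .
    from N1_cancel[OF this 1] have t: "f1 \<otimes> c [^] (j - i) \<in> N1" using fC cC by simp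
    have cU: "N1 #> c = U [^]\<^bsub>Qt\<^esub> q"
    proof -
      have "c \<in> f1 [^] q <#\<^bsub>F1\<^esub> N1" unfolding c_def l_coset_def using n1(1) by blast
      then have "c \<in> N1 #> f1 [^] q" using N1.coset_eq fC by simp
      then have "N1 #> c = N1 #> f1 [^] q" using F1.repr_independence[OF _ _ N1.subgroup_axioms] fC by simp
      also have "\<dots> = U [^]\<^bsub>Qt\<^esub> q" unfolding f1(2) Qt_def using N1.FactGroup_pow[OF fC(1)] by simp
      finally show ?thesis .
    qed
    have "\<one>\<^bsub>Qt\<^esub> = N1 #> (f1 \<otimes> c [^] (j - i))"
      using F1.coset_join2[OF _ N1.subgroup_axioms t] fC cC unfolding Qt_def by simp
    also have "\<dots> = (N1 #> f1) \<otimes>\<^bsub>Qt\<^esub> (N1 #> (c [^] (j - i)))"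
      using N1.rcos_sum[OF fC(1), of "c [^] (j - i)"] cC unfolding Qt_def by (simp add: FactGroup_def)
    also have "N1 #> (c [^] (j - i)) = (U [^]\<^bsub>Qt\<^esub> q) [^]\<^bsub>Qt\<^esub> (j - i)"
      using N1.FactGroup_int_pow[OF cC(1), of "j - i"] unfolding Qt_def[symmetric] cU by simp
    also have "N1 #> f1 = U [^]\<^bsub>Qt\<^esub> (1::int)" using f1(2) Qt.int_pow_1[OF UC] by simp
    also have "(U [^]\<^bsub>Qt\<^esub> q) [^]\<^bsub>Qt\<^esub> (j - i) = U [^]\<^bsub>Qt\<^esub> (int q * (j - i))"
      using Qt.int_pow_pow[OF UC, of "int q" "j - i"] by (simp add: int_pow_int)
    also have "U [^]\<^bsub>Qt\<^esub> (1::int) \<otimes>\<^bsub>Qt\<^esub> U [^]\<^bsub>Qt\<^esub> (int q * (j - i)) = U [^]\<^bsub>Qt\<^esub> (1 + int q * (j - i))"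
      using Qt.int_pow_mult[OF UC, of 1 "int q * (j - i)"] by simp
    finally have "1 + int q * (j - i) = 0" using inf by simp
    then have "int q * (i - j) = 1" by (simp add: algebra_simps)
    then show False using q(2) by (simp add: zmult_eq_1_iff)
  qed
  obtain L where L: "C_kernel C GG L" "\<forall>g \<in> carrier GG. inv\<^bsub>GG\<^esub> (c, y2) \<otimes>\<^bsub>GG\<^esub> (g \<otimes>\<^bsub>GG\<^esub> (c, d) \<otimes>\<^bsub>GG\<^esub> inv\<^bsub>GG\<^esub> g) \<notin> L"
    using conjugacy_separable_kernel[OF group_GG cs _ _ nc] cdG yG unfolding carrier_GG by blast
  obtain M \<phi> where M: "M \<in> C" "\<phi> \<in> hom GG M" "L = kernel GG M \<phi>" using L(1) unfolding C_kernel_def by blast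
  have gM: "group M" using C_group[OF M(1)] .
  interpret M: group M by (rule gM)
  interpret \<phi>: group_hom GG M \<phi> using group_GG gM M(2) by (simp add: group_hom_def group_hom_axioms_def)
  have L_iff: "g \<in> L \<longleftrightarrow> g \<in> G \<and> \<phi> g = \<one>\<^bsub>M\<^esub>" for g unfolding M(3) kernel_def by simp
  define e where "e = M.ord (\<phi> (f1, f2))"
  have \<phi>f: "\<phi> (f1, f2) \<in> carrier M" using f by simp
  have "gcd q e = 1" using q(1)[OF M(1) \<phi>f] unfolding e_def by (simp add: coprime_iff_gcd_eq_1 gcd.commute)
  \<comment> \<open>Modulo \<open>L\<close> the pair \<open>(f1, f2)\<close> has order
    \<open>e\<close>, so it equals its own power with exponent \<open>q * k\<close>. The discrepancy
    is \<open>(l1, l2)\<close>, the power with exponent \<open>e * s\<close>, which lies in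
    \<open>L\<close>.\<close>
  then obtain k s where ks: "q * k = e * s + 1" using bezout_nat[of q e] q(2) by auto
  define l1 where "l1 = f1 [^] (e * s)"
  define l2 where "l2 = f2 [^]\<^bsub>F2\<^esub> (e * s)"
  have lG: "(l1, l2) \<in> G" unfolding l1_def l2_def by (rule G_pow[OF f])
  have lC: "l1 \<in> carrier F1" "l2 \<in> carrier F2" using G_carrier[OF lG] .
  have "\<phi> (f1, f2) [^]\<^bsub>M\<^esub> (e * s) = \<one>\<^bsub>M\<^esub>" using M.pow_eq_id[OF \<phi>f] by (simp add: e_def)
  moreover have "\<phi> (l1, l2) = \<phi> (f1, f2) [^]\<^bsub>M\<^esub> (e * s)"
    unfolding l1_def l2_def pow_GG[OF f, symmetric] using \<phi>.hom_nat_pow f by simp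
  ultimately have lL: "(l1, l2) \<in> L" using L_iff lG by simp
  interpret L: normal L GG using C_kernel_normal[OF group_GG L(1)] .
  define u where "u = f2 [^]\<^bsub>F2\<^esub> (q * k)"
  have uC: "u \<in> carrier F2" using fC by (simp add: u_def)
  have u: "u = f2 \<cdot> l2" unfolding u_def l2_def ks using F2.nat_pow_Suc2[OF fC(2), of "e * s"] by simp
  \<comment> \<open>Since \<open>u\<close> and \<open>d^k\<close> agree modulo \<open>N2\<close>,
    the pair \<open>(c^k, u)\<close> belongs to \<open>G\<close>. It is the conjugating element:
    \<open>c^k\<close> fixes \<open>c\<close>, and \<open>u = f2 l2\<close> acts on \<open>d\<close>
    like \<open>f2\<close> modulo \<open>L\<close>.\<close>
  have dk: "N2 #>\<^bsub>F2\<^esub> d [^]\<^bsub>F2\<^esub> k = N2 #>\<^bsub>F2\<^esub> u"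
  proof -
    have "d \<in> f2 [^]\<^bsub>F2\<^esub> q <#\<^bsub>F2\<^esub> N2" unfolding d_def l_coset_def using n2(1) by blast
    then have "d \<in> N2 #>\<^bsub>F2\<^esub> f2 [^]\<^bsub>F2\<^esub> q" using N2.coset_eq fC by simp
    then have "N2 #>\<^bsub>F2\<^esub> d = N2 #>\<^bsub>F2\<^esub> f2 [^]\<^bsub>F2\<^esub> q" using F2.repr_independence[OF _ _ N2.subgroup_axioms] fC by simp
    then show ?thesis
      using N2.FactGroup_pow[OF cC(2), of k] N2.FactGroup_pow[of "f2 [^]\<^bsub>F2\<^esub> q" k] fC by (simp add: u_def F2.nat_pow_pow)
  qed
  have "u \<in> N2 #>\<^bsub>F2\<^esub> d [^]\<^bsub>F2\<^esub> k" unfolding dk using F2.rcos_self[OF uC N2.subgroup_axioms] .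
  then obtain n where n: "n \<in> N2" "u = n \<cdot> d [^]\<^bsub>F2\<^esub> k" unfolding r_coset_def by blast
  have nG: "(\<one>, n) \<in> G" using N2D[OF n(1)] by simp
  have gG: "(c [^] k, u) \<in> G" using G_mult[OF nG G_pow[OF cdG, of k]] cC n(2) by simp
  \<comment> \<open>What \<open>l2\<close> changes in \<open>d\<close>: it commutes with the factor
    \<open>f2^q\<close>, so only its commutator with \<open>n2\<close> is left. As
    \<open>(\<one>, n2)\<close> lies in \<open>G\<close>, normality of \<open>L\<close> puts
    \<open>(\<one>, r)\<close> into \<open>L\<close>.\<close>
  define r where "r = inv2 n2 \<cdot> l2 \<cdot> n2 \<cdot> inv2 l2"
  have rC: "r \<in> carrier F2" using nC lC by (simp add: r_def)
  have rL: "(\<one>, r) \<in> L"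
  proof -
    have n2G: "(\<one>, n2) \<in> carrier GG" using nC by simp
    have "inv\<^bsub>GG\<^esub> (\<one>, n2) \<otimes>\<^bsub>GG\<^esub> (l1, l2) \<otimes>\<^bsub>GG\<^esub> (\<one>, n2) \<in> L" using L.inv_op_closed1[OF n2G lL] .
    then have "inv\<^bsub>GG\<^esub> (\<one>, n2) \<otimes>\<^bsub>GG\<^esub> (l1, l2) \<otimes>\<^bsub>GG\<^esub> (\<one>, n2) \<otimes>\<^bsub>GG\<^esub> inv\<^bsub>GG\<^esub> (l1, l2) \<in> L" using L.m_closed L.m_inv_closed[OF lL] by blast
    moreover have "inv\<^bsub>GG\<^esub> (\<one>, n2) \<otimes>\<^bsub>GG\<^esub> (l1, l2) \<otimes>\<^bsub>GG\<^esub> (\<one>, n2) \<otimes>\<^bsub>GG\<^esub> inv\<^bsub>GG\<^esub> (l1, l2) = (\<one>, r)"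
      using inv_GG[OF nC(4)] inv_GG[OF lG] lC by (simp add: r_def)
    ultimately show ?thesis by simp
  qed
  have fG: "(f1, f2) \<in> carrier GG" using f by simp
  have "(f1, f2) \<otimes>\<^bsub>GG\<^esub> (\<one>, r) \<otimes>\<^bsub>GG\<^esub> inv\<^bsub>GG\<^esub> (f1, f2) \<in> L" using L.inv_op_closed2[OF fG rL] .
  then have 2: "(\<one>, f2 \<cdot> r \<cdot> inv2 f2) \<in> L" using inv_GG[OF f] fC by simp
  have lf: "l2 \<cdot> f2 [^]\<^bsub>F2\<^esub> q = f2 [^]\<^bsub>F2\<^esub> q \<cdot> l2" unfolding l2_def using F2.nat_pow_comm[OF fC(2)] .
  have dinv: "inv2 d \<cdot> (l2 \<cdot> d \<cdot> inv2 l2) = r"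
  proof -
    have "l2 \<cdot> d = f2 [^]\<^bsub>F2\<^esub> q \<cdot> (l2 \<cdot> n2)"
      unfolding d_def using lf fC lC nC by (simp add: F2.m_assoc[symmetric])
    then show ?thesis unfolding r_def using fC lC nC by (simp add: d_def F2.inv_mult_group F2.m_assoc F2.inv_mult_cancel)
  qed
  have "inv\<^bsub>GG\<^esub> (c, y2) \<otimes>\<^bsub>GG\<^esub> ((c [^] k, u) \<otimes>\<^bsub>GG\<^esub> (c, d) \<otimes>\<^bsub>GG\<^esub> inv\<^bsub>GG\<^esub> (c [^] k, u)) = (\<one>, f2 \<cdot> r \<cdot> inv2 f2)"
  proof -
    have "c [^] k \<otimes> c = c \<otimes> c [^] k" using F1.nat_pow_Suc2[OF cC(1), of k] by simp
    then have "c [^] k \<otimes> c \<otimes> inv (c [^] k) = c" using cC by (simp add: F1.m_assoc)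
    moreover have "inv2 y2 \<cdot> (u \<cdot> d \<cdot> inv2 u) = f2 \<cdot> r \<cdot> inv2 f2"
      unfolding dinv[symmetric] u y2_def using fC lC cC by (simp add: F2.inv_mult_group F2.m_assoc F2.inv_mult_cancel)
    ultimately show ?thesis using inv_GG[OF yG] inv_GG[OF gG] cC by simp
  qed
  moreover have "(c [^] k, u) \<in> carrier GG" using gG by simp
  ultimately show False using L(2) 2 by metis
qed

end

section \<open>Sufficiency\<close>

lemma (in normal) coset_int_pow_mod:
  assumes a: "a \<in> carrier G" and fin: "group.ord (G Mod H) (H #> a) \<noteq> 0"
  defines "n \<equiv> int (group.ord (G Mod H) (H #> a))"
  shows "H #> (a [^] (i::int)) = H #> (a [^] (i mod n))"
proof -
  interpret Qt: group "G Mod H" by (rule factorgroup_is_group)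
  have "H #> a \<in> carrier (G Mod H)" using a unfolding carrier_FactGroup by blast
  then have "(H #> a) [^]\<^bsub>G Mod H\<^esub> (i mod n) = (H #> a) [^]\<^bsub>G Mod H\<^esub> i"
    using Qt.int_pow_eq[of "H #> a" "i mod n" i] unfolding n_def by (simp add: minus_mod_eq_mult_div)
  then show ?thesis using FactGroup_int_pow[OF a] by simp
qed

lemma (in finite_pseudovariety) conjugacy_separable_if_hereditarily:
  fixes F :: "'a monoid"
  assumes "group F" "hereditarily_conjugacy_separable C F"
  shows "conjugacy_separable C F"
proof -
  interpret group F by fact
  have "openin (pro_topology C F) (carrier F)"
    unfolding pro_topology_def by (rule topology_generated_by_Basis) simp
  then have "conjugacy_separable C (F\<lparr>carrier := carrier F\<rparr>)"
    using assms(2) subgroup_self unfolding hereditarily_conjugacy_separable_def by blast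
  then show ?thesis by simp
qed

context subdirect_pseudovariety
begin

lemma C_kernel_fst: "C_kernel C F1 K \<Longrightarrow> C_kernel C GG {g \<in> carrier GG. fst g \<in> K}"
  using C_kernel_vimage[OF group_GG F1.is_group fst_hom(1)] .

lemma C_kernel_snd: "C_kernel C F2 K \<Longrightarrow> C_kernel C GG {g \<in> carrier GG. snd g \<in> K}"
  using C_kernel_vimage[OF group_GG F2.is_group snd_hom(1)] .

text \<open>
  The elements \<open>(x1, x2)\<close> and \<open>(x1, f2 x2 f2\<inverse>)\<close> are conjugate in \<open>G\<close> iff \<open>N1\<close> meets the set of all
  \<open>f1 e0\<^sup>j c0\<^sup>-\<^sup>i\<close>, where \<open>c0\<close> and \<open>d0\<close> generate the two centralizers and \<open>(e0, d0)\<close>, \<open>(f1, f2)\<close> lie in \<open>G\<close>.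
  By periodicity this set covers only finitely many cosets of \<open>N1\<close>.
\<close>
lemma separate_twisted_pair:
  assumes ext: "extension_closed C"
    and hcs: "hereditarily_conjugacy_separable C F1" "hereditarily_conjugacy_separable C F2"
    and cc: "cyclic_centralizers F1" "cyclic_centralizers F2"
    and res: "residually C (F1 Mod N1)" and per: "periodic_group (F1 Mod N1)"
    and xG: "(x1, x2) \<in> G" and f2: "f2 \<in> carrier F2"
    and nc: "\<not> conjugate_in GG (x1, x2) (x1, f2 \<cdot> x2 \<cdot> inv2 f2)"
  shows "\<exists>L. C_kernel C GG L \<and> (\<forall>g1 g2. (g1, g2) \<in> G \<longrightarrow>
    (inv x1 \<otimes> (g1 \<otimes> x1 \<otimes> inv g1), inv2 (f2 \<cdot> x2 \<cdot> inv2 f2) \<cdot> (g2 \<cdot> x2 \<cdot> inv2 g2)) \<notin> L)"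
proof -
  have xC: "x1 \<in> carrier F1" "x2 \<in> carrier F2" using G_carrier[OF xG] .
  obtain f1 where f: "(f1, f2) \<in> G" using lift2[OF f2] by blast
  have fC: "f1 \<in> carrier F1" "f2 \<in> carrier F2" using G_carrier[OF f] .
  have ncD: False if "(g1, g2) \<in> G" "g1 \<in> centralizer F1 x1" "inv2 f2 \<cdot> g2 \<in> centralizer F2 x2" for g1 g2
    using nc that unfolding conjugate_twisted_pair[OF xG f2] by blast
  \<comment> \<open>A trivial entry is centralized by its whole factor; the two elements would then
    be conjugate by \<open>(f1, f2)\<close>, or by the identity if it is \<open>x2\<close>. So both
    centralizers are cyclic.\<close>
  have x1: "x1 \<noteq> \<one>"
  proof
    assume "x1 = \<one>"
    then show False using ncD[OF f] fC F2.l_inv[OF f2] xC by (simp add: centralizer_def)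
  qed
  have x2: "x2 \<noteq> \<one>\<^bsub>F2\<^esub>"
  proof
    assume "x2 = \<one>\<^bsub>F2\<^esub>"
    then show False using ncD[OF G_one] fC xC by (simp add: centralizer_def)
  qed
  obtain c0 where c0: "c0 \<in> carrier F1" "centralizer F1 x1 = range (\<lambda>i::int. c0 [^] i)"
    using F1.cyclic_centralizers_generator[OF cc(1) xC(1) x1] by blast
  obtain d0 where d0: "d0 \<in> carrier F2" "centralizer F2 x2 = range (\<lambda>i::int. d0 [^]\<^bsub>F2\<^esub> i)"
    using F2.cyclic_centralizers_generator[OF cc(2) xC(2) x2] by blast
  obtain e0 where e0: "(e0, d0) \<in> G" using lift2[OF d0(1)] by blast
  have e0C: "e0 \<in> carrier F1" using G_carrier[OF e0] by simp
  \<comment> \<open>\<open>e0\<close> is a lift that transports powers of \<open>d0\<close> to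
    \<open>F1\<close>, where both centralizers can be compared modulo \<open>N1\<close>.\<close>
  define w where "w i j = f1 \<otimes> e0 [^] j \<otimes> c0 [^] i" for i j :: int
  have wC: "w i j \<in> carrier F1" for i j using fC e0C c0 by (simp add: w_def)
  have wN: "w i j \<notin> N1" for i j
  proof
    assume n: "w i j \<in> N1"
    have fe: "(f1 \<otimes> e0 [^] j, f2 \<cdot> d0 [^]\<^bsub>F2\<^esub> j) \<in> G" using G_mult[OF f G_int_pow[OF e0]] .
    have "(w i j, \<one>\<^bsub>F2\<^esub>) \<in> G" using n N1D by blast
    from G_mult[OF G_inv[OF this] fe]
    have "(c0 [^] (- i), f2 \<cdot> d0 [^]\<^bsub>F2\<^esub> j) \<in> G"
      using fC e0C c0(1) d0(1) by (simp add: w_def F1.int_pow_neg F1.inv_mult_group F1.m_assoc F1.inv_mult_cancel)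
    then show False
    proof (rule ncD)
      show "c0 [^] (- i) \<in> centralizer F1 x1" unfolding c0(2) by blast
      have "inv2 f2 \<cdot> (f2 \<cdot> d0 [^]\<^bsub>F2\<^esub> j) = d0 [^]\<^bsub>F2\<^esub> j" using fC d0(1) by (simp add: F2.inv_mult_cancel)
      then show "inv2 f2 \<cdot> (f2 \<cdot> d0 [^]\<^bsub>F2\<^esub> j) \<in> centralizer F2 x2" unfolding d0(2) by simp
    qed
  qed
  have sep: "\<exists>K. C_kernel C F1 K \<and> N1 \<subseteq> K \<and> w i j \<notin> K" for i j
    using res wC wN unfolding residually_Mod_iff[OF F1.is_group N1_normal] by blast
  define K0 where "K0 p = (SOME K. C_kernel C F1 K \<and> N1 \<subseteq> K \<and> w (fst p) (snd p) \<notin> K)" for p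
  have K0: "C_kernel C F1 (K0 p)" "N1 \<subseteq> K0 p" "w (fst p) (snd p) \<notin> K0 p" for p
    using someI_ex[OF sep[of "fst p" "snd p"]] unfolding K0_def by blast+
  define o1 where "o1 = int (group.ord (F1 Mod N1) (N1 #> c0))"
  define o2 where "o2 = int (group.ord (F1 Mod N1) (N1 #> e0))"
  have fin: "group.ord (F1 Mod N1) (N1 #> a) \<noteq> 0" if "a \<in> carrier F1" for a
    using per that unfolding periodic_group_def carrier_FactGroup by blast
  have o: "0 < o1" "0 < o2" using fin[OF c0(1)] fin[OF e0C] by (simp_all add: o1_def o2_def)
  \<comment> \<open>Modulo \<open>N1\<close> the element \<open>w i j\<close> depends only on the
    exponents modulo the orders of \<open>c0\<close> and \<open>e0\<close>, so finitely many of the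
    separating kernels suffice.\<close>
  define T where "T = {0..<o1} \<times> {0..<o2}"
  have T: "finite T" "T \<noteq> {}" using o by (auto simp: T_def)
  define K where "K = (\<Inter>p\<in>T. K0 p)"
  have K: "C_kernel C F1 K" unfolding K_def by (rule C_kernel_INT[OF F1.is_group T]) (rule K0(1))
  have NK: "N1 \<subseteq> K" unfolding K_def using K0(2) by blast
  have wK: "w i j \<notin> K" for i j
  proof
    assume wi: "w i j \<in> K"
    have r: "N1 #> (a \<otimes> b) = N1 #> (a' \<otimes> b')"
      if "a \<in> carrier F1" "b \<in> carrier F1" "a' \<in> carrier F1" "b' \<in> carrier F1" "N1 #> a = N1 #> a'" "N1 #> b = N1 #> b'" for a b a' b'
      using N1.rcos_sum[of a b] N1.rcos_sum[of a' b'] that by simp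
    have "N1 #> w i j = N1 #> w (i mod o1) (j mod o2)"
      unfolding w_def o1_def o2_def
      using N1.coset_int_pow_mod[OF c0(1) fin[OF c0(1)], of i] N1.coset_int_pow_mod[OF e0C fin[OF e0C], of j] fC c0(1) e0C
      by (intro r) simp_all
    then have "w (i mod o1) (j mod o2) \<in> N1 #> w i j" using F1.rcos_self[OF wC N1.subgroup_axioms] by simp
    then obtain n where n: "n \<in> N1" "w (i mod o1) (j mod o2) = n \<otimes> w i j" unfolding r_coset_def by blast
    let ?p = "(i mod o1, j mod o2)"
    have p: "?p \<in> T" using o by (simp add: T_def)
    have "w i j \<in> K0 ?p" "n \<in> K0 ?p" using wi p n(1) K0(2) unfolding K_def by blast+
    then have "w (i mod o1) (j mod o2) \<in> K0 ?p"
      unfolding n(2) using subgroup.m_closed[OF normal_imp_subgroup[OF C_kernel_normal[OF F1.is_group K0(1)]]] by blast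
    then show False using K0(3)[of ?p] by simp
  qed
  interpret K: normal K F1 using C_kernel_normal[OF F1.is_group K] .
  \<comment> \<open>The subgroup of \<open>F2\<close> that corresponds to \<open>K\<close> under the
    identification of the two quotients.\<close>
  define K2 where "K2 = snd ` {g \<in> carrier GG. fst g \<in> K}"
  have K2: "C_kernel C F2 K2"
    unfolding K2_def by (rule C_kernel_image[OF group_GG F2.is_group snd_hom C_kernel_fst[OF K]])
  interpret K2: normal K2 F2 using C_kernel_normal[OF F2.is_group K2] .
  obtain L1 where L1: "L1 \<subseteq> K" "C_kernel C F1 L1"
    "\<forall>g \<in> carrier F1. inv x1 \<otimes> (inv g \<otimes> x1 \<otimes> g) \<in> L1 \<longrightarrow> (\<exists>c \<in> centralizer F1 x1. \<exists>k \<in> K. g = c \<otimes> k)"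
    using centralizer_condition[OF ext F1.is_group hcs(1) xC(1) K] by blast
  obtain L2 where L2: "L2 \<subseteq> K2" "C_kernel C F2 L2"
    "\<forall>g \<in> carrier F2. inv2 x2 \<cdot> (inv2 g \<cdot> x2 \<cdot> g) \<in> L2 \<longrightarrow> (\<exists>c \<in> centralizer F2 x2. \<exists>k \<in> K2. g = c \<cdot> k)"
    using centralizer_condition[OF ext F2.is_group hcs(2) xC(2) K2] by blast
  interpret L2: normal L2 F2 using C_kernel_normal[OF F2.is_group L2(2)] .
  define L where "L = {g \<in> carrier GG. fst g \<in> L1} \<inter> {g \<in> carrier GG. snd g \<in> L2}"
  have L: "C_kernel C GG L"
    unfolding L_def using C_kernel_Int[OF group_GG C_kernel_fst[OF L1(2)] C_kernel_snd[OF L2(2)]] .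
  have False
    if g: "(g1, g2) \<in> G" and gL: "(inv x1 \<otimes> (g1 \<otimes> x1 \<otimes> inv g1), inv2 (f2 \<cdot> x2 \<cdot> inv2 f2) \<cdot> (g2 \<cdot> x2 \<cdot> inv2 g2)) \<in> L" for g1 g2
  proof -
    have gC: "g1 \<in> carrier F1" "g2 \<in> carrier F2" using G_carrier[OF g] .
    have gL1: "inv x1 \<otimes> (g1 \<otimes> x1 \<otimes> inv g1) \<in> L1"
      and gL2: "inv2 (f2 \<cdot> x2 \<cdot> inv2 f2) \<cdot> (g2 \<cdot> x2 \<cdot> inv2 g2) \<in> L2" using gL unfolding L_def by auto
    have "\<exists>c \<in> centralizer F1 x1. \<exists>k \<in> K. inv g1 = c \<otimes> k"
      using L1(3)[rule_format, of "inv g1"] gL1 gC by simp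
    then obtain i :: int and k1 where k1: "k1 \<in> K" "inv g1 = c0 [^] i \<otimes> k1" unfolding c0(2) by blast
    \<comment> \<open>Conjugation by \<open>f2\<close> turns the second coordinate of the assumption
      into the premise of the centralizer condition for \<open>x2\<close> and
      \<open>?h\<close>.\<close>
    let ?h = "inv2 g2 \<cdot> f2"
    have "inv2 f2 \<cdot> (inv2 (f2 \<cdot> x2 \<cdot> inv2 f2) \<cdot> (g2 \<cdot> x2 \<cdot> inv2 g2)) \<cdot> f2 \<in> L2"
      using L2.inv_op_closed1[OF fC(2) gL2] .
    moreover have "inv2 f2 \<cdot> (inv2 (f2 \<cdot> x2 \<cdot> inv2 f2) \<cdot> (g2 \<cdot> x2 \<cdot> inv2 g2)) \<cdot> f2 = inv2 x2 \<cdot> (inv2 ?h \<cdot> x2 \<cdot> ?h)"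
      using fC gC xC by (simp add: F2.inv_mult_group F2.m_assoc F2.inv_mult_cancel)
    ultimately have "\<exists>c \<in> centralizer F2 x2. \<exists>k \<in> K2. ?h = c \<cdot> k"
      using L2(3)[rule_format, of ?h] gC fC by simp
    then obtain j :: int and k2 where k2: "k2 \<in> K2" "?h = d0 [^]\<^bsub>F2\<^esub> j \<cdot> k2" unfolding d0(2) by blast
    have kC: "k1 \<in> carrier F1" "k2 \<in> carrier F2" using k1(1) k2(1) by auto
    obtain k' where k': "k' \<in> K" "(k', k2) \<in> G" using k2(1) unfolding K2_def by auto
    have k'C: "k' \<in> carrier F1" using k'(1) by simp
    \<comment> \<open>Two lifts of the same \<open>?h\<close>, one from \<open>G\<close>'s element
      \<open>(g1, g2)\<close> and one from its factorization, agree modulo \<open>N1\<close>.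
      Discarding the factors in \<open>K\<close> and conjugating by a power of \<open>c0\<close>
      shows that some \<open>w i (- j)\<close> lies in \<open>K\<close>.\<close>
    have "(inv g1 \<otimes> f1, ?h) \<in> G" using G_mult[OF G_inv[OF g] f] .
    moreover have "(e0 [^] j \<otimes> k', ?h) \<in> G" unfolding k2(2) using G_mult[OF G_int_pow[OF e0] k'(2)] .
    ultimately have "inv g1 \<otimes> f1 \<otimes> inv (e0 [^] j \<otimes> k') \<in> N1" by (rule N1_cancel)
    then have 1: "inv g1 \<otimes> f1 \<otimes> inv (e0 [^] j \<otimes> k') \<in> K" using NK by blast
    have e: "inv g1 \<otimes> f1 \<otimes> inv (e0 [^] j \<otimes> k') = c0 [^] i \<otimes> k1 \<otimes> f1 \<otimes> inv k' \<otimes> e0 [^] (- j)"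
      unfolding k1(2) using kC k'C e0C fC c0(1) by (simp add: F1.inv_mult_group F1.m_assoc F1.int_pow_neg)
    let ?E = "e0 [^] (- j)"
    have EC: "?E \<in> carrier F1" "c0 [^] i \<in> carrier F1" using e0C c0(1) by simp_all
    have coset: "K #> (c0 [^] i \<otimes> k1 \<otimes> f1 \<otimes> inv k' \<otimes> ?E) = K #> (c0 [^] i \<otimes> f1 \<otimes> ?E)"
    proof -
      have kk: "K #> k1 = K #> \<one>" "K #> inv k' = K #> \<one>"
        using F1.coset_join2[OF _ K.subgroup_axioms] k1(1) k'(1) by simp_all
      have r: "K #> (a \<otimes> b) = K #> (a' \<otimes> b')"
        if "a \<in> carrier F1" "b \<in> carrier F1" "a' \<in> carrier F1" "b' \<in> carrier F1" "K #> a = K #> a'" "K #> b = K #> b'" for a b a' b'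
        using K.rcos_sum[of a b] K.rcos_sum[of a' b'] that by simp
      have "K #> (c0 [^] i \<otimes> k1 \<otimes> f1 \<otimes> inv k' \<otimes> ?E) = K #> (c0 [^] i \<otimes> \<one> \<otimes> f1 \<otimes> \<one> \<otimes> ?E)"
        using kC k'C fC EC kk by (intro r) simp_all
      then show ?thesis using fC EC by simp
    qed
    have "K #> (c0 [^] i \<otimes> f1 \<otimes> ?E) = K"
      using F1.coset_join2[OF _ K.subgroup_axioms 1[unfolded e]] coset kC k'C fC EC by simp
    then have 2: "c0 [^] i \<otimes> f1 \<otimes> ?E \<in> K"
      using F1.coset_join1[OF _ _ K.subgroup_axioms] fC EC by simp
    have "inv (c0 [^] i) \<otimes> (c0 [^] i \<otimes> f1 \<otimes> ?E) \<otimes> c0 [^] i \<in> K" using K.inv_op_closed1[OF EC(2) 2] .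
    then have "w i (- j) \<in> K" unfolding w_def using fC EC by (simp add: F1.m_assoc F1.inv_mult_cancel)
    then show False using wK by blast
  qed
  then show ?thesis using L by blast
qed

lemma conjugacy_separable_of_residually:
  assumes ext: "extension_closed C"
    and hcs: "hereditarily_conjugacy_separable C F1" "hereditarily_conjugacy_separable C F2"
    and cc: "cyclic_centralizers F1" "cyclic_centralizers F2"
    and res: "residually C (F1 Mod N1)" and per: "periodic_group (F1 Mod N1)"
  shows "conjugacy_separable C GG"
proof (rule conjugacy_separableI[OF group_GG])
  fix x y assume "x \<in> carrier GG" "y \<in> carrier GG" and nc: "\<not> conjugate_in GG x y"
  then obtain x1 x2 y1 y2 where xy: "x = (x1, x2)" "y = (y1, y2)" and xG: "(x1, x2) \<in> G" and yG: "(y1, y2) \<in> G"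
    by (cases x, cases y) simp
  have C: "x1 \<in> carrier F1" "x2 \<in> carrier F2" "y1 \<in> carrier F1" "y2 \<in> carrier F2"
    using G_carrier[OF xG] G_carrier[OF yG] by simp_all
  have form: "inv\<^bsub>GG\<^esub> y \<otimes>\<^bsub>GG\<^esub> (g \<otimes>\<^bsub>GG\<^esub> x \<otimes>\<^bsub>GG\<^esub> inv\<^bsub>GG\<^esub> g) = (inv y1 \<otimes> (g1 \<otimes> x1 \<otimes> inv g1), inv2 y2 \<cdot> (g2 \<cdot> x2 \<cdot> inv2 g2))"
    if "(g1, g2) \<in> G" "g = (g1, g2)" for g g1 g2
    using that inv_GG yG unfolding xy by simp
  show "\<exists>L. C_kernel C GG L \<and> (\<forall>g \<in> carrier GG. inv\<^bsub>GG\<^esub> y \<otimes>\<^bsub>GG\<^esub> (g \<otimes>\<^bsub>GG\<^esub> x \<otimes>\<^bsub>GG\<^esub> inv\<^bsub>GG\<^esub> g) \<notin> L)"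
  proof (cases "conjugate_in F1 x1 y1 \<and> conjugate_in F2 x2 y2")
    case False
    then consider "\<not> conjugate_in F1 x1 y1" | "\<not> conjugate_in F2 x2 y2" by blast
    then show ?thesis
    proof cases
      case 1
      have "conjugacy_separable C F1" using conjugacy_separable_if_hereditarily F1.is_group hcs(1) by blast
      then obtain L where L: "C_kernel C F1 L" "\<forall>g \<in> carrier F1. inv y1 \<otimes> (g \<otimes> x1 \<otimes> inv g) \<notin> L"
        using conjugacy_separable_kernel[OF F1.is_group _ C(1,3) 1] by blast
      have "inv\<^bsub>GG\<^esub> y \<otimes>\<^bsub>GG\<^esub> (g \<otimes>\<^bsub>GG\<^esub> x \<otimes>\<^bsub>GG\<^esub> inv\<^bsub>GG\<^esub> g) \<notin> {g \<in> carrier GG. fst g \<in> L}" if g: "g \<in> carrier GG" for g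
      proof -
        obtain g1 g2 where g12: "g = (g1, g2)" by (cases g)
        then have "(g1, g2) \<in> G" using g by simp
        then show ?thesis using form g12 L(2) G_carrier(1) by simp
      qed
      then show ?thesis using C_kernel_fst[OF L(1)] by blast
    next
      case 2
      have "conjugacy_separable C F2" using conjugacy_separable_if_hereditarily F2.is_group hcs(2) by blast
      then obtain L where L: "C_kernel C F2 L" "\<forall>g \<in> carrier F2. inv2 y2 \<cdot> (g \<cdot> x2 \<cdot> inv2 g) \<notin> L"
        using conjugacy_separable_kernel[OF F2.is_group _ C(2,4) 2] by blast
      have "inv\<^bsub>GG\<^esub> y \<otimes>\<^bsub>GG\<^esub> (g \<otimes>\<^bsub>GG\<^esub> x \<otimes>\<^bsub>GG\<^esub> inv\<^bsub>GG\<^esub> g) \<notin> {g \<in> carrier GG. snd g \<in> L}" if g: "g \<in> carrier GG" for g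
      proof -
        obtain g1 g2 where g12: "g = (g1, g2)" by (cases g)
        then have "(g1, g2) \<in> G" using g by simp
        then show ?thesis using form g12 L(2) G_carrier(2) by simp
      qed
      then show ?thesis using C_kernel_snd[OF L(1)] by blast
    qed
  next
    case True
    then obtain a b' where a: "a \<in> carrier F1" "y1 = a \<otimes> x1 \<otimes> inv a"
      and b': "b' \<in> carrier F2" "y2 = b' \<cdot> x2 \<cdot> inv2 b'" unfolding conjugate_in_def by blast
    obtain b where b: "(a, b) \<in> G" using lift1[OF a(1)] by blast
    have bC: "b \<in> carrier F2" using G_carrier[OF b] by simp
    \<comment> \<open>The lift \<open>b\<close> of \<open>a\<close> need not agree with the given
      conjugator \<open>b'\<close>. After conjugating back by \<open>(a, b)\<close>, their
      discrepancy \<open>f2\<close> is all that is left.\<close>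
    define f2 where "f2 = inv2 b \<cdot> b'"
    have f2: "f2 \<in> carrier F2" using bC b' by (simp add: f2_def)
    have y2: "y2 = b \<cdot> (f2 \<cdot> x2 \<cdot> inv2 f2) \<cdot> inv2 b"
      unfolding b'(2) f2_def using bC b'(1) C by (simp add: F2.inv_mult_group F2.m_assoc F2.inv_mult_cancel)
    have nc': "\<not> conjugate_in GG (x1, x2) (x1, f2 \<cdot> x2 \<cdot> inv2 f2)"
    proof
      assume "conjugate_in GG (x1, x2) (x1, f2 \<cdot> x2 \<cdot> inv2 f2)"
      then obtain g1 g2 where g: "(g1, g2) \<in> G" "x1 = g1 \<otimes> x1 \<otimes> inv g1" "f2 \<cdot> x2 \<cdot> inv2 f2 = g2 \<cdot> x2 \<cdot> inv2 g2"
        unfolding conjugate_in_GG[OF xG] by blast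
      have gC: "g1 \<in> carrier F1" "g2 \<in> carrier F2" using G_carrier[OF g(1)] .
      have "y1 = (a \<otimes> g1) \<otimes> x1 \<otimes> inv (a \<otimes> g1)"
      proof -
        have "y1 = a \<otimes> (g1 \<otimes> x1 \<otimes> inv g1) \<otimes> inv a" using a(2) g(2) by simp
        then show ?thesis using a(1) gC C by (simp add: F1.inv_mult_group F1.m_assoc)
      qed
      moreover have "y2 = (b \<cdot> g2) \<cdot> x2 \<cdot> inv2 (b \<cdot> g2)"
        unfolding y2 g(3) using bC gC C by (simp add: F2.inv_mult_group F2.m_assoc)
      ultimately have "conjugate_in GG (x1, x2) (y1, y2)"
        unfolding conjugate_in_GG[OF xG] using G_mult[OF b g(1)] by blast
      then show False using nc xy by simp
    qed
    obtain L where L: "C_kernel C GG L" "\<forall>g1 g2. (g1, g2) \<in> G \<longrightarrow>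
       (inv x1 \<otimes> (g1 \<otimes> x1 \<otimes> inv g1), inv2 (f2 \<cdot> x2 \<cdot> inv2 f2) \<cdot> (g2 \<cdot> x2 \<cdot> inv2 g2)) \<notin> L"
      using separate_twisted_pair[OF ext hcs cc res per xG f2 nc'] by blast
    interpret L: normal L GG using C_kernel_normal[OF group_GG L(1)] .
    have "inv\<^bsub>GG\<^esub> y \<otimes>\<^bsub>GG\<^esub> (g \<otimes>\<^bsub>GG\<^esub> x \<otimes>\<^bsub>GG\<^esub> inv\<^bsub>GG\<^esub> g) \<notin> L" if g: "g \<in> carrier GG" for g
    proof
      assume gL: "inv\<^bsub>GG\<^esub> y \<otimes>\<^bsub>GG\<^esub> (g \<otimes>\<^bsub>GG\<^esub> x \<otimes>\<^bsub>GG\<^esub> inv\<^bsub>GG\<^esub> g) \<in> L"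
      obtain g1 g2 where g12: "g = (g1, g2)" by (cases g)
      then have gG: "(g1, g2) \<in> G" using g by simp
      have gC: "g1 \<in> carrier F1" "g2 \<in> carrier F2" using G_carrier[OF gG] .
      have abG: "(a, b) \<in> carrier GG" using b by simp
      have "inv\<^bsub>GG\<^esub> (a, b) \<otimes>\<^bsub>GG\<^esub> (inv y1 \<otimes> (g1 \<otimes> x1 \<otimes> inv g1), inv2 y2 \<cdot> (g2 \<cdot> x2 \<cdot> inv2 g2)) \<otimes>\<^bsub>GG\<^esub> (a, b) \<in> L"
        using L.inv_op_closed1[OF abG] gL form[OF gG g12] by simp
      then have "(inv a \<otimes> (inv y1 \<otimes> (g1 \<otimes> x1 \<otimes> inv g1)) \<otimes> a, inv2 b \<cdot> (inv2 y2 \<cdot> (g2 \<cdot> x2 \<cdot> inv2 g2)) \<cdot> b) \<in> L"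
        using inv_GG[OF b] by simp
      moreover have "inv a \<otimes> (inv y1 \<otimes> (g1 \<otimes> x1 \<otimes> inv g1)) \<otimes> a =
          inv x1 \<otimes> ((inv a \<otimes> g1) \<otimes> x1 \<otimes> inv (inv a \<otimes> g1))"
        unfolding a(2) using a(1) gC C by (simp add: F1.inv_mult_group F1.m_assoc F1.inv_mult_cancel)
      moreover have "inv2 b \<cdot> (inv2 y2 \<cdot> (g2 \<cdot> x2 \<cdot> inv2 g2)) \<cdot> b =
          inv2 (f2 \<cdot> x2 \<cdot> inv2 f2) \<cdot> ((inv2 b \<cdot> g2) \<cdot> x2 \<cdot> inv2 (inv2 b \<cdot> g2))"
        unfolding y2 using bC f2 gC C by (simp add: F2.inv_mult_group F2.m_assoc F2.inv_mult_cancel)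
      ultimately show False using L(2) G_mult[OF G_inv[OF b] gG] by metis
    qed
    then show ?thesis using L(1) by blast
  qed
qed

end

section \<open>The equivalence\<close>

text \<open>If a prime \<open>q\<close> in \<open>Q\<close> divided the order of \<open>x\<close>,
  then a power \<open>h\<close> of \<open>x\<close> would be non-trivial with
  \<open>h^q = 1\<close>. In a member of \<open>C\<close> the order of its image divides
  \<open>q\<close> and is coprime to \<open>q\<close>, so no such image could detect
  \<open>h\<close>.\<close>

lemma (in finite_pseudovariety) coprime_order_group_of_residually:
  assumes A: "group A" "residually C A" "periodic_group A"
    and Q: "\<And>q. q \<in> Q \<Longrightarrow> Factorial_Ring.prime q" "\<And>M. M \<in> C \<Longrightarrow> coprime_order_group Q M"
  shows "coprime_order_group Q A"
  unfolding coprime_order_group_def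
proof (intro ballI conjI)
  interpret A: group A by (rule A)
  fix x assume x: "x \<in> carrier A"
  show ord: "group.ord A x \<noteq> 0" using A(3) x by (simp add: periodic_group_def)
  fix q assume q: "q \<in> Q"
  show "coprime (group.ord A x) q"
  proof (rule ccontr)
    assume "\<not> coprime (group.ord A x) q"
    then have "q dvd A.ord x" using prime_imp_coprime[OF Q(1)[OF q]] coprime_commute by blast
    then obtain m where m: "A.ord x = q * m" by (elim dvdE)
    have q1: "1 < q" using Q(1)[OF q] by (rule prime_gt_1_nat)
    define h where "h = x [^]\<^bsub>A\<^esub> m"
    have hC: "h \<in> carrier A" using x by (simp add: h_def)
    have "\<not> A.ord x dvd m" using ord q1 m by (auto dest!: dvd_imp_le)
    then have h1: "h \<noteq> \<one>\<^bsub>A\<^esub>" unfolding h_def using A.pow_eq_id[OF x] by simp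
    have hq: "h [^]\<^bsub>A\<^esub> q = \<one>\<^bsub>A\<^esub>"
      unfolding h_def using A.nat_pow_pow[OF x, of m q] A.pow_ord_eq_1[OF x] m by (simp add: mult.commute)
    obtain M \<phi> where M: "M \<in> C" "\<phi> \<in> hom A M" "\<phi> h \<noteq> \<one>\<^bsub>M\<^esub>"
      using A(2) hC h1 unfolding residually_def by blast
    interpret \<phi>: group_hom A M \<phi> using A(1) C_group[OF M(1)] M(2) by (simp add: group_hom_def group_hom_axioms_def)
    have "\<phi> h [^]\<^bsub>M\<^esub> q = \<one>\<^bsub>M\<^esub>" using \<phi>.hom_nat_pow[OF hC, of q] hq by simp
    then have "\<phi>.H.ord (\<phi> h) dvd q" using \<phi>.H.pow_eq_id hC by simp
    moreover have "coprime (\<phi>.H.ord (\<phi> h)) q"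
      using Q(2)[OF M(1)] q hC unfolding coprime_order_group_def by simp
    ultimately have "\<phi>.H.ord (\<phi> h) = 1" by (metis coprime_absorb_left nat_dvd_1_iff_1)
    then show False using \<phi>.H.pow_ord_eq_1[of "\<phi> h"] hC M(3) by simp
  qed
qed

lemma (in group) infinite_nontrivial_normal:
  assumes "no_nontrivial_finite_normal_subgroups G" "N \<lhd> G" "N \<noteq> {\<one>}"
  shows "infinite N"
  using assms unfolding no_nontrivial_finite_normal_subgroups_def by blast

lemma primitive_element_in_normal_subgroup:
  assumes "acylindrically_hyperbolic TYPE('s) F" "cyclic_centralizers F" "N \<lhd> F" "infinite N"
  shows "\<exists>x \<in> N. centralizer F x \<subseteq> N"
proof -
  interpret normal N F by fact
  obtain n where n: "n \<in> N" "\<forall>v \<in> centralizer F (\<one>\<^bsub>F\<^esub> \<otimes>\<^bsub>F\<^esub> n). \<exists>i::int. v = (\<one>\<^bsub>F\<^esub> \<otimes>\<^bsub>F\<^esub> n) [^]\<^bsub>F\<^esub> i"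
    using primitive_element_in_coset[OF assms one_closed] by blast
  have "\<one>\<^bsub>F\<^esub> \<otimes>\<^bsub>F\<^esub> n = n" using n(1) by simp
  then have "centralizer F n \<subseteq> N" using n subgroup_int_pow_closed[OF subgroup_axioms n(1)] by auto
  then show ?thesis using n(1) by blast
qed

theorem theorem7p6:
  fixes Q :: "nat set"
    and C :: "nat monoid set"
    and F1 :: "'a monoid"
    and F2 :: "'b monoid"
    and G :: "('a \<times> 'b) set"
    and N1 :: "'a set"
  assumes "Q \<noteq> {}" and "\<And>q. q \<in> Q \<Longrightarrow> Factorial_Ring.prime q"
    and "pseudovariety_of_finite_coprime_order_groups Q C"
    and "extension_closed C"
    and "group F1" and "group F2"
    and "hereditarily_conjugacy_separable C F1"
    and "hereditarily_conjugacy_separable C F2"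
    and "acylindrically_hyperbolic TYPE('s1) F1"
    and "acylindrically_hyperbolic TYPE('s2) F2"
    and "cyclic_centralizers F1" and "cyclic_centralizers F2"
    and "no_nontrivial_finite_normal_subgroups F1"
    and "no_nontrivial_finite_normal_subgroups F2"
    and "full_subdirect_product F1 F2 G"
    and "N1 = first_factor_part F1 F2 G"
  shows "(conjugacy_separable C ((F1 \<times>\<times> F2)\<lparr>carrier := G\<rparr>) \<longleftrightarrow>
           residually C (F1 Mod N1) \<and> coprime_order_group Q (F1 Mod N1)) \<and>
         (residually C (F1 Mod N1) \<and> coprime_order_group Q (F1 Mod N1) \<longleftrightarrow>
           residually C (F1 Mod N1) \<and> periodic_group (F1 Mod N1))"
proof -
  have C: "pseudovariety_of_finite_groups C" "\<And>M. M \<in> C \<Longrightarrow> coprime_order_group Q M"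
    using assms(3) unfolding pseudovariety_of_finite_coprime_order_groups_def by blast+
  have sub: "subdirect_product F1 F2 G" using assms(15) unfolding full_subdirect_product_def by blast
  interpret S: subdirect_pseudovariety F1 F2 G C
    unfolding subdirect_pseudovariety_def subdirect_def subdirect_axioms_def finite_pseudovariety_def
    using assms(5,6) sub C(1) by blast
  have N1: "N1 = S.N1" using assms(16) unfolding first_factor_part_def S.N1_def .
  have GG: "(F1 \<times>\<times> F2)\<lparr>carrier := G\<rparr> = S.GG" unfolding S.GG_def ..
  have inf1: "infinite S.N1"
  proof (rule S.F1.infinite_nontrivial_normal[OF assms(13) S.N1_normal])
    have "G \<inter> (carrier F1 \<times> {\<one>\<^bsub>F2\<^esub>}) = {(\<one>\<^bsub>F1\<^esub>, \<one>\<^bsub>F2\<^esub>)}" if "S.N1 = {\<one>\<^bsub>F1\<^esub>}"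
      using that S.N1I S.G_one by auto
    then show "S.N1 \<noteq> {\<one>\<^bsub>F1\<^esub>}" using assms(15) unfolding full_subdirect_product_def by blast
  qed
  have inf2: "infinite S.N2"
  proof (rule S.F2.infinite_nontrivial_normal[OF assms(14) S.N2_normal])
    have "G \<inter> ({\<one>\<^bsub>F1\<^esub>} \<times> carrier F2) = {(\<one>\<^bsub>F1\<^esub>, \<one>\<^bsub>F2\<^esub>)}" if "S.N2 = {\<one>\<^bsub>F2\<^esub>}"
      using that S.N2I S.G_one by auto
    then show "S.N2 \<noteq> {\<one>\<^bsub>F2\<^esub>}" using assms(15) unfolding full_subdirect_product_def by blast
  qed
  obtain q where q: "q \<in> Q" using assms(1) by blast
  have cop: "coprime (group.ord M x) q" if "M \<in> C" "x \<in> carrier M" for M x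
    using C(2)[OF that(1)] that(2) q unfolding coprime_order_group_def by blast
  have q1: "1 < q" using assms(2)[OF q] by (rule prime_gt_1_nat)
  have nec: "residually C (F1 Mod S.N1) \<and> periodic_group (F1 Mod S.N1)" if cs: "conjugacy_separable C S.GG"
  proof
    obtain x1 where x1: "x1 \<in> S.N1" "centralizer F1 x1 \<subseteq> S.N1"
      using primitive_element_in_normal_subgroup[OF assms(9,11) S.N1_normal inf1] by blast
    obtain x2 where x2: "x2 \<in> S.N2" "centralizer F2 x2 \<subseteq> S.N2"
      using primitive_element_in_normal_subgroup[OF assms(10,12) S.N2_normal inf2] by blast
    show "residually C (F1 Mod S.N1)" by (rule S.residually_of_conjugacy_separable[OF cs x1 x2])
    show "periodic_group (F1 Mod S.N1)"
    proof (rule S.periodic_of_conjugacy_separable[OF cs cop q1])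
      show "\<exists>n \<in> S.N1. \<forall>v \<in> centralizer F1 (h \<otimes>\<^bsub>F1\<^esub> n). \<exists>i::int. v = (h \<otimes>\<^bsub>F1\<^esub> n) [^]\<^bsub>F1\<^esub> i" if "h \<in> carrier F1" for h
        using primitive_element_in_coset[OF assms(9,11) S.N1_normal inf1 that] by blast
      show "\<exists>n \<in> S.N2. \<forall>v \<in> centralizer F2 (h \<otimes>\<^bsub>F2\<^esub> n). \<exists>i::int. v = (h \<otimes>\<^bsub>F2\<^esub> n) [^]\<^bsub>F2\<^esub> i" if "h \<in> carrier F2" for h
        using primitive_element_in_coset[OF assms(10,12) S.N2_normal inf2 that] by blast
    qed
  qed
  have suf: "conjugacy_separable C S.GG" if "residually C (F1 Mod S.N1)" "periodic_group (F1 Mod S.N1)"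
    by (rule S.conjugacy_separable_of_residually[OF assms(4,7,8,11,12) that])
  have periodic: "periodic_group (F1 Mod S.N1)" if "coprime_order_group Q (F1 Mod S.N1)"
    using that unfolding coprime_order_group_def periodic_group_def by blast
  have coprime: "coprime_order_group Q (F1 Mod S.N1)" if "residually C (F1 Mod S.N1)" "periodic_group (F1 Mod S.N1)"
    by (rule S.coprime_order_group_of_residually[OF S.N1.factorgroup_is_group that assms(2) C(2)])
  show ?thesis unfolding N1 GG using nec suf periodic coprime by blast
qed

end
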